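(* Let $(M,\omega)$ be a symplectic manifold of dimension $2n$. Then each point of $M$ has a neighbourhood $V\subset M$ and coordinate functions $x_1,y_1,\dots,x_n,y_n\in C^\infty(V;\mathbb{R})$ on $V$ such that $\omega|_V=\sum_{j=1}^{n}\mathrm{d}x_j\wedge\mathrm{d}y_j$.
   Context: All objects are $C^\infty$; manifolds are real, Hausdorff, paracompact and connected. $C^\infty(V;\mathbb{R})$ denotes the set of smooth real-valued functions on $V$. A symplectic manifold is a manifold with a closed nondegenerate $2$-form $\omega$. *)

theory Defs
  imports "HOL-Analysis.Analysis"
begin

section \<open>Smooth maps between normed spaces\<close>

text \<open>
  \<^term>\<open>S\<close> is meant to be open. On a finite-dimensional space, continuity of all the
  directional maps \<open>x \<mapsto> Df(x) v\<close> is continuity of \<open>Df\<close>, so this is the usual class \<open>C\<^sup>k\<close>.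
\<close>

primrec C_diff_on ::
  "nat \<Rightarrow> 'a::real_normed_vector set \<Rightarrow> ('a \<Rightarrow> 'b::real_normed_vector) \<Rightarrow> bool" where
  "C_diff_on 0 S f \<longleftrightarrow> continuous_on S f"
| "C_diff_on (Suc k) S f \<longleftrightarrow>
     (\<forall>x\<in>S. f differentiable (at x)) \<and>
     (\<forall>v. C_diff_on k S (\<lambda>x. frechet_derivative f (at x) v))"

definition smooth_on ::
  "'a::real_normed_vector set \<Rightarrow> ('a \<Rightarrow> 'b::real_normed_vector) \<Rightarrow> bool" where
  "smooth_on S f \<longleftrightarrow> (\<forall>k. C_diff_on k S f)"


section \<open>Smooth manifolds\<close>

definition paracompact_space :: "'a topology \<Rightarrow> bool" where
  "paracompact_space T \<longleftrightarrow>
     (\<forall>\<U>. (\<forall>U\<in>\<U>. openin T U) \<and> \<Union>\<U> = topspace T \<longrightarrow>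
        (\<exists>\<V>. (\<forall>V\<in>\<V>. openin T V) \<and> \<Union>\<V> = topspace T \<and>
             (\<forall>V\<in>\<V>. \<exists>U\<in>\<U>. V \<subseteq> U) \<and> locally_finite_in T \<V>))"

text \<open>
  A chart is a pair of a domain \<open>U\<close> and a map; the values of the map outside \<open>U\<close> are irrelevant.
  The model space is a Euclidean space \<open>'e\<close>, so the dimension of the manifold is \<open>DIM('e)\<close>.
\<close>

type_synonym ('a, 'e) chart = "'a set \<times> ('a \<Rightarrow> 'e)"

abbreviation chart_dom :: "('a, 'e) chart \<Rightarrow> 'a set" where
  "chart_dom c \<equiv> fst c"

abbreviation chart_map :: "('a, 'e) chart \<Rightarrow> 'a \<Rightarrow> 'e" where
  "chart_map c \<equiv> snd c"

definition chart_img :: "('a, 'e) chart \<Rightarrow> 'e set" where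
  "chart_img c = chart_map c ` chart_dom c"

definition chart_inv :: "('a, 'e) chart \<Rightarrow> 'e \<Rightarrow> 'a" where
  "chart_inv c = inv_into (chart_dom c) (chart_map c)"

definition transition :: "('a, 'e) chart \<Rightarrow> ('a, 'e) chart \<Rightarrow> 'e \<Rightarrow> 'e" where
  "transition c d = chart_map d \<circ> chart_inv c"

definition is_chart :: "'a topology \<Rightarrow> ('a, 'e::euclidean_space) chart \<Rightarrow> bool" where
  "is_chart T c \<longleftrightarrow>
     openin T (chart_dom c) \<and> open (chart_img c) \<and>
     homeomorphic_map (subtopology T (chart_dom c)) (top_of_set (chart_img c)) (chart_map c)"

definition compatible_charts ::
  "('a, 'e::euclidean_space) chart \<Rightarrow> ('a, 'e) chart \<Rightarrow> bool" where
  "compatible_charts c d \<longleftrightarrow>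
     smooth_on (chart_map c ` (chart_dom c \<inter> chart_dom d)) (transition c d) \<and>
     smooth_on (chart_map d ` (chart_dom c \<inter> chart_dom d)) (transition d c)"

text \<open>The smooth structure is given by its maximal atlas \<open>A\<close>.\<close>

locale smooth_manifold =
  fixes T :: "'a topology"
    and A :: "('a, 'e::euclidean_space) chart set"
  assumes hausdorff: "Hausdorff_space T"
    and paracompact: "paracompact_space T"
    and connected: "connected_space T"
    and charts: "c \<in> A \<Longrightarrow> is_chart T c"
    and cover: "(\<Union>c\<in>A. chart_dom c) = topspace T"
    and compatible: "c \<in> A \<Longrightarrow> d \<in> A \<Longrightarrow> compatible_charts c d"
    and maximal: "is_chart T c \<Longrightarrow> (\<And>d. d \<in> A \<Longrightarrow> compatible_charts c d) \<Longrightarrow> c \<in> A"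

definition smooth_functions ::
  "('a, 'e::euclidean_space) chart set \<Rightarrow> 'a set \<Rightarrow> ('a \<Rightarrow> real) set" where
  "smooth_functions A V =
     {f. \<forall>c\<in>A. smooth_on (chart_map c ` (chart_dom c \<inter> V)) (f \<circ> chart_inv c)}"

text \<open>
  The functions \<open>f i\<close>, \<open>i \<in> I\<close>, are coordinate functions on \<open>V\<close> if they are the components of a
  chart with domain \<open>V\<close>. The bijection \<open>b\<close> identifies \<open>\<real>\<^sup>I\<close> with \<open>'e\<close>; as permuting the basis
  is a linear isomorphism and \<open>A\<close> is maximal, any other choice of \<open>b\<close> gives the same notion.
\<close>

definition coordinate_functions ::
  "('a, 'e::euclidean_space) chart set \<Rightarrow> 'a set \<Rightarrow> 'i set \<Rightarrow> ('i \<Rightarrow> 'a \<Rightarrow> real) \<Rightarrow> bool" where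
  "coordinate_functions A V I f \<longleftrightarrow>
     (\<exists>b. bij_betw b I (Basis :: 'e set) \<and> (V, \<lambda>p. \<Sum>i\<in>I. f i p *\<^sub>R b i) \<in> A)"


section \<open>Tangent vectors and differential forms\<close>

text \<open>
  A tangent vector at \<open>p\<close> is a family of vectors of the model space, one for each chart around
  \<open>p\<close>, which are related by the derivatives of the transition maps. The value \<open>0\<close> at all other
  indices makes the family unique. The vector space operations are pointwise.
\<close>

type_synonym ('a, 'e) tangent = "('a, 'e) chart \<Rightarrow> 'e"

definition charts_at :: "('a, 'e) chart set \<Rightarrow> 'a \<Rightarrow> ('a, 'e) chart set" where
  "charts_at A p = {c \<in> A. p \<in> chart_dom c}"

definition tangent_space ::
  "('a, 'e::euclidean_space) chart set \<Rightarrow> 'a \<Rightarrow> ('a, 'e) tangent set" where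
  "tangent_space A p =
     {v. (\<forall>c\<in>charts_at A p. \<forall>d\<in>charts_at A p.
            v d = frechet_derivative (transition c d) (at (chart_map c p)) (v c)) \<and>
         (\<forall>c. c \<notin> charts_at A p \<longrightarrow> v c = 0)}"

text \<open>The tangent vector at \<open>p\<close> whose representative in the chart \<open>c\<close> is \<open>a\<close>.\<close>

definition tangent_vector ::
  "('a, 'e::euclidean_space) chart set \<Rightarrow> ('a, 'e) chart \<Rightarrow> 'a \<Rightarrow> 'e \<Rightarrow> ('a, 'e) tangent" where
  "tangent_vector A c p a =
     (\<lambda>d. if d \<in> charts_at A p
          then frechet_derivative (transition c d) (at (chart_map c p)) a else 0)"

type_synonym ('a, 'e) one_form = "'a \<Rightarrow> ('a, 'e) tangent \<Rightarrow> real"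
type_synonym ('a, 'e) two_form = "'a \<Rightarrow> ('a, 'e) tangent \<Rightarrow> ('a, 'e) tangent \<Rightarrow> real"

text \<open>
  The differential of a function that is smooth near \<open>p\<close>, computed in some chart around \<open>p\<close>.
  By the chain rule the value on tangent vectors at \<open>p\<close> does not depend on the chart.
\<close>

definition differential ::
  "('a, 'e::euclidean_space) chart set \<Rightarrow> ('a \<Rightarrow> real) \<Rightarrow> ('a, 'e) one_form" where
  "differential A f p v =
     (let c = (SOME c. c \<in> charts_at A p)
      in frechet_derivative (f \<circ> chart_inv c) (at (chart_map c p)) (v c))"

definition wedge :: "('a, 'e) one_form \<Rightarrow> ('a, 'e) one_form \<Rightarrow> ('a, 'e) two_form" where
  "wedge \<alpha> \<beta> p u v = \<alpha> p u * \<beta> p v - \<alpha> p v * \<beta> p u"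

definition alternating_bilinear_on ::
  "('a, 'e::euclidean_space) tangent set \<Rightarrow>
   (('a, 'e) tangent \<Rightarrow> ('a, 'e) tangent \<Rightarrow> real) \<Rightarrow> bool" where
  "alternating_bilinear_on W B \<longleftrightarrow>
     (\<forall>u\<in>W. \<forall>v\<in>W. \<forall>w\<in>W. \<forall>r s.
        B (\<lambda>c. r *\<^sub>R u c + s *\<^sub>R v c) w = r * B u w + s * B v w \<and>
        B w (\<lambda>c. r *\<^sub>R u c + s *\<^sub>R v c) = r * B w u + s * B w v) \<and>
     (\<forall>v\<in>W. B v v = 0)"

text \<open>
  The local representative of a 2-form in a chart \<open>c\<close>: for basis vectors \<open>a\<close> and \<open>b\<close> of the model
  space these are its coefficient functions, defined on the image of the chart.
\<close>

definition form_rep ::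
  "('a, 'e::euclidean_space) chart set \<Rightarrow> ('a, 'e) two_form \<Rightarrow> ('a, 'e) chart \<Rightarrow>
   'e \<Rightarrow> 'e \<Rightarrow> 'e \<Rightarrow> real" where
  "form_rep A \<omega> c z a b =
     \<omega> (chart_inv c z) (tangent_vector A c (chart_inv c z) a) (tangent_vector A c (chart_inv c z) b)"

definition smooth_two_form ::
  "'a topology \<Rightarrow> ('a, 'e::euclidean_space) chart set \<Rightarrow> ('a, 'e) two_form \<Rightarrow> bool" where
  "smooth_two_form T A \<omega> \<longleftrightarrow>
     (\<forall>p\<in>topspace T. alternating_bilinear_on (tangent_space A p) (\<omega> p)) \<and>
     (\<forall>c\<in>A. \<forall>a b. smooth_on (chart_img c) (\<lambda>z. form_rep A \<omega> c z a b))"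

text \<open>
  The exterior derivative of a 2-form \<open>\<eta>\<close> on an open subset of the model space:
  the alternating sum \<open>d\<eta>(a,b,e) = D\<^sub>a \<eta>(b,e) - D\<^sub>b \<eta>(a,e) + D\<^sub>e \<eta>(a,b)\<close> on constant vector fields.
\<close>

definition ext_deriv ::
  "('e::euclidean_space \<Rightarrow> 'e \<Rightarrow> 'e \<Rightarrow> real) \<Rightarrow> 'e \<Rightarrow> 'e \<Rightarrow> 'e \<Rightarrow> 'e \<Rightarrow> real" where
  "ext_deriv \<eta> z a b e =
     frechet_derivative (\<lambda>z. \<eta> z b e) (at z) a
     - frechet_derivative (\<lambda>z. \<eta> z a e) (at z) b
     + frechet_derivative (\<lambda>z. \<eta> z a b) (at z) e"

definition closed_two_form ::
  "('a, 'e::euclidean_space) chart set \<Rightarrow> ('a, 'e) two_form \<Rightarrow> bool" where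
  "closed_two_form A \<omega> \<longleftrightarrow>
     (\<forall>c\<in>A. \<forall>z\<in>chart_img c. \<forall>a b e. ext_deriv (form_rep A \<omega> c) z a b e = 0)"

definition nondegenerate_two_form ::
  "'a topology \<Rightarrow> ('a, 'e::euclidean_space) chart set \<Rightarrow> ('a, 'e) two_form \<Rightarrow> bool" where
  "nondegenerate_two_form T A \<omega> \<longleftrightarrow>
     (\<forall>p\<in>topspace T. \<forall>u\<in>tangent_space A p.
        (\<forall>v\<in>tangent_space A p. \<omega> p u v = 0) \<longrightarrow> u = (\<lambda>c. 0))"

locale symplectic_manifold = smooth_manifold T A
  for T :: "'a topology" and A :: "('a, 'e::euclidean_space) chart set" +
  fixes \<omega> :: "('a, 'e) two_form"
  assumes smooth_form: "smooth_two_form T A \<omega>"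
    and closed_form: "closed_two_form A \<omega>"
    and nondegenerate: "nondegenerate_two_form T A \<omega>"

end

theory Submission
  imports Defs
begin

text \<open>
  This is Moser's argument. In a chart around \<open>p\<close>, with \<open>z\<^sub>0\<close> the image of \<open>p\<close>, let \<open>\<omega>\<^sub>0\<close> be the
  form with the constant coefficients of \<open>\<omega>\<close> at \<open>z\<^sub>0\<close>. By the Poincare lemma \<open>\<omega> - \<omega>\<^sub>0 = d\<alpha>\<close>, where
  \<open>\<alpha>\<close> vanishes to second order at \<open>z\<^sub>0\<close>. Near \<open>z\<^sub>0\<close> the forms \<open>\<omega>\<^sub>t = \<omega> + t (\<omega>\<^sub>0 - \<omega>)\<close> are
  nondegenerate, so \<open>\<omega>\<^sub>t(X\<^sub>t, -) = \<alpha>\<close> defines a field \<open>X\<^sub>t\<close> whose flow \<open>\<phi>\<^sub>t\<close> satisfies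
  \<open>\<phi>\<^sub>t\<^sup>*\<omega>\<^sub>t = \<omega>\<close>. Hence \<open>\<phi>\<^sub>1\<close> pulls \<open>\<omega>\<^sub>0\<close> back to \<open>\<omega>\<close>, and a symplectic basis for \<open>\<omega>\<^sub>0\<close>
  brings it into normal form.

  Since \<open>X\<^sub>t\<close> also vanishes to second order, it is \<open>1/2\<close>-Lipschitz near \<open>z\<^sub>0\<close>. So on the time interval
  \<open>[0,1]\<close> the Picard operator is a contraction for the supremum norm, and this contraction
  estimate takes the place of Gronwall's inequality.
\<close>

section \<open>Smoothness in the presence of a parameter\<close>

text \<open>A 2-form is handled as a field of operators, \<open>\<Omega> z a \<bullet> b\<close>
  being its value on \<open>a\<close> and \<open>b\<close>. Nondegeneracy becomes invertibility, and
  solving for the field means inverting a smooth family of operators. The second order of vanishing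
  comes from subtracting the constant form: the radial homotopy yields the primitive
  \<open>C z (z - z0)\<close>, both of whose factors are zero at \<open>z0\<close>. This makes the
  Lipschitz constant small and also keeps the trajectories that start near the centre inside a ball
  up to time 1. The main obstacle is smooth dependence of the flow on its starting point. The
  candidate for the derivative is constructed as the solution of the linearised integral equation
  and only then compared with the difference of two solutions. Continuity in time suffices, because
  the time derivatives are read off from the integral equations. The inverse of the time-one map
  comes from the inverse function theorem, not from the reversed flow: a linear map that pulls a
  form back to a nondegenerate one is injective.\<close>

text \<open>
  \<^term>\<open>P\<close> is the range of a parameter (time) in which only continuity is required, so it need not be
  open. With a one-point \<^term>\<open>P\<close> this is \<^const>\<open>C_diff_on\<close>, and one calculus serves both notions.
\<close>

primrec pdiff_on ::
  "nat \<Rightarrow> 'p::topological_space set \<Rightarrow> 'a::euclidean_space set \<Rightarrow> ('p \<Rightarrow> 'a \<Rightarrow> 'b::real_normed_vector) \<Rightarrow> bool" where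
  "pdiff_on 0 P S f \<longleftrightarrow> continuous_on (P \<times> S) (\<lambda>(p, x). f p x)"
| "pdiff_on (Suc k) P S f \<longleftrightarrow> continuous_on (P \<times> S) (\<lambda>(p, x). f p x) \<and>
     (\<exists>f'. (\<forall>p\<in>P. \<forall>x\<in>S. (f p has_derivative f' p x) (at x)) \<and>
           (\<forall>v. pdiff_on k P S (\<lambda>p x. f' p x v)))"

lemma pdiff_on_continuous: "pdiff_on k P S f \<Longrightarrow> continuous_on (P \<times> S) (\<lambda>(p, x). f p x)"
  by (cases k) auto

lemma pdiff_on_SucI:
  assumes "continuous_on (P \<times> S) (\<lambda>(p, x). f p x)"
    and "\<And>p x. p \<in> P \<Longrightarrow> x \<in> S \<Longrightarrow> (f p has_derivative f' p x) (at x)"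
    and "\<And>v. pdiff_on k P S (\<lambda>p x. f' p x v)"
  shows "pdiff_on (Suc k) P S f"
  using assms by auto

lemma pdiff_on_SucE:
  assumes "pdiff_on (Suc k) P S f"
  obtains f' where "\<And>p x. p \<in> P \<Longrightarrow> x \<in> S \<Longrightarrow> (f p has_derivative f' p x) (at x)"
    and "\<And>v. pdiff_on k P S (\<lambda>p x. f' p x v)"
  using assms by auto

lemma pdiff_on_SucD: "pdiff_on (Suc k) P S f \<Longrightarrow> pdiff_on k P S f"
proof (induction k arbitrary: f)
  case 0
  then show ?case by simp
next
  case (Suc k)
  from Suc.prems obtain f' where f': "\<And>p x. p \<in> P \<Longrightarrow> x \<in> S \<Longrightarrow> (f p has_derivative f' p x) (at x)"
    "\<And>v. pdiff_on (Suc k) P S (\<lambda>p x. f' p x v)" by (rule pdiff_on_SucE) blast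
  show ?case
    by (rule pdiff_on_SucI[OF pdiff_on_continuous[OF Suc.prems] f'(1) Suc.IH[OF f'(2)]])
qed

lemma pdiff_on_cong:
  assumes "open S" "\<And>p x. p \<in> P \<Longrightarrow> x \<in> S \<Longrightarrow> f p x = g p x" "pdiff_on k P S f"
  shows "pdiff_on k P S g"
proof (cases k)
  case 0
  have "continuous_on (P \<times> S) (\<lambda>(p, x). f p x) = continuous_on (P \<times> S) (\<lambda>(p, x). g p x)"
    by (rule continuous_on_cong) (use assms(2) in auto)
  with assms(3) show ?thesis by (simp add: 0)
next
  case (Suc j)
  with assms(3) obtain f' where f': "\<And>p x. p \<in> P \<Longrightarrow> x \<in> S \<Longrightarrow> (f p has_derivative f' p x) (at x)"
    "\<And>v. pdiff_on j P S (\<lambda>p x. f' p x v)" using pdiff_on_SucE by blast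
  have "continuous_on (P \<times> S) (\<lambda>(p, x). g p x)"
    by (rule continuous_on_cong[THEN iffD1, OF refl _ pdiff_on_continuous[OF assms(3)]])
      (use assms(2) in auto)
  moreover have "(g p has_derivative f' p x) (at x)" if "p \<in> P" "x \<in> S" for p x
    by (rule has_derivative_transform_within_open[OF f'(1)[OF that] assms(1)])
      (use that assms(2) in auto)
  ultimately show ?thesis unfolding Suc using f'(2) by (intro pdiff_on_SucI) auto
qed

text \<open>A constant \<open>h\<close> freezes the time or turns a single map into a constant
  family, and \<open>h\<close> the identity shrinks the domain. Any subset \<open>S'\<close> is
  admissible because derivatives are taken at \<open>x\<close> in the whole space, not within the
  set.\<close>

lemma pdiff_on_reparam:
  assumes "pdiff_on k P S f" "continuous_on Q h" "h ` Q \<subseteq> P" "S' \<subseteq> S"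
  shows "pdiff_on k Q S' (\<lambda>q. f (h q))"
proof -
  have c: "continuous_on (Q \<times> S') (\<lambda>(q, x). f (h q) x)" if "continuous_on (P \<times> S) (\<lambda>(p, x). f p x)"
    for f :: "'a \<Rightarrow> 'b \<Rightarrow> 'c"
  proof -
    have 1: "continuous_on (Q \<times> S') (\<lambda>z. (h (fst z), snd z))"
      by (intro continuous_intros continuous_on_compose2[OF assms(2)]) auto
    have "(\<lambda>z. (h (fst z), snd z)) ` (Q \<times> S') \<subseteq> P \<times> S"
      using assms(3,4) by auto
    then show ?thesis
      using continuous_on_compose2[OF that 1] by (simp add: case_prod_beta)
  qed
  show ?thesis using assms(1)
  proof (induction k arbitrary: f)
    case 0
    then show ?case using c by auto
  next
    case (Suc k)
    obtain f' where f': "\<And>p x. p \<in> P \<Longrightarrow> x \<in> S \<Longrightarrow> (f p has_derivative f' p x) (at x)"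
      "\<And>v. pdiff_on k P S (\<lambda>p x. f' p x v)" using pdiff_on_SucE[OF Suc.prems] by blast
    show ?case
      by (rule pdiff_on_SucI[OF c[OF pdiff_on_continuous[OF Suc.prems]], of "\<lambda>q. f' (h q)"])
        (use f' Suc.IH assms(3,4) in blast)+
  qed
qed

lemma pdiff_on_param: 
  assumes "continuous_on P c" shows "pdiff_on k P S (\<lambda>p x. c p)"
proof -
  have c: "continuous_on (P \<times> S) (\<lambda>(p, x). c p)"
    unfolding case_prod_beta by (intro continuous_on_compose2[OF assms]) (auto intro!: continuous_intros)
  have 0: "pdiff_on k P S (\<lambda>p x. 0::'b)" for k
    by (induction k) (auto intro!: exI[of _ "\<lambda>p x v. 0"])
  show ?thesis
  proof (cases k)
    case (Suc j)
    show ?thesis unfolding Suc using c 0 by (intro pdiff_on_SucI[where f'="\<lambda>p x v. 0"]) auto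
  qed (use c in auto)
qed

lemma pdiff_on_const [simp]: "pdiff_on k P S (\<lambda>p x. c)"
  by (rule pdiff_on_param) simp

lemma pdiff_on_linear:
  assumes "bounded_linear L" "pdiff_on k P S f"
  shows "pdiff_on k P S (\<lambda>p x. L (f p x))"
  using assms(2)
proof (induction k arbitrary: f)
  case 0
  then show ?case by (auto simp: case_prod_beta intro: bounded_linear.continuous_on[OF assms(1)])
next
  case (Suc k)
  obtain f' where f': "\<And>p x. p \<in> P \<Longrightarrow> x \<in> S \<Longrightarrow> (f p has_derivative f' p x) (at x)"
    "\<And>v. pdiff_on k P S (\<lambda>p x. f' p x v)" using pdiff_on_SucE[OF Suc.prems] by blast
  have "continuous_on (P \<times> S) (\<lambda>(p, x). L (f p x))"
    using pdiff_on_continuous[OF Suc.prems]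
    by (auto simp: case_prod_beta intro: bounded_linear.continuous_on[OF assms(1)])
  then show ?case
    by (rule pdiff_on_SucI[where f'="\<lambda>p x v. L (f' p x v)"])
      (auto intro: bounded_linear.has_derivative[OF assms(1) f'(1)] Suc.IH f'(2))
qed

lemma pdiff_on_id: "pdiff_on k P S (\<lambda>p x. x)"
proof (cases k)
  case (Suc j)
  show ?thesis unfolding Suc
    by (intro pdiff_on_SucI[where f'="\<lambda>p x v. v"])
      (auto simp: case_prod_beta intro!: continuous_intros)
qed (auto simp: case_prod_beta intro!: continuous_intros)

lemma pdiff_on_add:
  assumes "pdiff_on k P S f" "pdiff_on k P S g"
  shows "pdiff_on k P S (\<lambda>p x. f p x + g p x)"
  using assms
proof (induction k arbitrary: f g)
  case 0
  then show ?case by (auto simp: case_prod_beta intro!: continuous_intros)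
next
  case (Suc k)
  obtain f' where f': "\<And>p x. p \<in> P \<Longrightarrow> x \<in> S \<Longrightarrow> (f p has_derivative f' p x) (at x)"
    "\<And>v. pdiff_on k P S (\<lambda>p x. f' p x v)" using pdiff_on_SucE[OF Suc.prems(1)] by blast
  obtain g' where g': "\<And>p x. p \<in> P \<Longrightarrow> x \<in> S \<Longrightarrow> (g p has_derivative g' p x) (at x)"
    "\<And>v. pdiff_on k P S (\<lambda>p x. g' p x v)" using pdiff_on_SucE[OF Suc.prems(2)] by blast
  show ?case
    by (rule pdiff_on_SucI[where f'="\<lambda>p x v. f' p x v + g' p x v"])
      (use pdiff_on_continuous[OF Suc.prems(1)] pdiff_on_continuous[OF Suc.prems(2)] in
        \<open>auto simp: case_prod_beta intro!: continuous_intros has_derivative_add f' g' Suc.IH\<close>)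
qed

lemma pdiff_on_diff:
  assumes "pdiff_on k P S f" "pdiff_on k P S g"
  shows "pdiff_on k P S (\<lambda>p x. f p x - g p x)"
  using pdiff_on_add[OF assms(1) pdiff_on_linear[OF bounded_linear_minus[OF bounded_linear_ident] assms(2)]]
  by simp

lemma pdiff_on_sum:
  assumes "\<And>i. i \<in> I \<Longrightarrow> pdiff_on k P S (f i)"
  shows "pdiff_on k P S (\<lambda>p x. \<Sum>i\<in>I. f i p x)"
  using assms
  by (induction I rule: infinite_finite_induct) (auto intro: pdiff_on_add)

lemma pdiff_on_bilinear:
  assumes B: "bounded_bilinear B" and "pdiff_on k P S f" "pdiff_on k P S g"
  shows "pdiff_on k P S (\<lambda>p x. B (f p x) (g p x))"
  using assms(2,3)
proof (induction k arbitrary: f g)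
  case 0
  then show ?case using bounded_bilinear.continuous_on[OF B] by (auto simp: case_prod_beta)
next
  case (Suc k)
  obtain f' where f': "\<And>p x. p \<in> P \<Longrightarrow> x \<in> S \<Longrightarrow> (f p has_derivative f' p x) (at x)"
    "\<And>v. pdiff_on k P S (\<lambda>p x. f' p x v)" using pdiff_on_SucE[OF Suc.prems(1)] by blast
  obtain g' where g': "\<And>p x. p \<in> P \<Longrightarrow> x \<in> S \<Longrightarrow> (g p has_derivative g' p x) (at x)"
    "\<And>v. pdiff_on k P S (\<lambda>p x. g' p x v)" using pdiff_on_SucE[OF Suc.prems(2)] by blast
  show ?case
    by (rule pdiff_on_SucI[where f'="\<lambda>p x v. B (f p x) (g' p x v) + B (f' p x v) (g p x)"])
      (use pdiff_on_continuous[OF Suc.prems(1)] pdiff_on_continuous[OF Suc.prems(2)] Suc.prems[THEN pdiff_on_SucD] in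
        \<open>auto simp: case_prod_beta intro!: bounded_bilinear.continuous_on[OF B] bounded_bilinear.FDERIV[OF B] pdiff_on_add f' g' Suc.IH\<close>)
qed

lemma pdiff_on_compose:
  fixes g :: "'p::topological_space \<Rightarrow> 'b::euclidean_space \<Rightarrow> 'c::real_normed_vector"
  assumes "pdiff_on k P T g" "pdiff_on k P S f" "\<And>p x. p \<in> P \<Longrightarrow> x \<in> S \<Longrightarrow> f p x \<in> T" "open S"
  shows "pdiff_on k P S (\<lambda>p x. g p (f p x))"
proof -
  have c: "continuous_on (P \<times> S) (\<lambda>(p, x). g p (f p x))"
    if "continuous_on (P \<times> T) (\<lambda>(p, x). g p x)" for g :: "'p \<Rightarrow> 'b \<Rightarrow> 'c"
  proof -
    have "continuous_on (P \<times> S) (\<lambda>z. f (fst z) (snd z))"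
      using pdiff_on_continuous[OF assms(2)] by (simp add: case_prod_beta)
    then have 1: "continuous_on (P \<times> S) (\<lambda>z. (fst z, f (fst z) (snd z)))"
      by (rule continuous_on_Pair[OF continuous_on_fst[OF continuous_on_id]])
    have "(\<lambda>z. (fst z, f (fst z) (snd z))) ` (P \<times> S) \<subseteq> P \<times> T"
      using assms(3) by auto
    then show ?thesis
      using continuous_on_compose2[OF that 1] by (simp add: case_prod_beta)
  qed
  show ?thesis
    using assms(1,2)
  proof (induction k arbitrary: g)
    case 0
    then show ?case using c by simp
  next
    case (Suc k)
    obtain f' where f': "\<And>p x. p \<in> P \<Longrightarrow> x \<in> S \<Longrightarrow> (f p has_derivative f' p x) (at x)"
      "\<And>v. pdiff_on k P S (\<lambda>p x. f' p x v)" using pdiff_on_SucE[OF Suc.prems(2)] by blast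
    obtain g' where g': "\<And>p x. p \<in> P \<Longrightarrow> x \<in> T \<Longrightarrow> (g p has_derivative g' p x) (at x)"
      "\<And>v. pdiff_on k P T (\<lambda>p x. g' p x v)" using pdiff_on_SucE[OF Suc.prems(1)] by blast
    \<comment> \<open>In the chain rule the outer derivative is applied to a direction that varies
      with the point, while the induction hypothesis covers fixed directions only. Expanding the
      inner derivative in the basis separates the two.\<close>
    have d: "pdiff_on k P S (\<lambda>p x. \<Sum>b\<in>Basis. (f' p x v \<bullet> b) *\<^sub>R g' p (f p x) b)" for v
      by (intro pdiff_on_sum pdiff_on_bilinear[OF bounded_bilinear_scaleR] Suc.IH g' f'
          pdiff_on_linear[OF bounded_linear_inner_left] pdiff_on_SucD[OF Suc.prems(2)])
    have e: "(\<Sum>b\<in>Basis. (f' p x v \<bullet> b) *\<^sub>R g' p (f p x) b) = g' p (f p x) (f' p x v)"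
      if "p \<in> P" "x \<in> S" for p x v
    proof -
      interpret bounded_linear "g' p (f p x)"
        using g'(1)[OF that(1) assms(3)[OF that]] has_derivative_bounded_linear by blast
      have "g' p (f p x) (f' p x v) = g' p (f p x) (\<Sum>b\<in>Basis. (f' p x v \<bullet> b) *\<^sub>R b)"
        by (simp add: euclidean_representation)
      also have "\<dots> = (\<Sum>b\<in>Basis. (f' p x v \<bullet> b) *\<^sub>R g' p (f p x) b)"
        by (simp add: sum scaleR)
      finally show ?thesis by simp
    qed
    show ?case
    proof (rule pdiff_on_SucI[where f'="\<lambda>p x v. g' p (f p x) (f' p x v)", OF c[OF pdiff_on_continuous[OF Suc.prems(1)]]])
      show "pdiff_on k P S (\<lambda>p x. g' p (f p x) (f' p x v))" for v
        by (rule pdiff_on_cong[OF assms(4) _ d]) (rule e)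
      show "((\<lambda>x. g p (f p x)) has_derivative (\<lambda>v. g' p (f p x) (f' p x v))) (at x)"
        if "p \<in> P" "x \<in> S" for p x
        using diff_chain_at[OF f'(1)[OF that] g'(1)[OF that(1) assms(3)[OF that]]]
        by (simp add: o_def)
    qed
  qed
qed

lemma pdiff_on_Pair:
  assumes "pdiff_on k P S f" "pdiff_on k P S g"
  shows "pdiff_on k P S (\<lambda>p x. (f p x, g p x))"
proof -
  have "bounded_linear (\<lambda>u. (u, 0))" "bounded_linear (\<lambda>u. (0, u))"
    by (simp_all add: bounded_linear_Pair bounded_linear_ident)
  from pdiff_on_add[OF pdiff_on_linear[OF this(1) assms(1)] pdiff_on_linear[OF this(2) assms(2)]]
  show ?thesis by simp
qed

text \<open>An operator is rebuilt linearly from its columns: \<open>E b y\<close> is the rank-one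
  operator sending \<open>v\<close> to \<open>(v \<bullet> b) *\<^sub>R y\<close>.\<close>

lemma pdiff_on_blinfun:
  fixes F :: "'p::topological_space \<Rightarrow> 'a::euclidean_space \<Rightarrow> ('c::euclidean_space \<Rightarrow>\<^sub>L 'b::real_normed_vector)"
  assumes "\<And>b. b \<in> Basis \<Longrightarrow> pdiff_on k P S (\<lambda>p x. F p x b)"
  shows "pdiff_on k P S F"
proof -
  define E :: "'c \<Rightarrow> 'b \<Rightarrow> 'c \<Rightarrow>\<^sub>L 'b"
    where "E b y = blinfun_scaleR_left y o\<^sub>L blinfun_inner_left b" for b y
  have "bounded_linear (E b)" for b
    unfolding E_def
    by (rule bounded_linear_compose[OF bounded_bilinear.bounded_linear_left[OF bounded_bilinear_blinfun_compose]
          bounded_linear_blinfun_scaleR_left])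
  then have "pdiff_on k P S (\<lambda>p x. \<Sum>b\<in>Basis. E b (F p x b))"
    by (intro pdiff_on_sum) (rule pdiff_on_linear[OF _ assms], simp_all)
  moreover have "(\<Sum>b\<in>Basis. E b (blinfun_apply A b)) = A" for A
    by (rule blinfun_euclidean_eqI) 
      (auto simp: E_def blinfun.sum_left inner_Basis if_distrib if_distribR sum.delta cong: if_cong)
  ultimately show ?thesis by simp
qed

text \<open>In finite dimension continuity in each fixed direction is continuity in operator norm.
  The operator-valued derivative is what the uniform estimates and the inversion of operators work
  with.\<close>

lemma pdiff_on_SucE_blinfun:
  fixes f :: "'p::topological_space \<Rightarrow> 'a::euclidean_space \<Rightarrow> 'b::real_normed_vector"
  assumes "pdiff_on (Suc k) P S f"
  obtains F where "\<And>p x. p \<in> P \<Longrightarrow> x \<in> S \<Longrightarrow> (f p has_derivative blinfun_apply (F p x)) (at x)"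
    and "pdiff_on k P S F"
proof -
  obtain f' where f': "\<And>p x. p \<in> P \<Longrightarrow> x \<in> S \<Longrightarrow> (f p has_derivative f' p x) (at x)"
    "\<And>v. pdiff_on k P S (\<lambda>p x. f' p x v)" using pdiff_on_SucE[OF assms(1)] by blast
  define G where "G p x = (\<Sum>b\<in>Basis. blinfun_scaleR_left (f' p x b) o\<^sub>L blinfun_inner_left b)" for p x
  have G: "G p x v = (\<Sum>b\<in>Basis. (v \<bullet> b) *\<^sub>R f' p x b)" for p x v
    by (simp add: G_def blinfun.sum_left inner_commute)
  have "pdiff_on k P S G"
  proof (rule pdiff_on_blinfun)
    fix b :: 'a assume "b \<in> Basis"
    show "pdiff_on k P S (\<lambda>p x. G p x b)"
      unfolding G by (intro pdiff_on_sum pdiff_on_linear[OF bounded_linear_scaleR_right] f')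
  qed
  moreover have "f' p x = blinfun_apply (G p x)" if "p \<in> P" "x \<in> S" for p x
  proof
    fix v
    interpret bounded_linear "f' p x"
      using f'(1)[OF that] has_derivative_bounded_linear by blast
    have "f' p x v = f' p x (\<Sum>b\<in>Basis. (v \<bullet> b) *\<^sub>R b)"
      by (simp add: euclidean_representation)
    also have "\<dots> = G p x v"
      by (simp add: sum scaleR G)
    finally show "f' p x v = G p x v" .
  qed
  then have "(f p has_derivative blinfun_apply (G p x)) (at x)" if "p \<in> P" "x \<in> S" for p x
    using f'(1)[OF that] that by simp
  ultimately show ?thesis by (intro that)
qed

lemma C_diff_on_iff_pdiff_on:
  assumes "open S"
  shows "C_diff_on k S f \<longleftrightarrow> pdiff_on k {0::real} S (\<lambda>_. f)"
proof (induction k arbitrary: f)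
  case 0
  have "continuous_on S f" if "continuous_on ({0} \<times> S) (\<lambda>(p::real, x). f x)"
  proof -
    have "continuous_on S (\<lambda>x. (0::real, x))" by (intro continuous_intros)
    from continuous_on_compose2[OF that this] show ?thesis by auto
  qed
  moreover have "continuous_on ({0} \<times> S) (f \<circ> (snd :: real \<times> 'a \<Rightarrow> 'a))" if "continuous_on S f"
    by (intro continuous_on_compose continuous_intros continuous_on_subset[OF that]) auto
  ultimately show ?case by (auto simp: o_def case_prod_beta)
next
  case (Suc k)
  show ?case
  proof
    assume *: "C_diff_on (Suc k) S f"
    \<comment> \<open>At positive order \<open>C_diff_on\<close> records differentiability but not
      continuity, which \<open>pdiff_on\<close> demands at every order.\<close>
    then have "continuous_on S f"
      by (auto intro!: differentiable_imp_continuous_on simp: differentiable_on_def differentiable_at_withinI)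
    then have "continuous_on ({0} \<times> S) (f \<circ> (snd :: real \<times> 'a \<Rightarrow> 'a))"
      by (intro continuous_on_compose continuous_intros) auto
    then show "pdiff_on (Suc k) {0::real} S (\<lambda>_. f)"
      using * by (intro pdiff_on_SucI[where f'="\<lambda>_ x. frechet_derivative f (at x)"])
        (auto simp: Suc.IH[symmetric] frechet_derivative_works[symmetric] o_def case_prod_beta)
  next
    assume "pdiff_on (Suc k) {0::real} S (\<lambda>_. f)"
    then obtain f' where f': "\<And>x. x \<in> S \<Longrightarrow> (f has_derivative f' 0 x) (at x)"
      "\<And>v. pdiff_on k {0::real} S (\<lambda>p x. f' p x v)" by (auto elim: pdiff_on_SucE)
    have "pdiff_on k {0::real} S (\<lambda>p x. frechet_derivative f (at x) v)" for v
      by (rule pdiff_on_cong[OF assms _ f'(2)[of v]])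
        (use f'(1)[THEN frechet_derivative_at] in auto)
    then show "C_diff_on (Suc k) S f"
      using f'(1) by (auto simp: Suc.IH intro: differentiableI)
  qed
qed

section \<open>Inverses of operator-valued maps\<close>

text \<open>The resolvent identity
  \<open>B r - B q = - (B r o\<^sub>L (A r - A q) o\<^sub>L B q)\<close> still contains
  \<open>B r\<close>, whose size is not known beforehand. Once
  \<open>norm (A r - A q) * c < 1/2\<close>, half of \<open>norm (B r)\<close> can be absorbed,
  which gives \<open>norm (B r) \<le> 2 * c\<close>; the identity then yields convergence.\<close>

lemma continuous_on_blinfun_inverse:
  fixes A :: "'q::topological_space \<Rightarrow> 'b::real_normed_vector \<Rightarrow>\<^sub>L 'b"
  assumes A: "continuous_on Q A"
    and inv: "\<And>q. q \<in> Q \<Longrightarrow> A q o\<^sub>L B q = id_blinfun" "\<And>q. q \<in> Q \<Longrightarrow> B q o\<^sub>L A q = id_blinfun"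
  shows "continuous_on Q B"
  unfolding continuous_on_def
proof
  fix q assume q: "q \<in> Q"
  have lim: "((\<lambda>r. norm (A r - A q)) \<longlongrightarrow> 0) (at q within Q)"
    by (rule tendsto_norm_zero[OF Lim_null[THEN iffD1]]) (use A q in \<open>simp add: continuous_on_def\<close>)
  define c where "c = norm (B q)"
  have diff: "B r - B q = - (B r o\<^sub>L (A r - A q) o\<^sub>L B q)" if "r \<in> Q" for r
  proof (rule blinfun_eqI)
    fix i
    have "A q (B q i) = i" "B r (A r (B q i)) = B q i"
      using inv(1)[OF q, THEN arg_cong, of "\<lambda>L. blinfun_apply L i"]
        inv(2)[OF that, THEN arg_cong, of "\<lambda>L. blinfun_apply L (B q i)"] by simp_all
    then show "(B r - B q) i = (- (B r o\<^sub>L (A r - A q) o\<^sub>L B q)) i"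
      by (simp add: blinfun.diff_left blinfun.diff_right blinfun.minus_left)
  qed
  have nd: "norm (B r - B q) \<le> norm (B r) * norm (A r - A q) * c" if "r \<in> Q" for r
    unfolding diff[OF that] norm_minus_cancel c_def
    by (intro order_trans[OF norm_blinfun_compose] mult_right_mono norm_blinfun_compose) auto
  have "((\<lambda>r. norm (A r - A q) * c) \<longlongrightarrow> 0 * c) (at q within Q)"
    by (rule tendsto_mult_right[OF lim])
  then have "eventually (\<lambda>r. norm (A r - A q) * c < 1/2) (at q within Q)"
    by (rule order_tendstoD) simp
  moreover have "eventually (\<lambda>r. r \<in> Q) (at q within Q)"
    by (simp add: eventually_at_filter)
  ultimately have "eventually (\<lambda>r. norm (B r - B q) \<le> 2 * c * c * norm (A r - A q)) (at q within Q)"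
  proof eventually_elim
    case (elim r)
    have "norm (B r) * (norm (A r - A q) * c) \<le> norm (B r) * (1/2)"
      using elim(1) by (intro mult_left_mono) auto
    with nd[OF elim(2)] have "norm (B r - B q) \<le> norm (B r) / 2" by (simp add: mult.assoc)
    moreover have "norm (B r) \<le> norm (B r - B q) + c" unfolding c_def by (metis diff_add_cancel norm_triangle_ineq)
    ultimately have "norm (B r) \<le> 2 * c" by simp
    then have "norm (B r) * (norm (A r - A q) * c) \<le> 2 * c * (norm (A r - A q) * c)"
      by (intro mult_right_mono) (auto simp: c_def)
    with nd[OF elim(2)] show ?case by (simp add: algebra_simps)
  qed
  moreover have "((\<lambda>r. 2 * c * c * norm (A r - A q)) \<longlongrightarrow> 2 * c * c * 0) (at q within Q)"
    by (rule tendsto_mult_left[OF lim])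
  ultimately have "((\<lambda>r. B r - B q) \<longlongrightarrow> 0) (at q within Q)"
    by - (rule Lim_null_comparison, auto)
  then show "(B \<longlongrightarrow> B q) (at q within Q)"
    by (rule Lim_null[THEN iffD2])
qed

text \<open>The resolvent identity divided by \<open>norm (y - x)\<close>. The error splits into the
  Taylor remainder of \<open>A\<close> between two convergent factors, and the replacement of
  \<open>B y\<close> by \<open>B x\<close> in the main term, where the quotient of \<open>A'\<close>
  stays bounded.\<close>

lemma has_derivative_blinfun_inverse:
  fixes A :: "'a::real_normed_vector \<Rightarrow> 'b::real_normed_vector \<Rightarrow>\<^sub>L 'b"
  assumes A: "(A has_derivative A') (at x)" and "isCont B x" and "open S" "x \<in> S"
    and inv: "\<And>y. y \<in> S \<Longrightarrow> A y o\<^sub>L B y = id_blinfun" "\<And>y. y \<in> S \<Longrightarrow> B y o\<^sub>L A y = id_blinfun"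
  shows "(B has_derivative (\<lambda>v. - (B x o\<^sub>L A' v o\<^sub>L B x))) (at x)"
proof -
  interpret A': bounded_linear A' by (rule has_derivative_bounded_linear[OF A])
  note C = bounded_bilinear_blinfun_compose
  have bl: "bounded_linear (\<lambda>v. - (B x o\<^sub>L A' v o\<^sub>L B x))"
    by (intro bounded_linear_minus
        bounded_linear_compose[OF bounded_bilinear.bounded_linear_left[OF C]]
        bounded_linear_compose[OF bounded_bilinear.bounded_linear_right[OF C]] A'.bounded_linear)
  have Blim: "(B \<longlongrightarrow> B x) (at x)" using assms(2) by (simp add: isCont_def)
  have Alim: "((\<lambda>y. (A y - A x - A' (y - x)) /\<^sub>R norm (y - x)) \<longlongrightarrow> 0) (at x)"
    using A by (simp add: has_derivative_at_within)
  have 1: "((\<lambda>y. B y o\<^sub>L ((A y - A x - A' (y - x)) /\<^sub>R norm (y - x)) o\<^sub>L B x) \<longlongrightarrow> B x o\<^sub>L 0 o\<^sub>L B x) (at x)"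
    by (intro bounded_bilinear.tendsto[OF C] Blim Alim tendsto_const)
  have 2: "((\<lambda>y. (B y - B x) o\<^sub>L (A' (y - x) /\<^sub>R norm (y - x)) o\<^sub>L B x) \<longlongrightarrow> 0) (at x)"
  proof -
    obtain K where K: "\<And>v. norm (A' v) \<le> norm v * K" "K > 0" using A'.pos_bounded by blast
    have b: "norm (A' (y - x) /\<^sub>R norm (y - x)) \<le> K" for y
      using K(1)[of "y - x"] K(2) by (auto simp: divide_simps mult.commute)
    have "norm ((B y - B x) o\<^sub>L (A' (y - x) /\<^sub>R norm (y - x)) o\<^sub>L B x) \<le> norm (B y - B x) * K * norm (B x)" for y
    proof -
      have "norm ((B y - B x) o\<^sub>L (A' (y - x) /\<^sub>R norm (y - x)) o\<^sub>L B x)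
        \<le> norm (B y - B x) * norm (A' (y - x) /\<^sub>R norm (y - x)) * norm (B x)"
        by (intro order_trans[OF norm_blinfun_compose] mult_right_mono norm_blinfun_compose) auto
      also have "\<dots> \<le> norm (B y - B x) * K * norm (B x)"
        by (intro mult_right_mono mult_left_mono b) auto
      finally show ?thesis .
    qed
    moreover have "((\<lambda>y. norm (B y - B x) * K * norm (B x)) \<longlongrightarrow> 0 * K * norm (B x)) (at x)"
      by (intro tendsto_mult_right tendsto_norm_zero Lim_null[THEN iffD1] Blim)
    ultimately show ?thesis
      by - (rule Lim_null_comparison, auto)
  qed
  have "eventually (\<lambda>y. y \<in> S) (at x)"
    using \<open>open S\<close> \<open>x \<in> S\<close> by (rule eventually_at_in_open')
  then have ev: "eventually (\<lambda>y. - (B y o\<^sub>L ((A y - A x - A' (y - x)) /\<^sub>R norm (y - x)) o\<^sub>L B x) 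
      - ((B y - B x) o\<^sub>L (A' (y - x) /\<^sub>R norm (y - x)) o\<^sub>L B x)
      = (B y - B x - - (B x o\<^sub>L A' (y - x) o\<^sub>L B x)) /\<^sub>R norm (y - x)) (at x)"
  proof eventually_elim
    case (elim y)
    show ?case
    proof (rule blinfun_eqI)
      fix i
      have "A x (B x i) = i" "B y (A y (B x i)) = B x i"
        using inv(1)[OF \<open>x \<in> S\<close>, THEN arg_cong, of "\<lambda>L. blinfun_apply L i"]
          inv(2)[OF elim, THEN arg_cong, of "\<lambda>L. blinfun_apply L (B x i)"] by simp_all
      then show "(- (B y o\<^sub>L ((A y - A x - A' (y - x)) /\<^sub>R norm (y - x)) o\<^sub>L B x) 
      - ((B y - B x) o\<^sub>L (A' (y - x) /\<^sub>R norm (y - x)) o\<^sub>L B x)) i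
      = ((B y - B x - - (B x o\<^sub>L A' (y - x) o\<^sub>L B x)) /\<^sub>R norm (y - x)) i"
        by (simp add: blinfun.bilinear_simps algebra_simps)
    qed
  qed
  have "((\<lambda>y. - (B y o\<^sub>L ((A y - A x - A' (y - x)) /\<^sub>R norm (y - x)) o\<^sub>L B x) 
      - ((B y - B x) o\<^sub>L (A' (y - x) /\<^sub>R norm (y - x)) o\<^sub>L B x)) \<longlongrightarrow> 0) (at x)"
    using tendsto_diff[OF tendsto_minus[OF 1] 2] by simp
  from Lim_transform_eventually[OF this ev]
  show ?thesis using bl by (simp add: has_derivative_at_within)
qed

text \<open>Bootstrapping: the derivative of \<open>B\<close> is a product of \<open>B\<close>,
  \<open>A'\<close> and \<open>B\<close>, so each order of smoothness of \<open>B\<close> yields the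
  next one as long as \<open>A\<close> allows it.\<close>

lemma pdiff_on_blinfun_inverse:
  fixes A :: "'p::topological_space \<Rightarrow> 'a::euclidean_space \<Rightarrow> ('b::real_normed_vector \<Rightarrow>\<^sub>L 'b)"
  assumes "open S" "pdiff_on k P S A"
    and inv: "\<And>p x. p \<in> P \<Longrightarrow> x \<in> S \<Longrightarrow> A p x o\<^sub>L B p x = id_blinfun"
      "\<And>p x. p \<in> P \<Longrightarrow> x \<in> S \<Longrightarrow> B p x o\<^sub>L A p x = id_blinfun"
  shows "pdiff_on k P S B"
proof -
  have cont: "continuous_on (P \<times> S) (\<lambda>(p, x). B p x)"
    using pdiff_on_continuous[OF assms(2)]
    by (rule continuous_on_blinfun_inverse) (auto simp: inv)
  show ?thesis using assms(2)
  proof (induction k)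
    case 0
    show ?case using cont by simp
  next
    case (Suc k)
    obtain A' where A': "\<And>p x. p \<in> P \<Longrightarrow> x \<in> S \<Longrightarrow> (A p has_derivative A' p x) (at x)"
      "\<And>v. pdiff_on k P S (\<lambda>p x. A' p x v)" using pdiff_on_SucE[OF Suc.prems] by blast
    note B = Suc.IH[OF pdiff_on_SucD[OF Suc.prems]]
    show ?case
    proof (rule pdiff_on_SucI[OF cont])
      show "(B p has_derivative (\<lambda>v. - (B p x o\<^sub>L A' p x v o\<^sub>L B p x))) (at x)" if "p \<in> P" "x \<in> S" for p x
      proof (rule has_derivative_blinfun_inverse[OF A'(1)[OF that] _ assms(1) that(2)])
        have "continuous_on S (\<lambda>x. (p, x))" by (intro continuous_intros)
        from continuous_on_compose2[OF cont this] have "continuous_on S (B p)" using that by auto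
        then show "isCont (B p) x" using assms(1) that continuous_on_eq_continuous_at by blast
      qed (use inv that in auto)
      show "pdiff_on k P S (\<lambda>p x. - (B p x o\<^sub>L A' p x v o\<^sub>L B p x))" for v
        by (intro pdiff_on_linear[OF bounded_linear_minus[OF bounded_linear_ident]]
            pdiff_on_bilinear[OF bounded_bilinear_blinfun_compose] B A')
    qed
  qed
qed

section \<open>Integrals depending on a point\<close>

lemma has_derivative_integral_param:
  fixes f :: "real \<Rightarrow> 'a::euclidean_space \<Rightarrow> 'b::banach"
  assumes S: "open S" "x \<in> S"
    and F: "\<And>s x. s \<in> {a..b} \<Longrightarrow> x \<in> S \<Longrightarrow> (f s has_derivative blinfun_apply (F s x)) (at x)"
    and cf: "continuous_on ({a..b} \<times> S) (\<lambda>(s, x). f s x)"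
    and cF: "continuous_on ({a..b} \<times> S) (\<lambda>(s, x). F s x)"
  shows "((\<lambda>x. integral {a..b} (\<lambda>s. f s x)) has_derivative (\<lambda>v. integral {a..b} (\<lambda>s. F s x v))) (at x)"
proof -
  obtain e where e: "e > 0" "ball x e \<subseteq> S" using S open_contains_ball by blast
  have cs: "continuous_on {a..b} (\<lambda>s. g s x)" if "continuous_on ({a..b} \<times> S) (\<lambda>(s, x). g s x)" "x \<in> S"
    for g :: "real \<Rightarrow> 'a \<Rightarrow> 'c::banach" and x
  proof -
    have "continuous_on {a..b} (\<lambda>s. (s, x))" by (intro continuous_intros)
    from continuous_on_compose2[OF that(1) this] show ?thesis using that(2) by auto
  qed
  have "((\<lambda>x. integral (cbox a b) (\<lambda>s. f s x)) has_derivative integral (cbox a b) (\<lambda>s. F s x)) (at x within ball x e)"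
  proof (rule leibniz_rule[where fx="\<lambda>x s. F s x"])
    show "(f t has_derivative blinfun_apply (F t y)) (at y within ball x e)" if "y \<in> ball x e" "t \<in> cbox a b" for y t
      using F[of t y, THEN has_derivative_at_withinI] that e by auto
    show "(\<lambda>s. f s y) integrable_on cbox a b" if "y \<in> ball x e" for y
      using cs[OF cf, of y] that e by (auto intro!: integrable_continuous_real)
    have "continuous_on (ball x e \<times> cbox a b) (\<lambda>z. (snd z, fst z))" by (intro continuous_intros)
    moreover have "(\<lambda>z. (snd z, fst z)) ` (ball x e \<times> cbox a b) \<subseteq> {a..b} \<times> S" using e(2) by auto
    ultimately show "continuous_on (ball x e \<times> cbox a b) (\<lambda>(y, s). F s y)"
      using continuous_on_compose2[OF cF, of "ball x e \<times> cbox a b" "\<lambda>z. (snd z, fst z)"]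
      by (simp add: case_prod_beta)
  qed (use e in auto)
  then have "((\<lambda>x. integral {a..b} (\<lambda>s. f s x)) has_derivative integral {a..b} (\<lambda>s. F s x)) (at x)"
    using at_within_open[of x "ball x e"] e by auto
  moreover have "blinfun_apply (integral {a..b} (\<lambda>s. F s x)) = (\<lambda>v. integral {a..b} (\<lambda>s. F s x v))"
  proof
    fix v
    have "bounded_linear (\<lambda>L :: 'a \<Rightarrow>\<^sub>L 'b. blinfun_apply L v)" by (rule blinfun.bounded_linear_left)
    from integral_linear[OF integrable_continuous_real[OF cs[OF cF S(2)]] this]
    show "blinfun_apply (integral {a..b} (\<lambda>s. F s x)) v = integral {a..b} (\<lambda>s. F s x v)"
      by (simp add: o_def)
  qed
  ultimately show ?thesis by simp
qed

lemma continuous_on_param_const: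
  "continuous_on S g \<Longrightarrow> continuous_on (P \<times> S) (\<lambda>(p, x). g x)"
  unfolding case_prod_beta
  by (erule continuous_on_compose2[OF _ continuous_on_snd[OF continuous_on_id]]) auto

text \<open>The parameter of \<open>f\<close> is the integration variable, for which joint
  continuity is enough. The integral no longer depends on any parameter, hence the arbitrary
  \<open>P\<close>.\<close>

lemma pdiff_on_integral:
  fixes f :: "real \<Rightarrow> 'a::euclidean_space \<Rightarrow> 'b::banach"
  assumes "open S" "pdiff_on k {a..b} S f"
  shows "pdiff_on k P S (\<lambda>p x. integral {a..b} (\<lambda>s. f s x))"
  using assms(2)
proof (induction k arbitrary: f)
  case 0
  have "continuous_on (S \<times> cbox a b) (\<lambda>z. (snd z, fst z))" by (intro continuous_intros)
  moreover have "(\<lambda>z. (snd z, fst z)) ` (S \<times> cbox a b) \<subseteq> {a..b} \<times> S" by auto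
  ultimately have "continuous_on (S \<times> cbox a b) (\<lambda>(x, s). f s x)"
    using continuous_on_compose2[OF pdiff_on_continuous[OF 0], of "S \<times> cbox a b" "\<lambda>z. (snd z, fst z)"]
    by (simp add: case_prod_beta)
  from integral_continuous_on_param[OF this]
  have "continuous_on S (\<lambda>x. integral {a..b} (\<lambda>s. f s x))" by simp
  then show ?case by (simp add: continuous_on_param_const)
next
  case (Suc k)
  obtain F where F: "\<And>p x. p \<in> {a..b} \<Longrightarrow> x \<in> S \<Longrightarrow> (f p has_derivative blinfun_apply (F p x)) (at x)"
    and pF: "pdiff_on k {a..b} S F" by (rule pdiff_on_SucE_blinfun[OF Suc.prems]) blast
  show ?case
  proof (rule pdiff_on_SucI)
    have "continuous_on S (\<lambda>x. integral {a..b} (\<lambda>s. f s x))"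
      by (rule has_derivative_continuous_on[OF has_derivative_at_withinI])
        (rule has_derivative_integral_param[OF assms(1) _ F pdiff_on_continuous[OF Suc.prems] pdiff_on_continuous[OF pF]])
    then show "continuous_on (P \<times> S) (\<lambda>(p, x). integral {a..b} (\<lambda>s. f s x))" by (rule continuous_on_param_const)
    show "((\<lambda>x. integral {a..b} (\<lambda>s. f s x)) has_derivative (\<lambda>v. integral {a..b} (\<lambda>s. F s x v))) (at x)"
      if "x \<in> S" for x
      using has_derivative_integral_param[OF assms(1) that F pdiff_on_continuous[OF Suc.prems] pdiff_on_continuous[OF pF]] by auto
    show "pdiff_on k P S (\<lambda>p x. integral {a..b} (\<lambda>s. F s x v))" for v
      by (rule Suc.IH[OF pdiff_on_linear[OF blinfun.bounded_linear_left pF]])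
  qed
qed

section \<open>Integral equations\<close>

lemma continuous_on_slice:
  assumes "continuous_on (P \<times> S) (\<lambda>(p, x). f p x)" "continuous_on P g" "\<And>p. p \<in> P \<Longrightarrow> g p \<in> S"
  shows "continuous_on P (\<lambda>p. f p (g p))"
proof -
  have "continuous_on P (\<lambda>p. (p, g p))" by (intro continuous_intros assms(2))
  moreover have "(\<lambda>p. (p, g p)) ` P \<subseteq> P \<times> S" using assms(3) by auto
  ultimately show ?thesis
    using continuous_on_compose2[OF assms(1), of P "\<lambda>p. (p, g p)"] by simp
qed

lemma continuous_on_integral_upper:
  fixes g :: "real \<Rightarrow> 'b::banach"
  assumes "continuous_on {a..b} g"
  shows "continuous_on {a..b} (\<lambda>t. integral {a..t} g)"
  by (rule indefinite_integral_continuous_1[OF integrable_continuous_real[OF assms]])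

text \<open>Let \<open>u\<close> be a point where \<open>norm (w s)\<close> is maximal, with maximum
  m. The equation at \<open>u\<close> gives m \<le> a + b + l m, because the interval of integration
  has length at most 1, and \<open>l < 1\<close> allows solving for m. All later comparisons of
  solutions are instances: \<open>c\<close> carries the initial error, \<open>b\<close> the error in
  the equation.\<close>

lemma volterra_bound:
  fixes w g :: "real \<Rightarrow> 'b::banach"
  assumes "continuous_on {0..1} w" "continuous_on {0..1} g" "0 \<le> b"
    and eq: "\<And>t. t \<in> {0..1} \<Longrightarrow> w t = c t + integral {0..t} g"
    and c: "\<And>t. t \<in> {0..1} \<Longrightarrow> norm (c t) \<le> a"
    and g: "\<And>s. s \<in> {0..1} \<Longrightarrow> norm (g s) \<le> b + l * norm (w s)"
    and l: "0 \<le> l" "l < 1"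
    and t: "t \<in> {0..1}"
  shows "norm (w t) \<le> (a + b) / (1 - l)"
proof -
  obtain u where u: "u \<in> {0..1}" "\<And>s. s \<in> {0..1} \<Longrightarrow> norm (w s) \<le> norm (w u)"
    using continuous_attains_sup[of "{0..1::real}" "\<lambda>s. norm (w s)", OF _ _ continuous_on_norm[OF assms(1)]]
    by auto
  have "norm (integral {0..u} g) \<le> (b + l * norm (w u)) * (u - 0)"
  proof (rule integral_bound)
    show "continuous_on {0..u} g" using assms(2) u(1) by (auto intro: continuous_on_subset)
    show "norm (g s) \<le> b + l * norm (w u)" if "s \<in> {0..u}" for s
      using g[of s] mult_left_mono[OF u(2)[of s] l(1)] that u(1) by auto
  qed (use u in auto)
  also have "\<dots> \<le> (b + l * norm (w u)) * 1"
    using u(1) assms(3) l by (intro mult_left_mono) auto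
  finally have "norm (w u) \<le> a + (b + l * norm (w u))"
    using eq[OF u(1)] c[OF u(1)] norm_triangle_ineq[of "c u" "integral {0..u} g"] by simp
  then have "norm (w u) \<le> (a + b) / (1 - l)" using l by (simp add: field_simps)
  with u(2)[OF t] show ?thesis by simp
qed

text \<open>Banach's fixed point theorem for the Picard operator, with contraction factor 1/2 from
  \<open>lip\<close>; \<open>inv\<close> says that the operator preserves the curves in
  \<open>D\<close>. The complete space consists of bounded continuous functions on the whole line,
  so the image of a curve is extended beyond [0,1] by its end values through
  \<open>clamp\<close>.\<close>

lemma picard:
  fixes X :: "real \<Rightarrow> 'e::euclidean_space \<Rightarrow> 'e"
  assumes cX: "continuous_on ({0..1} \<times> D) (\<lambda>(s, w). X s w)" and D: "closed D" "z \<in> D"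
    and lip: "\<And>s w w'. s \<in> {0..1} \<Longrightarrow> w \<in> D \<Longrightarrow> w' \<in> D \<Longrightarrow> norm (X s w - X s w') \<le> norm (w - w') / 2"
    and inv: "\<And>g t. continuous_on {0..1} g \<Longrightarrow> (\<And>s. s \<in> {0..1} \<Longrightarrow> g s \<in> D) \<Longrightarrow> t \<in> {0..1} \<Longrightarrow>
      z + integral {0..t} (\<lambda>s. X s (g s)) \<in> D"
  shows "\<exists>\<phi>. continuous_on {0..1} \<phi> \<and> (\<forall>t\<in>{0..1}. \<phi> t \<in> D) \<and>
    (\<forall>t\<in>{0..1}. \<phi> t = z + integral {0..t} (\<lambda>s. X s (\<phi> s)))"
proof -
  define \<S> where "\<S> = PiC (UNIV :: real set) (\<lambda>_. D)"
  define F where "F g t = z + integral {0..t} (\<lambda>s. X s (apply_bcontfun g s))" for g and t :: real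
  have memS: "g \<in> \<S> \<longleftrightarrow> (\<forall>t. apply_bcontfun g t \<in> D)" for g
    by (auto simp: \<S>_def mem_PiC_iff)
  have cl: "clamp 0 1 (t::real) \<in> {0..1}" for t
    using clamp_in_interval[of 0 1 t] by auto
  have cont: "continuous_on {0..1} (\<lambda>s. X s (apply_bcontfun g s))" if "g \<in> \<S>" for g
    by (rule continuous_on_slice[OF cX]) (use that memS in auto)
  have contF: "continuous_on {0..1} (F g)" if "g \<in> \<S>" for g
    unfolding F_def by (intro continuous_intros continuous_on_integral_upper cont that)
  have exT: "\<exists>h. \<forall>t. apply_bcontfun h t = F g (clamp 0 1 t)" if "g \<in> \<S>" for g
  proof -
    have "continuous_on (cbox 0 1) (F g)" using contF[OF that] by simp
    then obtain h where "\<And>t. apply_bcontfun h t = F g (clamp 0 1 t)"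
      by (rule continuous_on_cbox_bcontfunE) blast
    then show ?thesis by blast
  qed
  define T where "T g = (SOME h. \<forall>t. apply_bcontfun h t = F g (clamp 0 1 t))" for g
  have T: "apply_bcontfun (T g) t = F g (clamp 0 1 t)" if "g \<in> \<S>" for g t
    using someI_ex[OF exT[OF that]] by (simp add: T_def)
  have "\<exists>!g\<in>\<S>. T g = g"
  proof (rule Banach_fix)
    show "complete \<S>" unfolding \<S>_def complete_eq_closed using D(1) by (intro closed_PiC) auto
    have "const_bcontfun z \<in> \<S>" using D(2) by (simp add: memS const_bcontfun.rep_eq)
    then show "\<S> \<noteq> {}" by auto
    show "T ` \<S> \<subseteq> \<S>"
    proof
      fix h assume "h \<in> T ` \<S>"
      then obtain g where g: "g \<in> \<S>" "h = T g" by auto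
      show "h \<in> \<S>" unfolding memS
      proof
        fix t
        show "apply_bcontfun h t \<in> D"
          unfolding g(2) T[OF g(1)] F_def by (rule inv[OF _ _ cl]) (use g(1) memS in auto)
      qed
    qed
    show "dist (T g) (T h) \<le> 1/2 * dist g h" if gh: "g \<in> \<S>" "h \<in> \<S>" for g h
    proof (rule dist_bound)
      fix t :: real
      define u where "u = clamp 0 1 t"
      have u: "u \<in> {0..1}" using cl by (simp add: u_def)
      have c: "continuous_on {0..u} (\<lambda>s. X s (apply_bcontfun g s))" if "g \<in> \<S>" for g
        using cont[OF that] u by (auto intro: continuous_on_subset)
      have "norm (integral {0..u} (\<lambda>s. X s (apply_bcontfun g s) - X s (apply_bcontfun h s)))
        \<le> dist g h / 2 * (u - 0)"
      proof (rule integral_bound)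
        fix s assume "s \<in> {0..u}"
        then have "norm (X s (apply_bcontfun g s) - X s (apply_bcontfun h s))
          \<le> norm (apply_bcontfun g s - apply_bcontfun h s) / 2"
          using u gh memS by (intro lip) auto
        also have "\<dots> \<le> dist g h / 2" using dist_bounded[of g s h] by (simp add: dist_norm)
        finally show "norm (X s (apply_bcontfun g s) - X s (apply_bcontfun h s)) \<le> dist g h / 2" .
      qed (use u c[OF gh(1)] c[OF gh(2)] in \<open>auto intro: continuous_on_diff\<close>)
      also have "\<dots> \<le> dist g h / 2 * 1" using u by (intro mult_left_mono) auto
      finally show "dist (apply_bcontfun (T g) t) (apply_bcontfun (T h) t) \<le> 1/2 * dist g h"
        unfolding T[OF gh(1)] T[OF gh(2)] u_def[symmetric] dist_norm F_def
        using integral_diff[OF integrable_continuous_real[OF c[OF gh(1)]] integrable_continuous_real[OF c[OF gh(2)]]]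
        by simp
    qed
  qed auto
  then obtain g where g: "g \<in> \<S>" "T g = g" by auto
  show ?thesis
  proof (intro exI[of _ "apply_bcontfun g"] conjI ballI)
    fix t :: real assume t: "t \<in> {0..1}"
    then show "apply_bcontfun g t = z + integral {0..t} (\<lambda>s. X s (apply_bcontfun g s))"
      using T[OF g(1), of t] g(2) by (simp add: F_def)
  qed (use g memS in auto)
qed

text \<open>On a small tube around the compact curve the derivative differs by at most
  \<open>e\<close> from its value on the curve, and the mean value inequality turns this into a
  first-order remainder with one \<open>d\<close> for all times.\<close>

lemma uniform_taylor:
  fixes X :: "real \<Rightarrow> 'a::euclidean_space \<Rightarrow> 'b::real_normed_vector"
  assumes "open Q" and c: "continuous_on {a..b} \<gamma>" "\<And>s. s \<in> {a..b} \<Longrightarrow> \<gamma> s \<in> Q"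
    and F: "\<And>s q. s \<in> {a..b} \<Longrightarrow> q \<in> Q \<Longrightarrow> (X s has_derivative blinfun_apply (F s q)) (at q)"
    and cF: "continuous_on ({a..b} \<times> Q) (\<lambda>(s, q). F s q)" and "e > 0"
  obtains d where "d > 0" "\<And>s q. s \<in> {a..b} \<Longrightarrow> norm (q - \<gamma> s) < d \<Longrightarrow>
      norm (X s q - X s (\<gamma> s) - F s (\<gamma> s) (q - \<gamma> s)) \<le> e * norm (q - \<gamma> s)"
proof (cases "{a..b} = {}")
  case True
  then show ?thesis by (intro that[of 1]) auto
next
  case False
  have "compact (\<gamma> ` {a..b})" using c by (intro compact_continuous_image) auto
  then obtain r where r: "r > 0" "(\<Union>x\<in>\<gamma> ` {a..b}. ball x r) \<subseteq> Q"
    using c(2) False compact_subset_open_imp_ball_epsilon_subset[of "\<gamma> ` {a..b}" Q] assms(1) by blast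
  then have rQ: "\<gamma> s + u \<in> Q" if "s \<in> {a..b}" "norm u < r" for s u
  proof -
    have "\<gamma> s + u \<in> ball (\<gamma> s) r" using that by (simp add: dist_norm)
    then show ?thesis using r(2) that(1) by blast
  qed
  \<comment> \<open>Recentring at \<open>\<gamma> s\<close> turns the tube into a product of a ball
    and a compact interval, where continuity at the zero displacement is uniform in
    \<open>s\<close>.\<close>
  have cg: "continuous_on (ball 0 r \<times> {a..b}) (\<lambda>z. \<gamma> (snd z))"
    by (rule continuous_on_compose2[OF c(1) continuous_on_snd[OF continuous_on_id]]) auto
  have "continuous_on (ball 0 r \<times> {a..b}) (\<lambda>z. (snd z, \<gamma> (snd z) + fst z))"
    by (rule continuous_on_Pair[OF continuous_on_snd[OF continuous_on_id]
          continuous_on_add[OF cg continuous_on_fst[OF continuous_on_id]]])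
  moreover have "(\<lambda>z. (snd z, \<gamma> (snd z) + fst z)) ` (ball 0 r \<times> {a..b}) \<subseteq> {a..b} \<times> Q"
    using rQ by auto
  ultimately have cc: "continuous_on (ball 0 r \<times> {a..b}) (\<lambda>z. F (snd z) (\<gamma> (snd z) + fst z))"
    using continuous_on_compose2[OF cF, of "ball 0 r \<times> {a..b}" "\<lambda>z. (snd z, \<gamma> (snd z) + fst z)"]
    by simp
  have "0 \<in> ball (0::'a) r" using r(1) by simp
  from continuous_on_prod_compactE[OF cc compact_Icc this \<open>e > 0\<close>]
  obtain X0 where X0: "0 \<in> X0" "open X0" "\<forall>u\<in>X0 \<inter> ball 0 r. \<forall>s\<in>{a..b}.
      dist (F s (\<gamma> s + u)) (F s (\<gamma> s)) \<le> e"
    by (simp only: fst_conv snd_conv add_0_right) blast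
  obtain d where d: "d > 0" "ball 0 d \<subseteq> X0 \<inter> ball 0 r"
    using openE[of "X0 \<inter> ball 0 r" 0] X0(1,2) r(1) by (metis IntI centre_in_ball open_Int open_ball)
  show ?thesis
  proof (rule that[OF d(1)])
    fix s q assume s: "s \<in> {a..b}" and q: "norm (q - \<gamma> s) < d"
    have in_d: "y - \<gamma> s \<in> X0 \<inter> ball 0 r" if "y \<in> ball (\<gamma> s) d" for y
      using that d(2) by (auto simp: dist_norm norm_minus_commute subset_iff)
    have "norm (X s q - X s (\<gamma> s) - F s (\<gamma> s) (q - \<gamma> s)) \<le> norm (q - \<gamma> s) * e"
    proof (rule differentiable_bound_linearization[where S="ball (\<gamma> s) d" and f' = "\<lambda>q. blinfun_apply (F s q)"])
      fix t :: real assume "t \<in> {0..1}"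
      moreover from this have "norm (t *\<^sub>R (q - \<gamma> s)) \<le> 1 * norm (q - \<gamma> s)"
        unfolding norm_scaleR by (intro mult_right_mono) auto
      ultimately show "\<gamma> s + t *\<^sub>R (q - \<gamma> s) \<in> ball (\<gamma> s) d"
        using q by (simp add: dist_norm)
    next
      fix y assume y: "y \<in> ball (\<gamma> s) d"
      have "y \<in> Q" using rQ[OF s, of "y - \<gamma> s"] in_d[OF y] by (auto simp: dist_norm norm_minus_commute)
      then show "(X s has_derivative blinfun_apply (F s y)) (at y within ball (\<gamma> s) d)"
        by (rule has_derivative_at_withinI[OF F[OF s]])
      have "norm (F s y - F s (\<gamma> s)) \<le> e"
        using bspec[OF bspec[OF X0(3) in_d[OF y]] s] by (simp add: dist_norm)
      then show "onorm (blinfun_apply (F s y) - blinfun_apply (F s (\<gamma> s))) \<le> e"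
        by (simp add: norm_blinfun.rep_eq minus_blinfun.rep_eq fun_diff_def)
    qed (use d(1) in auto)
    then show "norm (X s q - X s (\<gamma> s) - F s (\<gamma> s) (q - \<gamma> s)) \<le> e * norm (q - \<gamma> s)"
      by (simp add: mult.commute)
  qed
qed

text \<open>This passes the contraction constant of the nonlinear equation on to its
  linearisation.\<close>

lemma has_derivative_norm_le:
  fixes f :: "'a::real_normed_vector \<Rightarrow> 'b::real_normed_vector"
  assumes f: "(f has_derivative f') (at x)" and "open S" "x \<in> S"
    and lip: "\<And>y. y \<in> S \<Longrightarrow> norm (f y - f x) \<le> L * norm (y - x)"
  shows "norm (f' v) \<le> L * norm v"
proof -
  interpret f': bounded_linear f' by (rule has_derivative_bounded_linear[OF f])
  obtain r where r: "r > 0" "ball x r \<subseteq> S" using assms(2,3) by (rule openE)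
  have *: "norm (f' v) \<le> (L + e) * norm v" if "e > 0" "v \<noteq> 0" for e
  proof -
    from f[unfolded has_derivative_at_alt, THEN conjunct2, rule_format, OF that(1)]
    obtain d where d: "d > 0" "\<And>y. norm (y - x) < d \<Longrightarrow> norm (f y - f x - f' (y - x)) \<le> e * norm (y - x)"
      by auto
    \<comment> \<open>Then \<open>norm (t *\<^sub>R v)\<close> is half of \<open>min d r\<close>, so
      the displaced point lies both in the range of the Taylor estimate and in
      \<open>S\<close>.\<close>
    define t where "t = min d r / (2 * norm v)"
    have t: "t > 0" "norm (t *\<^sub>R v) < d" "norm (t *\<^sub>R v) < r"
      using d(1) r(1) that(2) by (auto simp: t_def min_def)
    then have "x + t *\<^sub>R v \<in> S" using r(2) by (auto simp: dist_norm)
    from lip[OF this] d(2)[of "x + t *\<^sub>R v"] t(2)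
    have "norm (f (x + t *\<^sub>R v) - f x) + norm (f (x + t *\<^sub>R v) - f x - f' (t *\<^sub>R v)) \<le> (L + e) * norm (t *\<^sub>R v)"
      by (simp add: algebra_simps)
    moreover have "norm (f' (t *\<^sub>R v)) \<le> norm (f (x + t *\<^sub>R v) - f x) + norm (f (x + t *\<^sub>R v) - f x - f' (t *\<^sub>R v))"
      using norm_triangle_ineq4[of "f (x + t *\<^sub>R v) - f x" "f (x + t *\<^sub>R v) - f x - f' (t *\<^sub>R v)"] by simp
    ultimately have "t * norm (f' v) \<le> t * ((L + e) * norm v)"
      using t(1) by (simp add: f'.scaleR algebra_simps)
    then show ?thesis using t(1) by simp
  qed
  show ?thesis
  proof (cases "v = 0")
    case False
    show ?thesis
    proof (rule field_le_epsilon)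
      fix e :: real assume "e > 0"
      then show "norm (f' v) \<le> L * norm v + e"
        using *[of "e / norm v"] False by (simp add: algebra_simps)
    qed
  qed (simp add: f'.zero)
qed

text \<open>Compactness of the time interval allows one radius \<open>d\<close> for all
  times.\<close>

lemma uniform_cont_param:
  fixes g :: "real \<Rightarrow> 'a::metric_space \<Rightarrow> 'b::metric_space"
  assumes g: "continuous_on ({a..b} \<times> S) (\<lambda>(s, x). g s x)" and "open S" "x0 \<in> S" "e > 0"
  obtains d where "d > 0" "ball x0 d \<subseteq> S"
    "\<And>x s. dist x x0 < d \<Longrightarrow> s \<in> {a..b} \<Longrightarrow> dist (g s x) (g s x0) \<le> e"
proof -
  have "continuous_on (S \<times> {a..b}) (\<lambda>z. (snd z, fst z))" by (intro continuous_intros)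
  moreover have "(\<lambda>z. (snd z, fst z)) ` (S \<times> {a..b}) \<subseteq> {a..b} \<times> S" by auto
  ultimately have "continuous_on (S \<times> {a..b}) (\<lambda>z. g (snd z) (fst z))"
    using continuous_on_compose2[OF g, of "S \<times> {a..b}" "\<lambda>z. (snd z, fst z)"] by simp
  from continuous_on_prod_compactE[OF this compact_Icc \<open>x0 \<in> S\<close> \<open>e > 0\<close>]
  obtain X0 where X0: "x0 \<in> X0" "open X0" "\<forall>x\<in>X0 \<inter> S. \<forall>s\<in>{a..b}. dist (g s x) (g s x0) \<le> e"
    by (simp only: fst_conv snd_conv) blast
  have "open (X0 \<inter> S)" "x0 \<in> X0 \<inter> S" using X0(1,2) assms(2,3) by auto
  then obtain d where d: "d > 0" "ball x0 d \<subseteq> X0 \<inter> S" by (rule openE)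
  show ?thesis
  proof (rule that[OF d(1)])
    show "ball x0 d \<subseteq> S" using d(2) by auto
    fix x s assume "dist x x0 < d" "s \<in> {a..b}"
    moreover from this have "x \<in> X0 \<inter> S" using d(2) by (auto simp: dist_commute subset_iff)
    ultimately show "dist (g s x) (g s x0) \<le> e" using X0(3) by blast
  qed
qed

section \<open>Dependence of solutions on the initial point\<close>

text \<open>The solutions from \<open>z\<close> and \<open>z0\<close> are compared by inserting
  \<open>X s (z, \<phi> s z0)\<close>: one difference is controlled by the Lipschitz bound, the
  other is small uniformly in time because only the parameter \<open>z\<close> moves.
  \<open>volterra_bound\<close> then applies to the difference of the solutions.\<close>

lemma integral_equation_jointly_continuous:
  fixes X :: "real \<Rightarrow> 'a::euclidean_space \<times> 'e::euclidean_space \<Rightarrow> 'e"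
  assumes "open Z"
    and X: "continuous_on ({0..1} \<times> (Z \<times> W)) (\<lambda>(s, q). X s q)"
    and lip: "\<And>s z w w'. s \<in> {0..1} \<Longrightarrow> z \<in> Z \<Longrightarrow> w \<in> W \<Longrightarrow> w' \<in> W \<Longrightarrow>
      norm (X s (z, w) - X s (z, w')) \<le> norm (w - w') / 2"
    and init: "continuous_on Z init"
    and W: "\<And>t z. t \<in> {0..1} \<Longrightarrow> z \<in> Z \<Longrightarrow> \<phi> t z \<in> W"
    and c\<phi>: "\<And>z. z \<in> Z \<Longrightarrow> continuous_on {0..1} (\<lambda>t. \<phi> t z)"
    and eq: "\<And>t z. t \<in> {0..1} \<Longrightarrow> z \<in> Z \<Longrightarrow> \<phi> t z = init z + integral {0..t} (\<lambda>s. X s (z, \<phi> s z))"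
  shows "continuous_on ({0..1} \<times> Z) (\<lambda>(t, z). \<phi> t z)"
  unfolding continuous_on_iff
proof (intro ballI allI impI)
  fix p0 :: "real \<times> 'a" and e :: real assume p0: "p0 \<in> {0..1} \<times> Z" and e: "e > 0"
  obtain t0 z0 where p0': "p0 = (t0, z0)" by (cases p0)
  have t0: "t0 \<in> {0..1}" and z0: "z0 \<in> Z" using p0 by (auto simp: p0')
  \<comment> \<open>The spatial comparison costs \<open>(e' + e') / (1 - 1/2)\<close>, that is four
    times \<open>e'\<close>, and the variation in time less than one more \<open>e'\<close>; five
    eighths of \<open>e\<close> leave room.\<close>
  define e' where "e' = e / 8"
  have e': "e' > 0" using e by (simp add: e'_def)
  have cX: "continuous_on {0..1} (\<lambda>s. X s (z, \<phi> s y))" if "z \<in> Z" "y \<in> Z" for z y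
    by (rule continuous_on_slice[OF X]) (use that W c\<phi> in \<open>auto intro: continuous_intros\<close>)
  have X': "continuous_on ({0..1} \<times> Z) (\<lambda>(s, z). X s (z, \<phi> s z0))"
  proof -
    have "continuous_on ({0..1} \<times> Z) (\<lambda>p. \<phi> (fst p) z0)"
      by (rule continuous_on_compose2[OF c\<phi>[OF z0] continuous_on_fst[OF continuous_on_id]]) auto
    then have "continuous_on ({0..1} \<times> Z) (\<lambda>p. (fst p, snd p, \<phi> (fst p) z0))"
      by (intro continuous_on_Pair continuous_on_fst continuous_on_snd continuous_on_id)
    moreover have "(\<lambda>p. (fst p, snd p, \<phi> (fst p) z0)) ` ({0..1} \<times> Z) \<subseteq> {0..1} \<times> (Z \<times> W)"
      using W[OF _ z0] by auto
    ultimately show ?thesis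
      using continuous_on_compose2[OF X, of "{0..1} \<times> Z" "\<lambda>p. (fst p, snd p, \<phi> (fst p) z0)"]
      by (simp add: case_prod_beta)
  qed
  obtain d1 where d1: "d1 > 0" "ball z0 d1 \<subseteq> Z"
    "\<And>z s. dist z z0 < d1 \<Longrightarrow> s \<in> {0..1} \<Longrightarrow> dist (X s (z, \<phi> s z0)) (X s (z0, \<phi> s z0)) \<le> e'"
    using uniform_cont_param[OF X' \<open>open Z\<close> z0 e'] by metis
  obtain d2 where d2: "d2 > 0" "\<And>z. z \<in> Z \<Longrightarrow> dist z z0 < d2 \<Longrightarrow> dist (init z) (init z0) < e'"
    using init z0 e' unfolding continuous_on_iff by metis
  obtain d3 where d3: "d3 > 0" "\<And>t. t \<in> {0..1} \<Longrightarrow> dist t t0 < d3 \<Longrightarrow> dist (\<phi> t z0) (\<phi> t0 z0) < e'"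
    using c\<phi>[OF z0] t0 e' unfolding continuous_on_iff by metis
  have close: "norm (\<phi> t z - \<phi> t z0) \<le> (e' + e') / (1 - 1/2)"
    if t: "t \<in> {0..1}" and z: "z \<in> Z" "dist z z0 < d1" "dist z z0 < d2" for t z
  proof (rule volterra_bound[where w="\<lambda>t. \<phi> t z - \<phi> t z0" and c="\<lambda>t. init z - init z0"
        and g="\<lambda>s. X s (z, \<phi> s z) - X s (z0, \<phi> s z0)", OF _ _ _ _ _ _ _ _ t])
    show "continuous_on {0..1} (\<lambda>t. \<phi> t z - \<phi> t z0)"
      by (intro continuous_on_diff c\<phi> z z0)
    show "continuous_on {0..1} (\<lambda>s. X s (z, \<phi> s z) - X s (z0, \<phi> s z0))"
      by (intro continuous_on_diff cX z z0)
    show "norm (init z - init z0) \<le> e'" using d2(2)[OF z(1,3)] by (simp add: dist_norm)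
    show "\<phi> t z - \<phi> t z0 = init z - init z0 + integral {0..t} (\<lambda>s. X s (z, \<phi> s z) - X s (z0, \<phi> s z0))"
      if t: "t \<in> {0..1}" for t
    proof -
      have "continuous_on {0..t} (\<lambda>s. X s (y, \<phi> s y))" if "y \<in> Z" for y
        using cX[OF that that] t by (auto intro: continuous_on_subset)
      then show ?thesis using eq[OF t] z z0
        by (simp add: integral_diff integrable_continuous_real)
    qed
    show "norm (X s (z, \<phi> s z) - X s (z0, \<phi> s z0)) \<le> e' + 1/2 * norm (\<phi> s z - \<phi> s z0)"
      if s: "s \<in> {0..1}" for s
      using lip[OF s z(1) W[OF s z(1)] W[OF s z0]] d1(3)[OF z(2) s]
        norm_triangle_ineq[of "X s (z, \<phi> s z) - X s (z, \<phi> s z0)" "X s (z, \<phi> s z0) - X s (z0, \<phi> s z0)"]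
      by (simp add: dist_norm)
  qed (use e' in auto)
  show "\<exists>d>0. \<forall>p'\<in>{0..1} \<times> Z. dist p' p0 < d \<longrightarrow>
      dist (case p' of (t, z) \<Rightarrow> \<phi> t z) (case p0 of (t, z) \<Rightarrow> \<phi> t z) < e"
    unfolding p0'
  proof (intro exI[of _ "min d1 (min d2 d3)"] conjI ballI impI)
    fix p' assume p': "p' \<in> {0..1} \<times> Z" "dist p' (t0, z0) < min d1 (min d2 d3)"
    obtain t z where p: "p' = (t, z)" by (cases p')
    have tz: "t \<in> {0..1}" "z \<in> Z" "dist t t0 < d3" "dist z z0 < d1" "dist z z0 < d2"
      using p' dist_fst_le[of p' "(t0, z0)"] dist_snd_le[of p' "(t0, z0)"] by (auto simp: p)
    have "dist (\<phi> t z) (\<phi> t0 z0) \<le> dist (\<phi> t z) (\<phi> t z0) + dist (\<phi> t z0) (\<phi> t0 z0)"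
      by (rule dist_triangle)
    also have "\<dots> < e"
      using close[OF tz(1,2,4,5)] d3(2)[OF tz(1,3)] e by (simp add: dist_norm e'_def)
    finally show "dist (case p' of (t, z) \<Rightarrow> \<phi> t z) (case (t0, z0) of (t, z) \<Rightarrow> \<phi> t z) < e"
      by (simp add: p)
  qed (use d1 d2 d3 in auto)
qed

text \<open>
  Allowing \<^term>\<open>X\<close> to depend on the initial point makes the induction work: the derivative of the solution
  in a fixed direction solves a linear equation of the same kind.
\<close>

theorem integral_equation_pdiff_on:
  fixes X :: "real \<Rightarrow> 'a::euclidean_space \<times> 'e::euclidean_space \<Rightarrow> 'e"
  assumes "open Z" "open W"
    and "pdiff_on k {0..1} (Z \<times> W) X"
    and "\<And>s z w w'. s \<in> {0..1} \<Longrightarrow> z \<in> Z \<Longrightarrow> w \<in> W \<Longrightarrow> w' \<in> W \<Longrightarrow>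
      norm (X s (z, w) - X s (z, w')) \<le> norm (w - w') / 2"
    and "pdiff_on k {0..1::real} Z (\<lambda>_. init)"
    and "\<And>t z. t \<in> {0..1} \<Longrightarrow> z \<in> Z \<Longrightarrow> \<phi> t z \<in> W"
    and "\<And>z. z \<in> Z \<Longrightarrow> continuous_on {0..1} (\<lambda>t. \<phi> t z)"
    and "\<And>t z. t \<in> {0..1} \<Longrightarrow> z \<in> Z \<Longrightarrow> \<phi> t z = init z + integral {0..t} (\<lambda>s. X s (z, \<phi> s z))"
  shows "pdiff_on k {0..1} Z \<phi>"
  using assms(2-)
proof (induction k arbitrary: X W init \<phi>)
  case 0
  have "continuous_on Z (\<lambda>z. (0::real, z))" by (intro continuous_intros)
  moreover have "Pair 0 ` Z \<subseteq> {0..1::real} \<times> Z" by auto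
  ultimately have "continuous_on Z init"
    using continuous_on_compose2[OF pdiff_on_continuous[OF 0(4)], of Z "Pair 0"] by simp
  then show ?case
    using integral_equation_jointly_continuous[OF \<open>open Z\<close> pdiff_on_continuous[OF 0(2)] 0(3) _ 0(5-7)]
    by simp
next
  case (Suc k)
  note W = Suc.prems(1) and lip = Suc.prems(3) and inW = Suc.prems(5) and c\<phi> = Suc.prems(6)
    and eq = Suc.prems(7)
  obtain F where F: "\<And>s q. s \<in> {0..1} \<Longrightarrow> q \<in> Z \<times> W \<Longrightarrow> (X s has_derivative blinfun_apply (F s q)) (at q)"
    and pF: "pdiff_on k {0..1} (Z \<times> W) F" by (rule pdiff_on_SucE_blinfun[OF Suc.prems(2)]) blast
  obtain G where G: "\<And>s z. s \<in> {0..1::real} \<Longrightarrow> z \<in> Z \<Longrightarrow> (init has_derivative blinfun_apply (G s z)) (at z)"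
    and pG: "pdiff_on k {0..1} Z G" by (rule pdiff_on_SucE_blinfun[OF Suc.prems(4)]) blast
  have p\<phi>: "pdiff_on k {0..1} Z \<phi>"
    by (rule Suc.IH[OF W pdiff_on_SucD[OF Suc.prems(2)] lip pdiff_on_SucD[OF Suc.prems(4)] inW c\<phi> eq])
  \<comment> \<open>The derivative of \<open>X s\<close> in both arguments along the solution. It is
    of class \<open>k\<close> because \<open>\<phi>\<close> is so already by the induction
    hypothesis.\<close>
  define B where "B s z = F s (z, \<phi> s z)" for s z
  have inZW: "(z, \<phi> s z) \<in> Z \<times> W" if "s \<in> {0..1}" "z \<in> Z" for s z
    using inW that by auto
  have pB: "pdiff_on k {0..1} Z B" unfolding B_def
    by (rule pdiff_on_compose[OF pF pdiff_on_Pair[OF pdiff_on_id p\<phi>] inZW \<open>open Z\<close>])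
  have cB: "continuous_on {0..1} (\<lambda>s. B s z)" if "z \<in> Z" for z
    by (rule continuous_on_slice[OF pdiff_on_continuous[OF pB]]) (use that in auto)
  have B_le: "norm (B s z (0, w)) \<le> 1/2 * norm w" if "s \<in> {0..1}" "z \<in> Z" for s z w
  proof (rule has_derivative_norm_le[OF _ W inW[OF that]])
    have "((\<lambda>w. (z, w)) has_derivative (\<lambda>w. (0, w))) (at (\<phi> s z))"
      by (auto intro!: derivative_eq_intros)
    from diff_chain_at[OF this F[OF that(1) inZW[OF that]]]
    show "((\<lambda>w. X s (z, w)) has_derivative (\<lambda>w. B s z (0, w))) (at (\<phi> s z))"
      by (simp add: o_def B_def)
    show "norm (X s (z, w) - X s (z, \<phi> s z)) \<le> 1/2 * norm (w - \<phi> s z)" if "w \<in> W" for w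
      using lip[OF \<open>s \<in> {0..1}\<close> \<open>z \<in> Z\<close> that inW[OF \<open>s \<in> {0..1}\<close> \<open>z \<in> Z\<close>]] by simp
  qed
  have B_add: "B s z (h, w) = B s z (h, 0) + B s z (0, w)" for s z h w
    by (simp flip: blinfun.add_right)
  \<comment> \<open>Formal differentiation of the integral equation in direction \<open>h\<close>
    gives this linear equation, whose solution is the candidate derivative. As it is globally
    Lipschitz by \<open>B_le\<close>, the Picard lemma applies with the whole space as
    \<open>D\<close>. The initial value is stationary, so any time may be used in \<open>G\<close>;
    0 is taken.\<close>
  have ex: "\<exists>\<psi>. continuous_on {0..1} \<psi> \<and>
      (\<forall>t\<in>{0..1}. \<psi> t = G 0 z h + integral {0..t} (\<lambda>s. B s z (h, \<psi> s)))" if z: "z \<in> Z" for z h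
  proof -
    have "continuous_on ({0..1} \<times> UNIV) (\<lambda>p. B (fst p) z (h, snd p))"
      by (intro blinfun.continuous_on continuous_on_compose2[OF cB[OF z] continuous_on_fst[OF continuous_on_id]]
          continuous_on_Pair continuous_on_const continuous_on_snd continuous_on_id) auto
    moreover have "norm (B s z (h, w) - B s z (h, w')) \<le> norm (w - w') / 2" if "s \<in> {0..1}" for s w w'
      using B_le[OF that z, of "w - w'"] by (simp flip: blinfun.diff_right)
    ultimately show ?thesis
      using picard[where X="\<lambda>s w. B s z (h, w)" and D=UNIV and z="G 0 z h"] by (simp add: case_prod_beta)
  qed
  define \<psi> where "\<psi> z h = (SOME \<psi>. continuous_on {0..1} \<psi> \<and>
      (\<forall>t\<in>{0..1}. \<psi> t = G 0 z h + integral {0..t} (\<lambda>s. B s z (h, \<psi> s))))" for z h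
  have c\<psi>: "continuous_on {0..1} (\<psi> z h)" if "z \<in> Z" for z h
    using someI_ex[OF ex[OF that]] by (simp add: \<psi>_def)
  have \<psi>: "\<psi> z h t = G 0 z h + integral {0..t} (\<lambda>s. B s z (h, \<psi> z h s))"
    if "z \<in> Z" "t \<in> {0..1}" for t z h
    using someI_ex[OF ex[OF that(1), of h], THEN conjunct2, rule_format, OF that(2)]
    unfolding \<psi>_def[symmetric] .
  show ?case
  proof (rule pdiff_on_SucI[OF pdiff_on_continuous[OF p\<phi>], where f'="\<lambda>t z h. \<psi> z h t"])
    show "pdiff_on k {0..1} Z (\<lambda>t z. \<psi> z h t)" for h
    \<comment> \<open>The second use of the induction hypothesis: the linearised equation has
      right-hand side of class \<open>k\<close>, the same constant 1/2, and a genuine dependence on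
      the initial point through \<open>B\<close>.\<close>
    proof (rule Suc.IH[where X="\<lambda>s q. B s (fst q) (h, snd q)" and init="\<lambda>z. G 0 z h", OF open_UNIV])
      have "pdiff_on k {0..1} (Z \<times> UNIV) (\<lambda>s q. B s (fst q))"
        by (rule pdiff_on_compose[OF pB pdiff_on_linear[OF bounded_linear_fst pdiff_on_id]])
          (use \<open>open Z\<close> in \<open>auto intro: open_Times\<close>)
      then show "pdiff_on k {0..1} (Z \<times> UNIV) (\<lambda>s q. B s (fst q) (h, snd q))"
        by (intro pdiff_on_bilinear[OF bounded_bilinear_blinfun_apply] pdiff_on_Pair pdiff_on_const
            pdiff_on_linear[OF bounded_linear_snd pdiff_on_id])
      show "norm (B s (fst (z, w)) (h, snd (z, w)) - B s (fst (z, w')) (h, snd (z, w'))) \<le> norm (w - w') / 2"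
        if "s \<in> {0..1}" "z \<in> Z" for s z w w'
        using B_le[OF that, of "w - w'"] by (simp flip: blinfun.diff_right)
      have "pdiff_on k {0..1} Z (\<lambda>_::real. G 0)"
        by (rule pdiff_on_reparam[OF pG, where h="\<lambda>_. 0"]) auto
      then show "pdiff_on k {0..1::real} Z (\<lambda>_ z. G 0 z h)"
        by (rule pdiff_on_linear[OF blinfun.bounded_linear_left])
    qed (use c\<psi> \<psi> in auto)
  next
    fix t z0 assume t: "t \<in> {0..1::real}" and z0: "z0 \<in> Z"
    have cBh: "continuous_on {0..u} (\<lambda>s. B s z0 (h, \<psi> z0 h' s))" if "u \<in> {0..1}" for u h h'
      by (intro blinfun.continuous_on continuous_on_Pair continuous_on_const 
          continuous_on_subset[OF cB[OF z0]] continuous_on_subset[OF c\<psi>[OF z0]]) (use that in auto)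
    have lin: "linear (\<lambda>h. \<psi> z0 h t)"
    proof -
      \<comment> \<open>The defect of linearity solves the homogeneous equation with initial value
        0, so \<open>volterra_bound\<close> forces it to vanish.\<close>
      have "\<psi> z0 (a *\<^sub>R h + h') t - (a *\<^sub>R \<psi> z0 h t + \<psi> z0 h' t) = 0" for a h h'
      proof -
        let ?w = "\<lambda>t. \<psi> z0 (a *\<^sub>R h + h') t - (a *\<^sub>R \<psi> z0 h t + \<psi> z0 h' t)"
        have "norm (?w t) \<le> (0 + 0) / (1 - 1/2)"
        proof (rule volterra_bound[where g="\<lambda>s. B s z0 (0, ?w s)" and c="\<lambda>_. 0", OF _ _ _ _ _ _ _ _ t])
          show cw: "continuous_on {0..1} ?w"
            by (intro continuous_on_diff continuous_on_add continuous_on_scaleR continuous_on_const c\<psi> z0)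
          show "continuous_on {0..1} (\<lambda>s. B s z0 (0, ?w s))"
            by (intro blinfun.continuous_on continuous_on_Pair continuous_on_const cB[OF z0] cw)
          show "norm (B s z0 (0, ?w s)) \<le> 0 + 1/2 * norm (?w s)" if "s \<in> {0..1}" for s
            using B_le[OF that z0, of "?w s"] by simp
          fix u :: real assume u: "u \<in> {0..1}"
          have i: "(\<lambda>s. B s z0 (h, \<psi> z0 h s)) integrable_on {0..u}" for h
            by (intro integrable_continuous_real cBh u)
          have "B s z0 (0, ?w s) = B s z0 (a *\<^sub>R h + h', \<psi> z0 (a *\<^sub>R h + h') s)
             - (a *\<^sub>R B s z0 (h, \<psi> z0 h s) + B s z0 (h', \<psi> z0 h' s))" for s
            by (simp flip: blinfun.add_right blinfun.diff_right blinfun.scaleR_right)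
          then have "integral {0..u} (\<lambda>s. B s z0 (0, ?w s)) =
              integral {0..u} (\<lambda>s. B s z0 (a *\<^sub>R h + h', \<psi> z0 (a *\<^sub>R h + h') s))
             - (a *\<^sub>R integral {0..u} (\<lambda>s. B s z0 (h, \<psi> z0 h s)) + integral {0..u} (\<lambda>s. B s z0 (h', \<psi> z0 h' s)))"
            by (simp add: integral_diff integral_add integrable_add integrable_cmul i)
          then show "?w u = 0 + integral {0..u} (\<lambda>s. B s z0 (0, ?w s))"
            using \<psi>[OF z0 u] by (simp add: blinfun.add_right blinfun.scaleR_right algebra_simps)
        qed auto
        then show ?thesis by simp
      qed
      then have *: "\<psi> z0 (a *\<^sub>R h + h') t = a *\<^sub>R \<psi> z0 h t + \<psi> z0 h' t" for a h h'
        using eq_iff_diff_eq_0 by blast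
      show ?thesis
      proof (rule linearI)
        show "\<psi> z0 (h + h') t = \<psi> z0 h t + \<psi> z0 h' t" for h h' using *[of 1 h h'] by simp
        have "\<psi> z0 0 t = 0" using *[of 1 0 0] by simp
        then show "\<psi> z0 (a *\<^sub>R h) t = a *\<^sub>R \<psi> z0 h t" for a h using *[of a h 0] by simp
      qed
    qed
    obtain M where M: "M > 0" "\<And>s. s \<in> {0..1} \<Longrightarrow> norm (B s z0) \<le> M"
    proof -
      have "bounded ((\<lambda>s. B s z0) ` {0..1})"
        by (intro compact_imp_bounded compact_continuous_image cB z0) auto
      then obtain M where "M > 0" "\<forall>x\<in>(\<lambda>s. B s z0) ` {0..1}. norm x \<le> M" by (auto simp: bounded_pos)
      then show ?thesis using that by auto
    qed
    \<comment> \<open>The constant that \<open>volterra_bound\<close> produces with initial error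
      \<open>norm (G 0 z0) * norm h\<close> and forcing at most \<open>M * norm h\<close>.\<close>
    define C where "C = (norm (G 0 z0) + M) / (1 - 1/2)"
    have C0: "C \<ge> 0" using M(1) by (simp add: C_def)
    have \<psi>_le: "norm (\<psi> z0 h s) \<le> C * norm h" if "s \<in> {0..1}" for s h
    proof -
      have "norm (\<psi> z0 h s) \<le> (norm (G 0 z0) * norm h + M * norm h) / (1 - 1/2)"
      proof (rule volterra_bound[where g="\<lambda>s. B s z0 (h, \<psi> z0 h s)" and c="\<lambda>_. G 0 z0 h", OF _ _ _ _ _ _ _ _ that])
        show "continuous_on {0..1} (\<lambda>s. B s z0 (h, \<psi> z0 h s))" using cBh[of 1] by simp
        show "norm (B s z0 (h, \<psi> z0 h s)) \<le> M * norm h + 1/2 * norm (\<psi> z0 h s)" if s: "s \<in> {0..1}" for s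
        proof -
          have "norm (B s z0 (h, 0)) \<le> norm (B s z0) * norm (h, 0::'e)" by (rule norm_blinfun)
          also have "\<dots> \<le> M * norm h" by (simp add: norm_Pair mult_right_mono M(2)[OF s])
          finally show ?thesis
            using B_add[of s z0 h "\<psi> z0 h s"] B_le[OF s z0, of "\<psi> z0 h s"]
              norm_triangle_ineq[of "B s z0 (h, 0)" "B s z0 (0, \<psi> z0 h s)"] by simp
        qed
      qed (use c\<psi> \<psi> z0 M(1) norm_blinfun in auto)
      then show ?thesis by (simp add: C_def algebra_simps)
    qed
    show "(\<phi> t has_derivative (\<lambda>h. \<psi> z0 h t)) (at z0)"
      unfolding has_derivative_at_alt
    proof (intro conjI allI impI)
      show "bounded_linear (\<lambda>h. \<psi> z0 h t)" using lin by (rule linear_conv_bounded_linear[THEN iffD1])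
      fix e :: real assume e: "e > 0"
      \<comment> \<open>The bound 1/4 raises the contraction constant from 1/2 to only 3/4, hence a
        final factor 4. The other bound makes the forcing at most \<open>e / 8\<close> per unit of
        \<open>norm h\<close>; with the \<open>e / 8\<close> from \<open>init\<close> the total is
        exactly \<open>e\<close>.\<close>
      define e1 where "e1 = min (1/4) (e / (8 * (1 + C)))"
      have e1: "e1 > 0" "e1 \<le> 1/4" "e1 * (1 + C) \<le> e / 8"
      proof -
        have "e1 \<le> e / (8 * (1 + C))" by (simp add: e1_def)
        then show "e1 * (1 + C) \<le> e / 8" using C0 by (simp add: field_simps)
        show "e1 \<le> 1/4" unfolding e1_def by (rule min.cobounded1)
      qed (use e C0 in \<open>auto simp: e1_def\<close>)
      have "continuous_on {0..1} (\<lambda>s. (z0, \<phi> s z0))"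
        by (intro continuous_on_Pair continuous_on_const c\<phi> z0)
      then obtain d1 where d1: "d1 > 0" "\<And>s q. s \<in> {0..1} \<Longrightarrow> norm (q - (z0, \<phi> s z0)) < d1 \<Longrightarrow>
          norm (X s q - X s (z0, \<phi> s z0) - B s z0 (q - (z0, \<phi> s z0))) \<le> e1 * norm (q - (z0, \<phi> s z0))"
        unfolding B_def
        by (rule uniform_taylor[OF open_Times[OF \<open>open Z\<close> W] _ inZW[OF _ z0] F pdiff_on_continuous[OF pF] e1(1)]) auto
      \<comment> \<open>Both components of the displacement \<open>(?h, ?k)\<close> stay within
        \<open>d1 / 3\<close>, so its norm is below \<open>d1\<close> and the Taylor estimate
        applies.\<close>
      obtain d2 where d2: "d2 > 0" "ball z0 d2 \<subseteq> Z"
        "\<And>z s. dist z z0 < d2 \<Longrightarrow> s \<in> {0..1} \<Longrightarrow> dist (\<phi> s z) (\<phi> s z0) \<le> d1 / 3"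
        by (rule uniform_cont_param[OF pdiff_on_continuous[OF p\<phi>] \<open>open Z\<close> z0, of "d1/3"]) (use d1(1) in auto)
      have "e / 8 > 0" using e by simp
      from G[OF _ z0, of 0, unfolded has_derivative_at_alt, THEN conjunct2, rule_format, OF _ this]
      obtain d3 where d3: "d3 > 0" "\<And>z. norm (z - z0) < d3 \<Longrightarrow>
          norm (init z - init z0 - G 0 z0 (z - z0)) \<le> e / 8 * norm (z - z0)" by auto
      show "\<exists>d>0. \<forall>z. norm (z - z0) < d \<longrightarrow> norm (\<phi> t z - \<phi> t z0 - \<psi> z0 (z - z0) t) \<le> e * norm (z - z0)"
      proof (intro exI[of _ "min (d1/3) (min d2 d3)"] conjI allI impI)
        fix z assume z: "norm (z - z0) < min (d1/3) (min d2 d3)"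
        then have zZ: "z \<in> Z" using d2(2) by (auto simp: dist_norm norm_minus_commute subset_iff)
        let ?h = "z - z0"
        let ?w = "\<lambda>t. \<phi> t z - \<phi> t z0 - \<psi> z0 ?h t"
        let ?g = "\<lambda>s. X s (z, \<phi> s z) - X s (z0, \<phi> s z0) - B s z0 (?h, \<psi> z0 ?h s)"
        have cX: "continuous_on {0..1} (\<lambda>s. X s (y, \<phi> s y))" if "y \<in> Z" for y
          by (rule continuous_on_slice[OF pdiff_on_continuous[OF Suc.prems(2)]])
            (use that inW c\<phi> in \<open>auto intro: continuous_intros\<close>)
        have "norm (?w t) \<le> (e / 8 * norm ?h + e1 * (1 + C) * norm ?h) / (1 - 3/4)"
        proof (rule volterra_bound[where g="?g" and c="\<lambda>_. init z - init z0 - G 0 z0 ?h", OF _ _ _ _ _ _ _ _ t])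
          show "continuous_on {0..1} ?w" by (intro continuous_on_diff c\<phi> c\<psi> zZ z0)
          show "continuous_on {0..1} ?g" using cBh[of 1] by (intro continuous_on_diff cX zZ z0) auto
          show "norm (init z - init z0 - G 0 z0 ?h) \<le> e / 8 * norm ?h" using d3(2) z by auto
          show "?w u = init z - init z0 - G 0 z0 ?h + integral {0..u} ?g" if u: "u \<in> {0..1}" for u
          proof -
            have "(\<lambda>s. X s (y, \<phi> s y)) integrable_on {0..u}" if "y \<in> Z" for y
              by (rule integrable_continuous_real[OF continuous_on_subset[OF cX[OF that]]]) (use u in auto)
            moreover have "(\<lambda>s. B s z0 (?h, \<psi> z0 ?h s)) integrable_on {0..u}"
              by (intro integrable_continuous_real cBh u)
            ultimately show ?thesis using zZ z0
              by (simp add: integral_diff integrable_diff eq[OF u] \<psi>[OF z0 u])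
          qed
          show "norm (?g s) \<le> e1 * (1 + C) * norm ?h + 3/4 * norm (?w s)" if s: "s \<in> {0..1}" for s
          proof -
            let ?k = "\<phi> s z - \<phi> s z0"
            have q: "(z, \<phi> s z) - (z0, \<phi> s z0) = (?h, ?k)" by simp
            have nq: "norm (?h, ?k) \<le> norm ?h + norm ?k" by (rule norm_Pair_le)
            have "norm ?k \<le> d1 / 3" using d2(3)[OF _ s, of z] z by (simp add: dist_norm)
            with nq z d1(1) have "norm (?h, ?k) < d1" by auto
            with d1(2)[OF s, of "(z, \<phi> s z)", unfolded q]
            have 1: "norm (X s (z, \<phi> s z) - X s (z0, \<phi> s z0) - B s z0 (?h, ?k)) \<le> e1 * norm (?h, ?k)" .
            have "norm ?k \<le> norm (?w s) + norm (\<psi> z0 ?h s)"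
              using norm_triangle_ineq[of "?w s" "\<psi> z0 ?h s"] by simp
            with nq \<psi>_le[OF s, of ?h] have "norm (?h, ?k) \<le> (1 + C) * norm ?h + norm (?w s)"
              by (simp add: algebra_simps)
            then have "e1 * norm (?h, ?k) \<le> e1 * ((1 + C) * norm ?h + norm (?w s))"
              using e1(1) by (intro mult_left_mono) auto
            also have "\<dots> \<le> e1 * (1 + C) * norm ?h + 1/4 * norm (?w s)"
              using mult_right_mono[OF e1(2), of "norm (?w s)"] by (simp add: algebra_simps)
            finally have 2: "e1 * norm (?h, ?k) \<le> e1 * (1 + C) * norm ?h + 1/4 * norm (?w s)" .
            \<comment> \<open>A Taylor remainder plus the linear part of the error
              \<open>?w\<close>: the remainder costs at most 1/4 of \<open>norm (?w s)\<close>, the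
              linear part at most 1/2.\<close>
            have "?g s = (X s (z, \<phi> s z) - X s (z0, \<phi> s z0) - B s z0 (?h, ?k)) + B s z0 (0, ?w s)"
              by (simp add: algebra_simps flip: blinfun.add_right blinfun.diff_right)
            then have "norm (?g s) \<le> norm (X s (z, \<phi> s z) - X s (z0, \<phi> s z0) - B s z0 (?h, ?k)) + norm (B s z0 (0, ?w s))"
              by (metis norm_triangle_ineq)
            with 1 2 B_le[OF s z0, of "?w s"] show ?thesis by simp
          qed
        qed (use e1 C0 in auto)
        also have "\<dots> = 4 * (e / 8 + e1 * (1 + C)) * norm ?h" by (simp add: algebra_simps)
        also have "\<dots> \<le> e * norm ?h" using e1(3) by (intro mult_right_mono) auto
        finally show "norm (?w t) \<le> e * norm ?h" .
      qed (use d1 d2 d3 in auto)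
    qed
  qed
qed

section \<open>The method of Moser\<close>

lemma integral_blinfun_inner:
  fixes L :: "real \<Rightarrow> 'a::euclidean_space \<Rightarrow>\<^sub>L 'b::euclidean_space"
  assumes "continuous_on {a..b} L"
  shows "integral {a..b} L u \<bullet> v = integral {a..b} (\<lambda>s. L s u \<bullet> v)"
proof -
  have "bounded_linear (\<lambda>M :: 'a \<Rightarrow>\<^sub>L 'b. M u \<bullet> v)"
    by (rule bounded_linear_compose[OF bounded_linear_inner_left blinfun.bounded_linear_left])
  from integral_linear[OF integrable_continuous_real[OF assms] this] show ?thesis
    by (simp add: o_def)
qed

lemma skew_derivative:
  fixes \<Omega> :: "'e::euclidean_space \<Rightarrow> 'e \<Rightarrow>\<^sub>L 'e"
  assumes "open S" "z \<in> S" and d: "(\<Omega> has_derivative D) (at z)"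
    and skew: "\<And>z a b. z \<in> S \<Longrightarrow> \<Omega> z a \<bullet> b = - (\<Omega> z b \<bullet> a)"
  shows "D w a \<bullet> b = - (D w b \<bullet> a)"
proof -
  have 1: "((\<lambda>z. \<Omega> z a \<bullet> b) has_derivative (\<lambda>w. D w a \<bullet> b)) (at z)" for a b
    by (rule bounded_linear.has_derivative[OF bounded_linear_compose[OF bounded_linear_inner_left blinfun.bounded_linear_left] d])
  have "((\<lambda>z. \<Omega> z a \<bullet> b) has_derivative (\<lambda>w. - (D w b \<bullet> a))) (at z)"
    by (rule has_derivative_transform_within_open[OF has_derivative_minus[OF 1] assms(1,2)])
      (simp add: skew[of _ a b])
  from has_derivative_unique[OF 1 this] show ?thesis by meson
qed

text \<open>With \<open>C z (z - z0)\<close> read as a 1-form through the inner product, the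
  antisymmetrised derivative \<open>D u \<bullet> v - D v \<bullet> u\<close> is its exterior
  derivative. Keeping the factor \<open>z - z0\<close> outside the integral, together with
  \<open>C z0 = 0\<close>, exhibits the vanishing to second order.\<close>

lemma poincare_two_form:
  fixes \<Omega> :: "'e::euclidean_space \<Rightarrow> 'e \<Rightarrow>\<^sub>L 'e"
  assumes S: "open S" "convex S" "z0 \<in> S"
    and p\<Omega>: "\<And>k. pdiff_on k {0::real} S (\<lambda>_. \<Omega>)"
    and d\<Omega>: "\<And>z. z \<in> S \<Longrightarrow> (\<Omega> has_derivative blinfun_apply (D\<Omega> z)) (at z)"
    and cD\<Omega>: "continuous_on S D\<Omega>"
    and skew: "\<And>z a b. z \<in> S \<Longrightarrow> \<Omega> z a \<bullet> b = - (\<Omega> z b \<bullet> a)"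
    and closed: "\<And>z a b e. z \<in> S \<Longrightarrow> D\<Omega> z a b \<bullet> e - D\<Omega> z b a \<bullet> e + D\<Omega> z e a \<bullet> b = 0"
  obtains C where "\<And>k P. pdiff_on k P S (\<lambda>_::real. C)" "C z0 = 0"
    "\<And>z D u v. z \<in> S \<Longrightarrow> ((\<lambda>z. blinfun_apply (C z) (z - z0)) has_derivative D) (at z) \<Longrightarrow>
      D u \<bullet> v - D v \<bullet> u = (\<Omega> z u - \<Omega> z0 u) \<bullet> v"
proof -
  define p where "p s z = z0 + s *\<^sub>R (z - z0)" for s :: real and z
  \<comment> \<open>The factor \<open>s\<close> is the one in the radial homotopy operator on
    2-forms; contraction with \<open>z - z0\<close> is postponed.\<close>
  define f where "f s z = s *\<^sub>R (\<Omega> (p s z) - \<Omega> z0)" for s z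
  define C where "C z = integral {0..1} (\<lambda>s. f s z)" for z
  have p: "p s z \<in> S" if "s \<in> {0..1}" "z \<in> S" for s z
  proof -
    have "p s z = (1 - s) *\<^sub>R z0 + s *\<^sub>R z" by (simp add: p_def algebra_simps)
    then show ?thesis using convexD_alt[OF S(2) S(3) that(2)] that(1) by auto
  qed
  have c\<Omega>: "continuous_on S \<Omega>"
    using d\<Omega> by (rule has_derivative_continuous_on[OF has_derivative_at_withinI])
  have pf: "pdiff_on k {0..1} S f" for k
  proof -
    have 1: "pdiff_on k {0..1} S p" unfolding p_def
      by (intro pdiff_on_add pdiff_on_const pdiff_on_bilinear[OF bounded_bilinear_scaleR]
          pdiff_on_param[OF continuous_on_id] pdiff_on_diff pdiff_on_id)
    have "pdiff_on k {0..1::real} S (\<lambda>_. \<Omega>)"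
      by (rule pdiff_on_reparam[OF p\<Omega>, where h="\<lambda>_. 0"]) auto
    then have "pdiff_on k {0..1} S (\<lambda>s z. \<Omega> (p s z))"
      by (rule pdiff_on_compose[OF _ 1 p S(1)])
    then show ?thesis unfolding f_def
      by (intro pdiff_on_bilinear[OF bounded_bilinear_scaleR] pdiff_on_param[OF continuous_on_id]
          pdiff_on_diff pdiff_on_const)
  qed
  have cp: "continuous_on ({0..1} \<times> S) (\<lambda>q. p (fst q) (snd q))"
    unfolding p_def by (intro continuous_intros)
  have cs: "continuous_on {0..1} (\<lambda>s. p s z)" for z unfolding p_def by (intro continuous_intros)
  \<comment> \<open>One factor \<open>s\<close> comes from \<open>f\<close>, the other from the
    derivative of \<open>p s\<close>.\<close>
  have dC: "(C has_derivative (\<lambda>v. integral {0..1} (\<lambda>s. ((s * s) *\<^sub>R D\<Omega> (p s z)) v))) (at z)" if "z \<in> S" for z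
    unfolding C_def
  proof (rule has_derivative_integral_param[OF S(1) that])
    fix s :: real and y assume s: "s \<in> {0..1}" and y: "y \<in> S"
    have "(p s has_derivative (\<lambda>v. s *\<^sub>R v)) (at y)"
      unfolding p_def by (auto intro!: derivative_eq_intros)
    from has_derivative_compose[OF this d\<Omega>[OF p[OF s y]]]
    show "(f s has_derivative blinfun_apply ((s * s) *\<^sub>R D\<Omega> (p s y))) (at y)"
      unfolding f_def by (auto intro!: derivative_eq_intros simp: blinfun.bilinear_simps)
  next
    show "continuous_on ({0..1} \<times> S) (\<lambda>(s, z). f s z)" using pdiff_on_continuous[OF pf] .
    have "(\<lambda>q. p (fst q) (snd q)) ` ({0..1} \<times> S) \<subseteq> S" using p by auto
    from continuous_on_compose2[OF cD\<Omega> cp this]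
    show "continuous_on ({0..1} \<times> S) (\<lambda>(s, z). (s * s) *\<^sub>R D\<Omega> (p s z))"
      unfolding case_prod_beta by (intro continuous_intros)
  qed
  show ?thesis
  proof (rule that[of C])
    show "pdiff_on k P S (\<lambda>_. C)" for k and P :: "real set"
      unfolding C_def by (rule pdiff_on_integral[OF S(1) pf])
    show "C z0 = 0" by (simp add: C_def f_def p_def)
    fix z D u v assume z: "z \<in> S" and D: "((\<lambda>z. blinfun_apply (C z) (z - z0)) has_derivative D) (at z)"
    let ?\<zeta> = "z - z0"
    let ?DC = "\<lambda>w. integral {0..1} (\<lambda>s. ((s * s) *\<^sub>R D\<Omega> (p s z)) w)"
    have "((\<lambda>z. z - z0) has_derivative (\<lambda>w. w)) (at z)" by (auto intro!: derivative_eq_intros)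
    note dd = bounded_bilinear.FDERIV[OF bounded_bilinear_blinfun_apply dC[OF z] this]
    have D': "D w = C z w + ?DC w ?\<zeta>" for w
      by (rule has_derivative_unique[OF D dd, THEN fun_cong])
    have sub: "(\<lambda>s. p s z) ` {0..1} \<subseteq> S" using p[OF _ z] by auto
    have c1: "continuous_on {0..1} (\<lambda>s. \<Omega> (p s z))" by (rule continuous_on_compose2[OF c\<Omega> cs sub])
    have c2: "continuous_on {0..1} (\<lambda>s. D\<Omega> (p s z))" by (rule continuous_on_compose2[OF cD\<Omega> cs sub])
    have c3: "continuous_on {0..1} (\<lambda>s. f s z)" unfolding f_def by (intro continuous_intros c1)
    have c4: "continuous_on {0..1} (\<lambda>s. ((s * s) *\<^sub>R D\<Omega> (p s z)) w)" for w by (intro continuous_intros c2)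
    have Dw: "D w \<bullet> x = integral {0..1} (\<lambda>s. f s z w \<bullet> x + ((s * s) *\<^sub>R D\<Omega> (p s z)) w ?\<zeta> \<bullet> x)" for w x
    proof -
      have "C z w \<bullet> x = integral {0..1} (\<lambda>s. f s z w \<bullet> x)"
        unfolding C_def by (rule integral_blinfun_inner[OF c3])
      moreover have "?DC w ?\<zeta> \<bullet> x = integral {0..1} (\<lambda>s. ((s * s) *\<^sub>R D\<Omega> (p s z)) w ?\<zeta> \<bullet> x)"
        by (rule integral_blinfun_inner[OF c4])
      moreover have "(\<lambda>s. f s z w \<bullet> x) integrable_on {0..1}"
        "(\<lambda>s. ((s * s) *\<^sub>R D\<Omega> (p s z)) w ?\<zeta> \<bullet> x) integrable_on {0..1}"
        by (intro integrable_continuous_real continuous_intros c3 c2)+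
      ultimately show ?thesis by (simp add: D' inner_add_left integral_add)
    qed
    \<comment> \<open>A primitive in \<open>s\<close> for the exterior derivative of the integrand.
      The double weight \<open>s * s\<close> makes the lower boundary term vanish, and the upper one
      is the desired form.\<close>
    let ?H = "\<lambda>s. (s * s) * ((\<Omega> (p s z) u - \<Omega> z0 u) \<bullet> v)"
    let ?H' = "\<lambda>s. (s * s) * (D\<Omega> (p s z) ?\<zeta> u \<bullet> v) + 2 * s * ((\<Omega> (p s z) u - \<Omega> z0 u) \<bullet> v)"
    have "(?H' has_integral ?H 1 - ?H 0) {0..1}"
    proof (rule fundamental_theorem_of_calculus)
      fix s :: real assume s: "s \<in> {0..1}"
      have "((\<lambda>s. p s z) has_derivative (\<lambda>t. t *\<^sub>R ?\<zeta>)) (at s within {0..1})"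
        unfolding p_def by (auto intro!: derivative_eq_intros)
      from has_derivative_compose[OF this d\<Omega>[OF p[OF s z]]]
      have "((\<lambda>s. \<Omega> (p s z)) has_derivative (\<lambda>t. D\<Omega> (p s z) (t *\<^sub>R ?\<zeta>))) (at s within {0..1})" .
      then show "(?H has_vector_derivative ?H' s) (at s within {0..1})"
        unfolding has_vector_derivative_def
        by (auto intro!: derivative_eq_intros simp: blinfun.bilinear_simps algebra_simps)
    qed simp
    then have *: "integral {0..1} ?H' = (\<Omega> z u - \<Omega> z0 u) \<bullet> v"
      by (simp add: integral_unique p_def)
    have "D u \<bullet> v - D v \<bullet> u = integral {0..1} (\<lambda>s. (f s z u \<bullet> v + ((s * s) *\<^sub>R D\<Omega> (p s z)) u ?\<zeta> \<bullet> v)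
        - (f s z v \<bullet> u + ((s * s) *\<^sub>R D\<Omega> (p s z)) v ?\<zeta> \<bullet> u))"
      unfolding Dw by (rule integral_diff[symmetric]; intro integrable_continuous_real continuous_intros c3 c2)
    also have "\<dots> = integral {0..1} ?H'"
    proof (rule integral_cong)
      fix s :: real assume s: "s \<in> {0..1}"
      note ps = p[OF s z]
      \<comment> \<open>Closedness, with the skewness of the differentiated form, trades the two
        derivatives in directions \<open>u\<close> and \<open>v\<close> for the radial one, which is
        a derivative in \<open>s\<close> up to the scaling.\<close>
      have "D\<Omega> (p s z) u ?\<zeta> \<bullet> v - D\<Omega> (p s z) v ?\<zeta> \<bullet> u = D\<Omega> (p s z) ?\<zeta> u \<bullet> v"
        using closed[OF ps, of u ?\<zeta> v] skew_derivative[OF S(1) ps d\<Omega>[OF ps] skew, of v u ?\<zeta>] by simp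
      moreover have "f s z u \<bullet> v - f s z v \<bullet> u = 2 * s * ((\<Omega> (p s z) u - \<Omega> z0 u) \<bullet> v)"
        using skew[OF ps, of u v] skew[OF S(3), of u v]
        by (simp add: f_def blinfun.bilinear_simps inner_diff_left algebra_simps)
      moreover have "((s * s) *\<^sub>R D\<Omega> (p s z)) u ?\<zeta> \<bullet> v - ((s * s) *\<^sub>R D\<Omega> (p s z)) v ?\<zeta> \<bullet> u =
        (s * s) * (D\<Omega> (p s z) u ?\<zeta> \<bullet> v - D\<Omega> (p s z) v ?\<zeta> \<bullet> u)"
        by (simp add: blinfun.scaleR_left right_diff_distrib)
      ultimately show "(f s z u \<bullet> v + ((s * s) *\<^sub>R D\<Omega> (p s z)) u ?\<zeta> \<bullet> v)
        - (f s z v \<bullet> u + ((s * s) *\<^sub>R D\<Omega> (p s z)) v ?\<zeta> \<bullet> u) = ?H' s" by simp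
    qed
    finally show "D u \<bullet> v - D v \<bullet> u = (\<Omega> z u - \<Omega> z0 u) \<bullet> v" unfolding * .
  qed
qed

section \<open>The Moser field and its flow\<close>

lemma blinfun_inverse_ex:
  fixes A :: "'e::euclidean_space \<Rightarrow>\<^sub>L 'e"
  assumes "\<And>a. A a = 0 \<Longrightarrow> a = 0"
  shows "\<exists>B. A o\<^sub>L B = id_blinfun \<and> B o\<^sub>L A = id_blinfun"
proof -
  have lin: "linear (blinfun_apply A)" by (rule bounded_linear.linear[OF blinfun.bounded_linear_right])
  moreover have "inj (blinfun_apply A)"
    using linear_injective_0[OF lin] assms by auto
  ultimately obtain g where g: "linear g" "\<And>x. g (A x) = x" "\<And>x. A (g x) = x"
    using linear_injective_isomorphism by blast
  have "blinfun_apply (Blinfun g) = g"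
    by (rule bounded_linear_Blinfun_apply) (rule linear_conv_bounded_linear[THEN iffD1, OF g(1)])
  with g have "A o\<^sub>L Blinfun g = id_blinfun" "Blinfun g o\<^sub>L A = id_blinfun"
    by (auto intro!: blinfun_eqI)
  then show ?thesis by blast
qed

text \<open>Near \<open>z0\<close> every interpolated operator is a small perturbation of the
  invertible \<open>\<Omega> z0\<close>, so the field can be solved for. It has the form
  \<open>G t z (z - z0)\<close> with \<open>G t z0 = 0\<close>; both terms of the product rule
  vanish at the centre, and a small derivative nearby gives the Lipschitz constant.\<close>

lemma moser_field:
  fixes \<Omega> :: "'e::euclidean_space \<Rightarrow> 'e \<Rightarrow>\<^sub>L 'e"
  assumes S: "open S" "z0 \<in> S"
    and p\<Omega>: "\<And>k. pdiff_on k {0::real} S (\<lambda>_. \<Omega>)"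
    and nondeg: "\<And>a. \<Omega> z0 a = 0 \<Longrightarrow> a = 0"
    and pC: "\<And>k P. pdiff_on k P S (\<lambda>_::real. C)" and C0: "C z0 = 0"
  obtains W X where "open W" "z0 \<in> W" "W \<subseteq> S" "\<And>k. pdiff_on k {0..1} W X"
    "\<And>t z. t \<in> {0..1} \<Longrightarrow> z \<in> W \<Longrightarrow> (\<Omega> z + t *\<^sub>R (\<Omega> z0 - \<Omega> z)) (X t z) = blinfun_apply (C z) (z - z0)"
    "\<And>t w w'. t \<in> {0..1} \<Longrightarrow> w \<in> W \<Longrightarrow> w' \<in> W \<Longrightarrow> norm (X t w - X t w') \<le> norm (w - w') / 2"
proof -
  define A where "A t z = \<Omega> z + t *\<^sub>R (\<Omega> z0 - \<Omega> z)" for t z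
  obtain B0 where B0: "B0 o\<^sub>L \<Omega> z0 = id_blinfun" using blinfun_inverse_ex nondeg by blast
  \<comment> \<open>A perturbation of this size has product at most 1/2 with \<open>norm B0\<close>;
    the \<open>+ 1\<close> keeps the denominator positive.\<close>
  have pos: "1 / (2 * (norm B0 + 1)) > 0" by (auto intro!: divide_pos_pos add_nonneg_pos)
  obtain d where d: "d > 0" "ball z0 d \<subseteq> S"
    "\<And>x s. dist x z0 < d \<Longrightarrow> s \<in> {0..0::real} \<Longrightarrow> dist (\<Omega> x) (\<Omega> z0) \<le> 1 / (2 * (norm B0 + 1))"
    using uniform_cont_param[of 0 0 S "\<lambda>_. \<Omega>", OF _ S pos] pdiff_on_continuous[OF p\<Omega>] by auto
  define S1 where "S1 = ball z0 d"
  have S1: "open S1" "z0 \<in> S1" "S1 \<subseteq> S" using d by (auto simp: S1_def)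
  have inj: "a = 0" if t: "t \<in> {0..1}" and z: "z \<in> S1" and 0: "A t z a = 0" for t z a
  proof -
    have "norm (\<Omega> z0 - \<Omega> z) \<le> 1 / (2 * (norm B0 + 1))"
      using d(3)[of z 0] z by (auto simp: S1_def dist_norm norm_minus_commute)
    then have "norm B0 * norm (\<Omega> z0 - \<Omega> z) \<le> norm B0 * (1 / (2 * (norm B0 + 1)))"
      by (intro mult_left_mono) auto
    also have "\<dots> \<le> 1/2" by (simp add: divide_le_eq add_nonneg_pos)
    finally have n: "norm B0 * norm (\<Omega> z0 - \<Omega> z) \<le> 1/2" .
    have "a = B0 (\<Omega> z0 a)" using B0[THEN arg_cong, of "\<lambda>L. blinfun_apply L a"] by simp
    \<comment> \<open>A kernel vector of the interpolated operator sees only the deviation from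
      \<open>\<Omega> z0\<close>, so its norm is at most half of itself.\<close>
    also have "\<Omega> z0 a = (1 - t) *\<^sub>R (\<Omega> z0 - \<Omega> z) a"
      using 0 by (simp add: A_def blinfun.bilinear_simps algebra_simps)
    finally have "norm a = norm (B0 ((1 - t) *\<^sub>R (\<Omega> z0 - \<Omega> z) a))" by simp
    also have "\<dots> \<le> norm B0 * (\<bar>1 - t\<bar> * (norm (\<Omega> z0 - \<Omega> z) * norm a))"
      by (intro order_trans[OF norm_blinfun] mult_left_mono) (auto intro: mult_left_mono norm_blinfun)
    also have "\<dots> = \<bar>1 - t\<bar> * (norm B0 * norm (\<Omega> z0 - \<Omega> z) * norm a)" by (simp add: algebra_simps)
    also have "\<dots> \<le> 1 * (1/2 * norm a)"
      using t by (intro mult_mono mult_right_mono n) auto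
    finally show ?thesis by simp
  qed
  define R where "R t z = (SOME B. A t z o\<^sub>L B = id_blinfun \<and> B o\<^sub>L A t z = id_blinfun)" for t z
  have R: "A t z o\<^sub>L R t z = id_blinfun" "R t z o\<^sub>L A t z = id_blinfun" if "t \<in> {0..1}" "z \<in> S1" for t z
    using someI_ex[OF blinfun_inverse_ex[of "A t z"]] inj[OF that] unfolding R_def by blast+
  have p\<Omega>1: "pdiff_on k {0..1::real} S1 (\<lambda>_. \<Omega>)" for k
    by (rule pdiff_on_reparam[OF p\<Omega>, where h="\<lambda>_. 0"]) (use S1 in auto)
  have pA: "pdiff_on k {0..1} S1 A" for k
    unfolding A_def by (intro pdiff_on_add p\<Omega>1 pdiff_on_bilinear[OF bounded_bilinear_scaleR]
        pdiff_on_param[OF continuous_on_id] pdiff_on_diff pdiff_on_const)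
  have pR: "pdiff_on k {0..1} S1 R" for k by (rule pdiff_on_blinfun_inverse[OF S1(1) pA R])
  define G where "G t z = R t z o\<^sub>L C z" for t z
  define X where "X t z = G t z (z - z0)" for t z
  have pG: "pdiff_on k {0..1} S1 G" for k unfolding G_def
    by (intro pdiff_on_bilinear[OF bounded_bilinear_blinfun_compose] pR pdiff_on_reparam[OF pC, where h="\<lambda>x. x"])
      (use S1 in auto)
  have pX: "pdiff_on k {0..1} S1 X" for k unfolding X_def
    by (intro pdiff_on_bilinear[OF bounded_bilinear_blinfun_apply] pG pdiff_on_diff pdiff_on_id pdiff_on_const)
  obtain F where F: "\<And>t z. t \<in> {0..1} \<Longrightarrow> z \<in> S1 \<Longrightarrow> (X t has_derivative blinfun_apply (F t z)) (at z)"
    and pF: "pdiff_on 0 {0..1} S1 F" using pdiff_on_SucE_blinfun[OF pX] by blast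
  obtain G' where G': "\<And>t z. t \<in> {0..1} \<Longrightarrow> z \<in> S1 \<Longrightarrow> (G t has_derivative G' t z) (at z)"
    using pdiff_on_SucE[OF pG] by metis
  \<comment> \<open>The field vanishes to second order at the centre, hence it is a contraction near it.\<close>
  have F0: "F t z0 = 0" if t: "t \<in> {0..1}" for t
  proof -
    have "((\<lambda>z. z - z0) has_derivative (\<lambda>w. w)) (at z0)" by (auto intro!: derivative_eq_intros)
    from bounded_bilinear.FDERIV[OF bounded_bilinear_blinfun_apply G'[OF t S1(2)] this]
    have "(X t has_derivative (\<lambda>w. 0)) (at z0)"
      by (simp add: X_def[abs_def] G_def C0 blinfun.zero_right)
    from has_derivative_unique[OF F[OF t S1(2)] this] show ?thesis
      by (auto intro: blinfun_eqI)
  qed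
  obtain r where r: "r > 0" "ball z0 r \<subseteq> S1"
    "\<And>z t. dist z z0 < r \<Longrightarrow> t \<in> {0..1} \<Longrightarrow> dist (F t z) (F t z0) \<le> 1/2"
    by (rule uniform_cont_param[OF pdiff_on_continuous[OF pF] S1(1,2), of "1/2"]) auto
  show ?thesis
  proof (rule that[of "ball z0 r" X])
    show "pdiff_on k {0..1} (ball z0 r) X" for k
      by (rule pdiff_on_reparam[OF pX, where h="\<lambda>x. x"]) (use r in auto)
    show "(\<Omega> z + t *\<^sub>R (\<Omega> z0 - \<Omega> z)) (X t z) = C z (z - z0)" if "t \<in> {0..1}" "z \<in> ball z0 r" for t z
      using R(1)[of t z, THEN arg_cong, of "\<lambda>L. blinfun_apply L (C z (z - z0))"] that r(2)
      by (auto simp: X_def G_def A_def)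
    show "norm (X t w - X t w') \<le> norm (w - w') / 2"
      if t: "t \<in> {0..1}" and w: "w \<in> ball z0 r" "w' \<in> ball z0 r" for t w w'
    proof -
      have "norm (X t w - X t w') \<le> 1/2 * norm (w - w')"
      proof (rule differentiable_bound[OF convex_ball _ _ w])
        fix z assume z: "z \<in> ball z0 r"
        then show "(X t has_derivative blinfun_apply (F t z)) (at z within ball z0 r)"
          using F[OF t, THEN has_derivative_at_withinI] r(2) by blast
        show "onorm (blinfun_apply (F t z)) \<le> 1/2"
          using r(3)[OF _ t, of z] z by (simp add: F0[OF t] norm_blinfun.rep_eq dist_commute)
      qed
      then show ?thesis by simp
    qed
  qed (use r S1 in auto)
qed

text \<open>The invariance of the pulled-back form is checked by differentiating its values on
  transported vectors. Two relations replace Cartan's formula: the linearised equation for the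
  derivative of the flow, and the spatial derivative of the equation defining
  \<open>X\<close>.\<close>

lemma moser_flow:
  fixes \<Omega> :: "'e::euclidean_space \<Rightarrow> 'e \<Rightarrow>\<^sub>L 'e"
  assumes W: "open W" "z0 \<in> W"
    and d\<Omega>: "\<And>z. z \<in> W \<Longrightarrow> (\<Omega> has_derivative blinfun_apply (D\<Omega> z)) (at z)"
    and skew: "\<And>z a b. z \<in> W \<Longrightarrow> \<Omega> z a \<bullet> b = - (\<Omega> z b \<bullet> a)"
    and closed: "\<And>z a b e. z \<in> W \<Longrightarrow> D\<Omega> z a b \<bullet> e - D\<Omega> z b a \<bullet> e + D\<Omega> z e a \<bullet> b = 0"
    and \<alpha>: "\<And>z D u v. z \<in> W \<Longrightarrow> (\<alpha> has_derivative D) (at z) \<Longrightarrow> D u \<bullet> v - D v \<bullet> u = (\<Omega> z u - \<Omega> z0 u) \<bullet> v"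
    and pX: "\<And>k. pdiff_on k {0..1} W X"
    and X: "\<And>t z. t \<in> {0..1} \<Longrightarrow> z \<in> W \<Longrightarrow> (\<Omega> z + t *\<^sub>R (\<Omega> z0 - \<Omega> z)) (X t z) = \<alpha> z"
    and lip: "\<And>t w w'. t \<in> {0..1} \<Longrightarrow> w \<in> W \<Longrightarrow> w' \<in> W \<Longrightarrow> norm (X t w - X t w') \<le> norm (w - w') / 2"
    and X0: "\<And>t. t \<in> {0..1} \<Longrightarrow> X t z0 = 0"
  obtains Z \<phi> where "open Z" "z0 \<in> Z" "Z \<subseteq> W" "\<And>k. pdiff_on k {0::real} Z (\<lambda>_. \<phi>)"
    "\<And>z D u v. z \<in> Z \<Longrightarrow> (\<phi> has_derivative D) (at z) \<Longrightarrow> \<Omega> z0 (D u) \<bullet> D v = \<Omega> z u \<bullet> v"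
proof -
  obtain r where r: "r > 0" "cball z0 r \<subseteq> W" using W open_contains_cball by blast
  \<comment> \<open>Starting within \<open>r/2\<close> and moving at speed at most
    \<open>r/2\<close> for time at most 1, a curve stays in \<open>cball z0 r\<close>. The speed
    bound follows from \<open>lip\<close> and \<open>X0\<close>.\<close>
  define Z where "Z = ball z0 (r/2)"
  have Z: "open Z" "z0 \<in> Z" "Z \<subseteq> W" using r by (auto simp: Z_def subset_iff)
  have cX: "continuous_on ({0..1} \<times> cball z0 r) (\<lambda>(t, z). X t z)"
    by (rule continuous_on_subset[OF pdiff_on_continuous[OF pX]]) (use r in auto)
  have Xle: "norm (X t z) \<le> r/2" if "t \<in> {0..1}" "z \<in> cball z0 r" for t z
    using lip[OF that(1), of z z0] X0[OF that(1)] that(2) r(2) W(2)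
    by (auto simp: subset_iff dist_norm norm_minus_commute)
  have ex: "\<exists>\<phi>. continuous_on {0..1} \<phi> \<and> (\<forall>t\<in>{0..1}. \<phi> t \<in> cball z0 r) \<and>
      (\<forall>t\<in>{0..1}. \<phi> t = z + integral {0..t} (\<lambda>s. X s (\<phi> s)))" if z: "z \<in> Z" for z
  proof (rule picard[OF cX])
    show "z \<in> cball z0 r" using z r by (auto simp: Z_def)
    show "norm (X s w - X s w') \<le> norm (w - w') / 2"
      if "s \<in> {0..1}" "w \<in> cball z0 r" "w' \<in> cball z0 r" for s w w'
      using lip[OF that(1)] that r(2) by blast
    fix g :: "real \<Rightarrow> 'e" and t :: real assume g: "continuous_on {0..1} g" "\<And>s. s \<in> {0..1} \<Longrightarrow> g s \<in> cball z0 r" and t: "t \<in> {0..1}"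
    have "norm (integral {0..t} (\<lambda>s. X s (g s))) \<le> r/2 * (t - 0)"
    proof (rule integral_bound)
      show "continuous_on {0..t} (\<lambda>s. X s (g s))"
        by (rule continuous_on_subset[OF continuous_on_slice[OF cX g]]) (use t in auto)
    qed (use t Xle g in auto)
    also have "\<dots> \<le> r/2 * 1" using t r by (intro mult_left_mono) auto
    finally have "norm (integral {0..t} (\<lambda>s. X s (g s))) \<le> r/2" by simp
    moreover have "norm (z - z0) \<le> r/2" using z by (simp add: Z_def dist_norm norm_minus_commute)
    ultimately have "norm ((z - z0) + integral {0..t} (\<lambda>s. X s (g s))) \<le> r"
      by (intro order_trans[OF norm_triangle_ineq]) simp
    then show "z + integral {0..t} (\<lambda>s. X s (g s)) \<in> cball z0 r"
      by (simp add: dist_norm norm_minus_commute algebra_simps)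
  qed auto
  define curve where "curve z = (SOME \<phi>. continuous_on {0..1} \<phi> \<and> (\<forall>t\<in>{0..1}. \<phi> t \<in> cball z0 r) \<and>
      (\<forall>t\<in>{0..1}. \<phi> t = z + integral {0..t} (\<lambda>s. X s (\<phi> s))))" for z
  define \<phi> where "\<phi> t z = curve z t" for t z
  note some = someI_ex[OF ex, folded curve_def, folded \<phi>_def]
  have c\<phi>: "continuous_on {0..1} (\<lambda>t. \<phi> t z)" if "z \<in> Z" for z
    using some[OF that] by (simp add: \<phi>_def)
  have \<phi>W: "\<phi> t z \<in> W" if "t \<in> {0..1}" "z \<in> Z" for t z
    using some[OF that(2)] that(1) r(2) by blast
  have \<phi>: "\<phi> t z = z + integral {0..t} (\<lambda>s. X s (\<phi> s z))" if "t \<in> {0..1}" "z \<in> Z" for t z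
    using some[OF that(2), THEN conjunct2, THEN conjunct2, rule_format, OF that(1)] .
  have p\<phi>: "pdiff_on k {0..1} Z \<phi>" for k
  proof (rule integral_equation_pdiff_on[where X="\<lambda>s q. X s (snd q)" and W=W and init="\<lambda>z. z"])
    show "pdiff_on k {0..1} (Z \<times> W) (\<lambda>s q. X s (snd q))"
      by (rule pdiff_on_compose[OF pX pdiff_on_linear[OF bounded_linear_snd pdiff_on_id]])
        (use Z(1) W(1) in \<open>auto intro: open_Times\<close>)
  qed (use Z W lip \<phi>W c\<phi> \<phi> pdiff_on_id in auto)
  obtain \<Phi> where \<Phi>: "\<And>t z. t \<in> {0..1} \<Longrightarrow> z \<in> Z \<Longrightarrow> (\<phi> t has_derivative blinfun_apply (\<Phi> t z)) (at z)"
    and p\<Phi>: "pdiff_on 0 {0..1} Z \<Phi>" using pdiff_on_SucE_blinfun[OF p\<phi>] by blast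
  obtain F where F: "\<And>t z. t \<in> {0..1} \<Longrightarrow> z \<in> W \<Longrightarrow> (X t has_derivative blinfun_apply (F t z)) (at z)"
    and pF: "pdiff_on 0 {0..1} W F" using pdiff_on_SucE_blinfun[OF pX] by blast
  define N where "N t z = F t (\<phi> t z) o\<^sub>L \<Phi> t z" for t z
  have pN: "pdiff_on 0 {0..1} Z N" unfolding N_def
    by (intro pdiff_on_bilinear[OF bounded_bilinear_blinfun_compose] p\<Phi>
        pdiff_on_compose[OF pF p\<phi> \<phi>W Z(1)])
  have pX\<phi>: "pdiff_on 0 {0..1} Z (\<lambda>s z. X s (\<phi> s z))"
    by (rule pdiff_on_compose[OF pX p\<phi> \<phi>W Z(1)])
  have \<Phi>_eq: "\<Phi> t z v = v + integral {0..t} (\<lambda>s. N s z v)" if t: "t \<in> {0..1}" and z: "z \<in> Z" for t z v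
  proof -
    have sub: "{0..t} \<times> Z \<subseteq> {0..1} \<times> Z" using t by auto
    have "((\<lambda>z. integral {0..t} (\<lambda>s. X s (\<phi> s z))) has_derivative (\<lambda>v. integral {0..t} (\<lambda>s. N s z v))) (at z)"
    proof (rule has_derivative_integral_param[OF Z(1) z])
      show "((\<lambda>z. X s (\<phi> s z)) has_derivative blinfun_apply (N s y)) (at y)" if "s \<in> {0..t}" "y \<in> Z" for s y
      proof -
        have "blinfun_apply (N s y) = (\<lambda>w. F s (\<phi> s y) (\<Phi> s y w))" by (auto simp: N_def)
        then show ?thesis using has_derivative_compose[OF \<Phi> F[OF _ \<phi>W], of s y s] that t by simp
      qed
    qed (use continuous_on_subset[OF pdiff_on_continuous[OF pN] sub]
        continuous_on_subset[OF pdiff_on_continuous[OF pX\<phi>] sub] in auto)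
    then have "((\<lambda>z. z + integral {0..t} (\<lambda>s. X s (\<phi> s z))) has_derivative (\<lambda>v. v + integral {0..t} (\<lambda>s. N s z v))) (at z)"
      by (intro has_derivative_add has_derivative_ident)
    then have "(\<phi> t has_derivative (\<lambda>v. v + integral {0..t} (\<lambda>s. N s z v))) (at z)"
      by (rule has_derivative_transform_within_open[OF _ Z(1) z]) (simp add: \<phi>[OF t])
    from has_derivative_unique[OF \<Phi>[OF t z] this] show ?thesis by meson
  qed
  have d\<phi>: "((\<lambda>t. \<phi> t z) has_vector_derivative X t (\<phi> t z)) (at t within {0..1})" if t: "t \<in> {0..1}" and z: "z \<in> Z" for t z
  proof -
    have "continuous_on {0..1} (\<lambda>s. X s (\<phi> s z))"
      by (rule continuous_on_slice[OF pdiff_on_continuous[OF pX\<phi>]]) (use z in auto)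
    from integral_has_vector_derivative[OF this t]
    have "((\<lambda>t. z + integral {0..t} (\<lambda>s. X s (\<phi> s z))) has_vector_derivative X t (\<phi> t z)) (at t within {0..1})"
      by (auto intro!: derivative_eq_intros)
    then show ?thesis by (rule has_vector_derivative_transform[OF t, rotated]) (simp add: \<phi> z)
  qed
  have d\<Phi>: "((\<lambda>t. \<Phi> t z v) has_vector_derivative N t z v) (at t within {0..1})" if t: "t \<in> {0..1}" and z: "z \<in> Z" for t z v
  proof -
    have "continuous_on {0..1} (\<lambda>s. N s z)"
      by (rule continuous_on_slice[OF pdiff_on_continuous[OF pN]]) (use z in auto)
    then have "continuous_on {0..1} (\<lambda>s. N s z v)" by (intro continuous_intros)
    from integral_has_vector_derivative[OF this t]
    have "((\<lambda>t. v + integral {0..t} (\<lambda>s. N s z v)) has_vector_derivative N t z v) (at t within {0..1})"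
      by (auto intro!: derivative_eq_intros)
    then show ?thesis by (rule has_vector_derivative_transform[OF t, rotated]) (simp add: \<Phi>_eq z)
  qed
  have pull: "\<Omega> z0 (\<Phi> 1 z u) \<bullet> \<Phi> 1 z v = \<Omega> z u \<bullet> v" if z: "z \<in> Z" for z u v
  proof -
    \<comment> \<open>\<open>?A t\<close> is the interpolated form at the moving point, and
      \<open>?h\<close> its value on the vectors carried by the flow. Constancy of \<open>?h\<close>
      gives the claim: it starts from \<open>\<Omega> z\<close> and ends with
      \<open>\<Omega> z0\<close>.\<close>
    let ?A = "\<lambda>t. \<Omega> (\<phi> t z) + t *\<^sub>R (\<Omega> z0 - \<Omega> (\<phi> t z))"
    let ?h = "\<lambda>t. ?A t (\<Phi> t z u) \<bullet> \<Phi> t z v"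
    have dh: "(?h has_derivative (\<lambda>_. 0)) (at t within {0..1})" if t: "t \<in> {0..1}" for t
    proof -
      let ?c = "\<phi> t z" and ?p = "\<Phi> t z u" and ?q = "\<Phi> t z v"
      note c = \<phi>W[OF t z]
      have 1: "((\<lambda>t. \<Omega> (\<phi> t z)) has_derivative (\<lambda>\<tau>. D\<Omega> ?c (\<tau> *\<^sub>R X t ?c))) (at t within {0..1})"
        using has_derivative_compose[OF d\<phi>[OF t z, unfolded has_vector_derivative_def] d\<Omega>[OF c]] .
      have A: "(?A has_derivative (\<lambda>\<tau>. D\<Omega> ?c (\<tau> *\<^sub>R X t ?c) + (\<tau> *\<^sub>R (\<Omega> z0 - \<Omega> ?c) - t *\<^sub>R D\<Omega> ?c (\<tau> *\<^sub>R X t ?c))))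
          (at t within {0..1})"
        by (auto intro!: derivative_eq_intros 1 simp: algebra_simps)
      note P = bounded_bilinear.FDERIV[OF bounded_bilinear_blinfun_apply A d\<Phi>[OF t z, of u, unfolded has_vector_derivative_def]]
      note H = has_derivative_inner[OF P d\<Phi>[OF t z, of v, unfolded has_vector_derivative_def]]
      let ?D = "\<lambda>w. (1 - t) *\<^sub>R D\<Omega> ?c w (X t ?c) + ?A t (F t ?c w)"
      \<comment> \<open>The product rule on the left side of \<open>X\<close> computes the
        derivative of \<open>\<alpha>\<close>, so the hypothesis on \<open>\<alpha>\<close> yields a
        relation between the spatial derivatives of \<open>X\<close> and of
        \<open>\<Omega>\<close>.\<close>
      have "((\<lambda>z. (\<Omega> z + t *\<^sub>R (\<Omega> z0 - \<Omega> z)) (X t z)) has_derivative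
          (\<lambda>w. ?A t (F t ?c w) + (D\<Omega> ?c w + t *\<^sub>R (0 - D\<Omega> ?c w)) (X t ?c))) (at ?c)"
        by (rule bounded_bilinear.FDERIV[OF bounded_bilinear_blinfun_apply _ F[OF t c]])
          (intro has_derivative_add d\<Omega>[OF c] has_derivative_scaleR_right has_derivative_diff has_derivative_const)
      then have "(\<alpha> has_derivative (\<lambda>w. ?A t (F t ?c w) + (D\<Omega> ?c w + t *\<^sub>R (0 - D\<Omega> ?c w)) (X t ?c))) (at ?c)"
        by (rule has_derivative_transform_within_open[OF _ W(1) c]) (rule X[OF t])
      from \<alpha>[OF c this, of ?p ?q]
      have a: "?D ?p \<bullet> ?q - ?D ?q \<bullet> ?p = (\<Omega> ?c ?p - \<Omega> z0 ?p) \<bullet> ?q"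
        by (simp add: blinfun.bilinear_simps algebra_simps)
      have skA: "?A t ?p \<bullet> w = - (?A t w \<bullet> ?p)" for w
        using skew[OF c, of ?p w] skew[OF W(2), of ?p w]
        by (simp add: blinfun.bilinear_simps inner_add_left inner_diff_left algebra_simps)
      \<comment> \<open>The time derivative regroups into two vanishing brackets: closedness,
        weighted by \<open>1 - t\<close> because the constant form contributes no derivative, and
        the identity for the exterior derivative of \<open>\<alpha>\<close>.\<close>
      have "(D\<Omega> ?c (X t ?c) ?p + ((\<Omega> z0 - \<Omega> ?c) ?p - t *\<^sub>R D\<Omega> ?c (X t ?c) ?p)) \<bullet> ?q
        + ?A t (F t ?c ?p) \<bullet> ?q + ?A t ?p \<bullet> F t ?c ?q
        = (1 - t) * (D\<Omega> ?c (X t ?c) ?p \<bullet> ?q - D\<Omega> ?c ?p (X t ?c) \<bullet> ?q + D\<Omega> ?c ?q (X t ?c) \<bullet> ?p)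
          + (?D ?p \<bullet> ?q - ?D ?q \<bullet> ?p - (\<Omega> ?c ?p - \<Omega> z0 ?p) \<bullet> ?q)"
        unfolding skA by (simp add: blinfun.diff_left inner_add_left inner_diff_left algebra_simps)
      also have "\<dots> = 0" unfolding a closed[OF c] by simp
      finally have zero: "(D\<Omega> ?c (X t ?c) ?p + ((\<Omega> z0 - \<Omega> ?c) ?p - t *\<^sub>R D\<Omega> ?c (X t ?c) ?p)) \<bullet> ?q
        + ?A t (F t ?c ?p) \<bullet> ?q + ?A t ?p \<bullet> F t ?c ?q = 0" .
      show ?thesis
      proof (rule has_derivative_eq_rhs[OF H], rule ext)
        fix \<tau> :: real
        have "?A t ?p \<bullet> (\<tau> *\<^sub>R N t z v) +
          (?A t (\<tau> *\<^sub>R N t z u) + (D\<Omega> ?c (\<tau> *\<^sub>R X t ?c) + (\<tau> *\<^sub>R (\<Omega> z0 - \<Omega> ?c) - t *\<^sub>R D\<Omega> ?c (\<tau> *\<^sub>R X t ?c))) ?p) \<bullet> ?q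
          = \<tau> * ((D\<Omega> ?c (X t ?c) ?p + ((\<Omega> z0 - \<Omega> ?c) ?p - t *\<^sub>R D\<Omega> ?c (X t ?c) ?p)) \<bullet> ?q
        + ?A t (F t ?c ?p) \<bullet> ?q + ?A t ?p \<bullet> F t ?c ?q)"
          by (simp add: N_def blinfun.bilinear_simps inner_add_left inner_diff_left algebra_simps)
        then show "?A t ?p \<bullet> (\<tau> *\<^sub>R N t z v) +
          (?A t (\<tau> *\<^sub>R N t z u) + (D\<Omega> ?c (\<tau> *\<^sub>R X t ?c) + (\<tau> *\<^sub>R (\<Omega> z0 - \<Omega> ?c) - t *\<^sub>R D\<Omega> ?c (\<tau> *\<^sub>R X t ?c))) ?p) \<bullet> ?q = 0"
          unfolding zero by simp
      qed
    qed
    have "?h 1 = ?h 0"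
      by (rule has_derivative_zero_unique[OF convex_real_interval(5) dh]) auto
    moreover have "\<phi> 0 z = z" "\<Phi> 0 z w = w" for w using \<phi>[of 0 z] \<Phi>_eq[of 0 z w] z by auto
    ultimately show ?thesis by simp
  qed
  show ?thesis
  proof (rule that[OF Z, of "\<phi> 1"])
    show "pdiff_on k {0::real} Z (\<lambda>_. \<phi> 1)" for k
      by (rule pdiff_on_reparam[OF p\<phi>, where h="\<lambda>_. 1"]) auto
    show "\<Omega> z0 (D u) \<bullet> D v = \<Omega> z u \<bullet> v" if "z \<in> Z" "(\<phi> 1 has_derivative D) (at z)" for z D u v
      using has_derivative_unique[OF that(2) \<Phi>[of 1 z]] pull[OF that(1)] that(1) by simp
  qed
qed

section \<open>The local normal form\<close>

text \<open>Symplectic Gram-Schmidt. While fewer than \<open>n\<close> pairs are chosen, their span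
  is not the whole space, so projecting off it leaves some nonzero vector; nondegeneracy gives it a
  partner, which is projected and normalised.\<close>

lemma symplectic_basis_ex:
  fixes \<eta> :: "'e::euclidean_space \<Rightarrow> 'e \<Rightarrow> real"
  assumes bil: "bilinear \<eta>" and alt: "\<And>a. \<eta> a a = 0"
    and nondeg: "\<And>a. (\<And>b. \<eta> a b = 0) \<Longrightarrow> a = 0" and dim: "DIM('e) = 2 * n"
  shows "\<exists>e f :: nat \<Rightarrow> 'e. \<forall>i\<in>{1..n}. \<forall>j\<in>{1..n}.
    \<eta> (e i) (f j) = (if i = j then 1 else 0) \<and> \<eta> (e i) (e j) = 0 \<and> \<eta> (f i) (f j) = 0"
proof -
  note bi = bilinear_ladd[OF bil] bilinear_radd[OF bil] bilinear_lmul[OF bil] bilinear_rmul[OF bil]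
    bilinear_lsub[OF bil] bilinear_rsub[OF bil] bilinear_lneg[OF bil] bilinear_rneg[OF bil]
    bilinear_lzero[OF bil] bilinear_rzero[OF bil]
  have skew: "\<eta> a b = - \<eta> b a" for a b
    using alt[of "a + b"] alt[of a] alt[of b] by (simp add: bilinear_ladd[OF bil] bilinear_radd[OF bil])
  have lsum: "\<eta> (sum g I) b = (\<Sum>i\<in>I. \<eta> (g i) b)" for g :: "nat \<Rightarrow> 'e" and I b
    by (induction I rule: infinite_finite_induct) (auto simp: bi)
  have rsum: "\<eta> b (sum g I) = (\<Sum>i\<in>I. \<eta> b (g i))" for g :: "nat \<Rightarrow> 'e" and I b
    by (induction I rule: infinite_finite_induct) (auto simp: bi)
  have "\<exists>e f :: nat \<Rightarrow> 'e. \<forall>i\<in>{1..m}. \<forall>j\<in>{1..m}.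
    \<eta> (e i) (f j) = (if i = j then 1 else 0) \<and> \<eta> (e i) (e j) = 0 \<and> \<eta> (f i) (f j) = 0" if "m \<le> n" for m
    using that
  proof (induction m)
    case (Suc m)
    from Suc.IH[OF Suc_leD[OF Suc.prems]]
    obtain e f :: "nat \<Rightarrow> 'e" where "\<forall>i\<in>{1..m}. \<forall>j\<in>{1..m}.
      \<eta> (e i) (f j) = (if i = j then 1 else 0) \<and> \<eta> (e i) (e j) = 0 \<and> \<eta> (f i) (f j) = 0"
      by (elim exE) 
    then have ef: "\<eta> (e i) (f j) = (if i = j then 1 else 0)" "\<eta> (e i) (e j) = 0" "\<eta> (f i) (f j) = 0"
      if "i \<in> {1..m}" "j \<in> {1..m}" for i j
      using that by auto
    have fe: "\<eta> (f i) (e j) = (if i = j then - 1 else 0)" if "i \<in> {1..m}" "j \<in> {1..m}" for i j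
      using skew[of "f i" "e j"] ef(1)[OF that(2,1)] by auto
    \<comment> \<open>The projection onto the \<eta>-orthogonal complement of the pairs. The
      opposite signs reflect that \<eta> is -1 on the reversed pairs.\<close>
    define P where "P v = v - (\<Sum>j=1..m. \<eta> v (f j) *\<^sub>R e j - \<eta> v (e j) *\<^sub>R f j)" for v
    have Pe: "\<eta> (P v) (e i) = 0" and Pf: "\<eta> (P v) (f i) = 0" if i: "i \<in> {1..m}" for v i
    proof -
      have "\<eta> (P v) (e i) = \<eta> v (e i) - (\<Sum>j=1..m. if j = i then \<eta> v (e i) else 0)"
        unfolding P_def bi lsum
        by (intro arg_cong2[of _ _ _ _ minus] refl sum.cong) (use i ef fe in \<open>auto simp: bi\<close>)
      then show "\<eta> (P v) (e i) = 0" using i by simp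
      have "\<eta> (P v) (f i) = \<eta> v (f i) - (\<Sum>j=1..m. if j = i then \<eta> v (f i) else 0)"
        unfolding P_def bi lsum
        by (intro arg_cong2[of _ _ _ _ minus] refl sum.cong) (use i ef fe in \<open>auto simp: bi\<close>)
      then show "\<eta> (P v) (f i) = 0" using i by simp
    qed
    have "\<exists>v. P v \<noteq> 0"
    proof (rule ccontr)
      assume "\<not> (\<exists>v. P v \<noteq> 0)"
      then have P0: "P v = 0" for v by blast
      have "v \<in> span (e ` {1..m} \<union> f ` {1..m})" for v
      proof -
        have "v = (\<Sum>j=1..m. \<eta> v (f j) *\<^sub>R e j - \<eta> v (e j) *\<^sub>R f j)"
          using P0[of v] unfolding P_def by (rule eq_iff_diff_eq_0[THEN iffD2])
        also have "\<dots> \<in> span (e ` {1..m} \<union> f ` {1..m})"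
          by (intro span_sum span_diff span_scale) (auto intro: span_base)
        finally show ?thesis .
      qed
      then have "UNIV \<subseteq> span (e ` {1..m} \<union> f ` {1..m})" by blast
      then have "dim (UNIV :: 'e set) \<le> card (e ` {1..m} \<union> f ` {1..m})"
        by (rule dim_le_card) auto
      also have "\<dots> \<le> card (e ` {1..m}) + card (f ` {1..m})" by (rule card_Un_le)
      also have "\<dots> \<le> m + m" by (intro add_mono order_trans[OF card_image_le]) auto
      finally show False using dim Suc.prems by (simp add: dim_UNIV)
    qed
    then obtain u where u: "u \<noteq> 0" "\<And>i. i \<in> {1..m} \<Longrightarrow> \<eta> u (e i) = 0" "\<And>i. i \<in> {1..m} \<Longrightarrow> \<eta> u (f i) = 0"
      using Pe Pf by blast
    obtain v where v: "\<eta> u v \<noteq> 0" using nondeg u(1) by blast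
    \<comment> \<open>Projecting the normalised partner does not change its pairing with
      \<open>u\<close>, since \<open>u\<close> is already orthogonal to all earlier pairs.\<close>
    define w where "w = P ((1 / \<eta> u v) *\<^sub>R v)"
    have "\<eta> u w = 1 - (\<Sum>j=1..m. 0)"
      unfolding w_def P_def bi rsum
      by (intro arg_cong2[of _ _ _ _ minus] sum.cong) (use u v in \<open>auto simp: bi\<close>)
    then have uw: "\<eta> u w = 1" by simp
    have w: "\<eta> w (e i) = 0" "\<eta> w (f i) = 0" if "i \<in> {1..m}" for i
      using Pe Pf that by (auto simp: w_def)
    have *: "\<eta> (e i) u = 0" "\<eta> (f i) u = 0" "\<eta> (e i) w = 0" "\<eta> (f i) w = 0" if "i \<in> {1..m}" for i
      using u w that skew[of "e i"] skew[of "f i"] by auto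
    show ?case
    proof (rule exI[of _ "e(Suc m := u)"], rule exI[of _ "f(Suc m := w)"], intro ballI)
      fix i j assume "i \<in> {1..Suc m}" "j \<in> {1..Suc m}"
      then have "i = Suc m \<or> i \<noteq> Suc m \<and> i \<in> {1..m}" "j = Suc m \<or> j \<noteq> Suc m \<and> j \<in> {1..m}" by auto
      then show "\<eta> ((e(Suc m := u)) i) ((f(Suc m := w)) j) = (if i = j then 1 else 0) \<and>
        \<eta> ((e(Suc m := u)) i) ((e(Suc m := u)) j) = 0 \<and> \<eta> ((f(Suc m := w)) i) ((f(Suc m := w)) j) = 0"
        using ef u(2,3) w uw * alt by (elim disjE) (simp_all)
    qed
  qed simp
  then show ?thesis by blast
qed

text \<open>\<open>M\<close> sends the Euclidean basis, indexed by \<open>b\<close>, to a symplectic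
  basis, and \<open>L\<close> reads off the coordinates. Independence of that basis costs no extra
  work: \<open>M\<close> pulls \<eta> back to the standard form, and a kernel vector of
  \<open>M\<close>, tested there against basis vectors, has only zero coordinates.\<close>

lemma symplectic_normal_form:
  fixes \<eta> :: "'e::euclidean_space \<Rightarrow> 'e \<Rightarrow> real" and b :: "nat + nat \<Rightarrow> 'e"
  assumes bil: "bilinear \<eta>" and alt: "\<And>a. \<eta> a a = 0"
    and nondeg: "\<And>a. (\<And>b. \<eta> a b = 0) \<Longrightarrow> a = 0" and dim: "DIM('e) = 2 * n"
    and b: "bij_betw b ({1..n} <+> {1..n}) Basis"
  obtains L M :: "'e \<Rightarrow> 'e" where "linear L" "linear M" "\<And>x. L (M x) = x" "\<And>x. M (L x) = x"
    "\<And>u v. \<eta> u v = (\<Sum>j=1..n. (L u \<bullet> b (Inl j)) * (L v \<bullet> b (Inr j)) - (L v \<bullet> b (Inl j)) * (L u \<bullet> b (Inr j)))"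
proof -
  note bi = bilinear_ladd[OF bil] bilinear_radd[OF bil] bilinear_lmul[OF bil] bilinear_rmul[OF bil]
    bilinear_lzero[OF bil] bilinear_rzero[OF bil]
  have lsum: "\<eta> (sum g I) b = (\<Sum>i\<in>I. \<eta> (g i) b)" for g :: "nat \<Rightarrow> 'e" and I b
    by (induction I rule: infinite_finite_induct) (auto simp: bi)
  have rsum: "\<eta> b (sum g I) = (\<Sum>i\<in>I. \<eta> b (g i))" for g :: "nat \<Rightarrow> 'e" and I b
    by (induction I rule: infinite_finite_induct) (auto simp: bi)
  have skew: "\<eta> a b = - \<eta> b a" for a b
    using alt[of "a + b"] alt[of a] alt[of b] by (simp add: bilinear_ladd[OF bil] bilinear_radd[OF bil])
  have "\<exists>e f :: nat \<Rightarrow> 'e. \<forall>i\<in>{1..n}. \<forall>j\<in>{1..n}.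
    \<eta> (e i) (f j) = (if i = j then 1 else 0) \<and> \<eta> (e i) (e j) = 0 \<and> \<eta> (f i) (f j) = 0"
    by (rule symplectic_basis_ex[OF bil alt _ dim]) (rule nondeg)
  then obtain e f :: "nat \<Rightarrow> 'e" where "\<forall>i\<in>{1..n}. \<forall>j\<in>{1..n}.
    \<eta> (e i) (f j) = (if i = j then 1 else 0) \<and> \<eta> (e i) (e j) = 0 \<and> \<eta> (f i) (f j) = 0"
    by (elim exE)
  then have ef: "\<eta> (e i) (f j) = (if i = j then 1 else 0)" "\<eta> (e i) (e j) = 0" "\<eta> (f i) (f j) = 0"
    "\<eta> (f i) (e j) = (if i = j then - 1 else 0)" if "i \<in> {1..n}" "j \<in> {1..n}" for i j
    using that skew[of "f i" "e j"] by auto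
  define M where "M x = (\<Sum>j=1..n. (x \<bullet> b (Inl j)) *\<^sub>R e j + (x \<bullet> b (Inr j)) *\<^sub>R f j)" for x
  have linM: "linear M"
    unfolding M_def by (rule linearI)
      (simp_all add: inner_add_left scaleR_add_left sum.distrib scaleR_sum_right scaleR_add_right algebra_simps)
  have MM: "\<eta> (M x) (M y) = (\<Sum>j=1..n. (x \<bullet> b (Inl j)) * (y \<bullet> b (Inr j)) - (y \<bullet> b (Inl j)) * (x \<bullet> b (Inr j)))" for x y
  proof -
    have "\<eta> (M x) (M y) = (\<Sum>i=1..n. \<Sum>j=1..n. if j = i then
        (x \<bullet> b (Inl i)) * (y \<bullet> b (Inr i)) - (x \<bullet> b (Inr i)) * (y \<bullet> b (Inl i)) else 0)"
      unfolding M_def lsum rsum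
      by (intro sum.cong refl) (use ef in \<open>auto simp: bi\<close>)
    then show ?thesis by (simp add: mult.commute)
  qed
  have inB: "b (Inl j) \<in> Basis" "b (Inr j) \<in> Basis" if "j \<in> {1..n}" for j
    using bij_betwE[OF b] that by auto
  have inner_b: "b (Inl i) \<bullet> b (Inl j) = (if i = j then 1 else 0)" "b (Inr i) \<bullet> b (Inr j) = (if i = j then 1 else 0)"
    "b (Inl i) \<bullet> b (Inr j) = 0" "b (Inr i) \<bullet> b (Inl j) = 0" if "i \<in> {1..n}" "j \<in> {1..n}" for i j
    using that inB inj_on_eq_iff[OF bij_betw_imp_inj_on[OF b]] by (simp_all add: inner_Basis InlI InrI)
  have "inj M"
  proof (rule linear_injective_0[THEN iffD2, OF linM], intro allI impI)
    fix x assume "M x = 0"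
    then have z: "(\<Sum>j=1..n. (x \<bullet> b (Inl j)) * (y \<bullet> b (Inr j)) - (y \<bullet> b (Inl j)) * (x \<bullet> b (Inr j))) = 0" for y
      using MM[of x y] by (simp add: bi)
    have l: "x \<bullet> b (Inl i) = 0" if i: "i \<in> {1..n}" for i
    proof -
      have "(\<Sum>j=1..n. (x \<bullet> b (Inl j)) * (b (Inr i) \<bullet> b (Inr j)) - (b (Inr i) \<bullet> b (Inl j)) * (x \<bullet> b (Inr j)))
        = (\<Sum>j=1..n. if j = i then x \<bullet> b (Inl i) else 0)"
        by (intro sum.cong refl) (use i in \<open>auto simp: inner_b\<close>)
      then show ?thesis using z[of "b (Inr i)"] i by simp
    qed
    have r: "x \<bullet> b (Inr i) = 0" if i: "i \<in> {1..n}" for i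
    proof -
      have "(\<Sum>j=1..n. (x \<bullet> b (Inl j)) * (b (Inl i) \<bullet> b (Inr j)) - (b (Inl i) \<bullet> b (Inl j)) * (x \<bullet> b (Inr j)))
        = (\<Sum>j=1..n. if j = i then - (x \<bullet> b (Inr i)) else 0)"
        by (intro sum.cong refl) (use i in \<open>auto simp: inner_b\<close>)
      then show ?thesis using z[of "b (Inl i)"] i by simp
    qed
    have "x \<bullet> c = 0" if c: "c \<in> Basis" for c
    proof -
      obtain i where "i \<in> {1..n} <+> {1..n}" "c = b i" using b c by (auto simp: bij_betw_def)
      then show ?thesis using l r by auto
    qed
    then show "x = 0" by (simp add: euclidean_eq_iff[of x 0])
  qed
  then obtain L where L: "linear L" "\<And>x. L (M x) = x" "\<And>x. M (L x) = x"
    using linear_injective_isomorphism[OF linM] by blast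
  show ?thesis
    by (rule that[OF L(1) linM L(2,3)]) (metis MM L(3))
qed

section \<open>Smooth inverses and the local theorem\<close>

lemma pdiff_on_derivative:
  assumes "open S" and f: "\<And>k. pdiff_on k P S f"
    and F: "\<And>p x. p \<in> P \<Longrightarrow> x \<in> S \<Longrightarrow> (f p has_derivative blinfun_apply (F p x)) (at x)"
  shows "pdiff_on k P S F"
proof -
  obtain G where G: "\<And>p x. p \<in> P \<Longrightarrow> x \<in> S \<Longrightarrow> (f p has_derivative blinfun_apply (G p x)) (at x)"
    and pG: "pdiff_on k P S G" using pdiff_on_SucE_blinfun[OF f] by blast
  have "G p x = F p x" if "p \<in> P" "x \<in> S" for p x
    using has_derivative_unique[OF G[OF that] F[OF that]] by (simp add: blinfun_apply_inject)
  then show ?thesis by (rule pdiff_on_cong[OF assms(1) _ pG])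
qed

lemma continuous_on_param_constD:
  assumes "continuous_on (P \<times> S) (\<lambda>(p, x). g x)" "p \<in> P"
  shows "continuous_on S g"
proof -
  have "continuous_on S (\<lambda>x. (p, x))" by (intro continuous_intros)
  moreover have "Pair p ` S \<subseteq> P \<times> S" using assms(2) by auto
  ultimately show ?thesis using continuous_on_compose2[OF assms(1), of S "Pair p"] by simp
qed

text \<open>The inverse function theorem gives differentiability of \<open>g\<close> with derivative
  the inverse of \<open>F (g y)\<close>. Smoothness follows by bootstrapping: if \<open>g\<close> is
  of class \<open>k\<close>, so are the composition and its inverse operator, hence \<open>g\<close>
  is of class \<open>Suc k\<close>.\<close>

lemma smooth_local_inverse:
  fixes f :: "'e::euclidean_space \<Rightarrow> 'e"
  assumes S: "open S" "z0 \<in> S" and pf: "\<And>k. pdiff_on k {0::real} S (\<lambda>_. f)"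
    and D: "(f has_derivative D) (at z0)" and inj: "\<And>a. D a = 0 \<Longrightarrow> a = 0"
  obtains U V g where "open U" "z0 \<in> U" "U \<subseteq> S" "open V" "homeomorphism U V f g"
    "\<And>k. pdiff_on k {0::real} V (\<lambda>_. g)"
proof -
  obtain F' where F': "\<And>p z. p \<in> {0::real} \<Longrightarrow> z \<in> S \<Longrightarrow> (f has_derivative blinfun_apply (F' p z)) (at z)"
    using pdiff_on_SucE_blinfun[OF pf] by metis
  define F where "F = F' 0"
  have F: "(f has_derivative blinfun_apply (F z)) (at z)" if "z \<in> S" for z
    using F'[of 0] that by (simp add: F_def)
  have pF: "pdiff_on k {0::real} S (\<lambda>_. F)" for k
    by (rule pdiff_on_derivative[OF S(1) pf]) (rule F)
  have cF: "continuous_on S F"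
    using pdiff_on_continuous[OF pF] by (rule continuous_on_param_constD) simp
  have "F z0 a = 0 \<Longrightarrow> a = 0" for a
    using inj has_derivative_unique[OF D F[OF S(2)]] by simp
  then obtain B0 where B0: "B0 o\<^sub>L F z0 = id_blinfun" using blinfun_inverse_ex by metis
  obtain U V g g' where U: "open U" "U \<subseteq> S" "z0 \<in> U" "open V" "f z0 \<in> V" "homeomorphism U V f g"
    and g': "\<And>y. y \<in> V \<Longrightarrow> (g has_derivative (g' y)) (at y)"
      "\<And>y. y \<in> V \<Longrightarrow> g' y = inv (blinfun_apply (F (g y)))"
      "\<And>y. y \<in> V \<Longrightarrow> bij (blinfun_apply (F (g y)))"
    by (rule inverse_function_theorem[of S f F z0 B0, OF S(1) F cF S(2) B0]) (assumption, rule that)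
  have gS: "g y \<in> S" if "y \<in> V" for y
    using U(2,6) that by (auto simp: homeomorphism_def)
  define R where "R y = Blinfun (g' y)" for y
  have R: "blinfun_apply (R y) = g' y" if "y \<in> V" for y
    unfolding R_def by (rule bounded_linear_Blinfun_apply[OF has_derivative_bounded_linear[OF g'(1)[OF that]]])
  have inv: "F (g y) o\<^sub>L R y = id_blinfun" "R y o\<^sub>L F (g y) = id_blinfun" if "y \<in> V" for y
    using g'(2,3)[OF that] by (auto intro!: blinfun_eqI simp: R[OF that] bij_is_surj surj_f_inv_f bij_is_inj inv_f_f)
  have cg: "continuous_on ({0::real} \<times> V) (\<lambda>(p, y). g y)"
    using U(6) by (intro continuous_on_param_const) (auto simp: homeomorphism_def)
  have "pdiff_on k {0::real} V (\<lambda>_. g)" for k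
  proof (induction k)
    case (Suc k)
    have "pdiff_on k {0::real} V (\<lambda>_ y. F (g y))"
      by (rule pdiff_on_compose[OF pF Suc gS U(4)])
    then have pR: "pdiff_on k {0::real} V (\<lambda>_. R)"
      by (rule pdiff_on_blinfun_inverse[OF U(4) _ inv])
    show ?case
      by (rule pdiff_on_SucI[where f'="\<lambda>_ y. blinfun_apply (R y)", OF cg])
        (use R g'(1) pdiff_on_linear[OF blinfun.bounded_linear_left pR] in auto)
  qed (use cg in simp)
  with U show ?thesis using that by blast
qed

lemma smooth_on_iff_pdiff_on: "open S \<Longrightarrow> smooth_on S f \<longleftrightarrow> (\<forall>k. pdiff_on k {0::real} S (\<lambda>_. f))"
  by (simp add: smooth_on_def C_diff_on_iff_pdiff_on)

text \<open>The map is the time-one flow followed by \<open>L\<close>: the flow carries \<eta> to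
  the constant form at \<open>z0\<close>, and \<open>L\<close> carries that to the standard
  form.\<close>

theorem darboux_local:
  fixes \<eta> :: "'e::euclidean_space \<Rightarrow> 'e \<Rightarrow> 'e \<Rightarrow> real" and b :: "nat + nat \<Rightarrow> 'e"
  assumes U: "open U" "z0 \<in> U"
    and bil: "\<And>z. z \<in> U \<Longrightarrow> bilinear (\<eta> z)" and alt: "\<And>z a. z \<in> U \<Longrightarrow> \<eta> z a a = 0"
    and sm: "\<And>a b. smooth_on U (\<lambda>z. \<eta> z a b)"
    and closed: "\<And>z a b e. z \<in> U \<Longrightarrow> ext_deriv \<eta> z a b e = 0"
    and nondeg: "\<And>a. (\<And>b. \<eta> z0 a b = 0) \<Longrightarrow> a = 0"
    and dim: "DIM('e) = 2 * n" and b: "bij_betw b ({1..n} <+> {1..n}) Basis"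
  obtains V W \<Psi> \<Theta> where "open V" "z0 \<in> V" "V \<subseteq> U" "open W" "homeomorphism V W \<Psi> \<Theta>"
    "smooth_on V \<Psi>" "smooth_on W \<Theta>"
    "\<And>z D u v. z \<in> V \<Longrightarrow> (\<Psi> has_derivative D) (at z) \<Longrightarrow>
      \<eta> z u v = (\<Sum>j=1..n. (D u \<bullet> b (Inl j)) * (D v \<bullet> b (Inr j)) - (D v \<bullet> b (Inl j)) * (D u \<bullet> b (Inr j)))"
proof -
  define \<Omega> where "\<Omega> z = Blinfun (\<lambda>a. \<Sum>c\<in>Basis. \<eta> z a c *\<^sub>R c)" for z
  have \<Omega>a: "\<Omega> z a = (\<Sum>c\<in>Basis. \<eta> z a c *\<^sub>R c)" if "z \<in> U" for z a
  proof -
    have "linear (\<lambda>a. \<Sum>c\<in>Basis. \<eta> z a c *\<^sub>R c)"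
      by (rule linearI) (simp_all add: bilinear_ladd[OF bil[OF that]] bilinear_lmul[OF bil[OF that]]
          scaleR_add_left sum.distrib scaleR_sum_right)
    then show ?thesis
      unfolding \<Omega>_def by (subst bounded_linear_Blinfun_apply) (simp_all add: linear_conv_bounded_linear)
  qed
  have \<Omega>: "\<Omega> z a \<bullet> c = \<eta> z a c" if "z \<in> U" for z a c
  proof -
    have lin: "linear (\<eta> z a)" using bil[OF that] by (simp add: bilinear_def)
    have "\<Omega> z a \<bullet> c = (\<Sum>d\<in>Basis. (c \<bullet> d) *\<^sub>R \<eta> z a d)"
      unfolding \<Omega>a[OF that] inner_sum_left by (simp add: inner_commute mult.commute)
    also have "\<dots> = \<eta> z a (\<Sum>d\<in>Basis. (c \<bullet> d) *\<^sub>R d)"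
      by (simp add: linear_sum[OF lin] linear_cmul[OF lin])
    finally show ?thesis by (simp add: euclidean_representation)
  qed
  have p\<Omega>: "pdiff_on k {0::real} U (\<lambda>_. \<Omega>)" for k
  proof (rule pdiff_on_blinfun)
    fix a :: 'e
    have "pdiff_on k {0::real} U (\<lambda>_ z. \<Sum>c\<in>Basis. \<eta> z a c *\<^sub>R c)"
      using sm by (intro pdiff_on_sum pdiff_on_linear[OF bounded_linear_scaleR_left])
        (simp add: smooth_on_iff_pdiff_on[OF U(1)])
    then show "pdiff_on k {0::real} U (\<lambda>_ z. \<Omega> z a)"
      by (rule pdiff_on_cong[OF U(1), rotated]) (simp add: \<Omega>a)
  qed
  obtain D' where "\<And>p z. p \<in> {0::real} \<Longrightarrow> z \<in> U \<Longrightarrow> (\<Omega> has_derivative blinfun_apply (D' p z)) (at z)"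
    using pdiff_on_SucE_blinfun[OF p\<Omega>] by metis
  then have d\<Omega>: "(\<Omega> has_derivative blinfun_apply (D' 0 z)) (at z)" if "z \<in> U" for z using that by simp
  define D\<Omega> where "D\<Omega> = D' 0"
  note d\<Omega> = d\<Omega>[folded D\<Omega>_def]
  have "pdiff_on 0 {0::real} U (\<lambda>_. D\<Omega>)" by (rule pdiff_on_derivative[OF U(1) p\<Omega>]) (rule d\<Omega>)
  then have cD\<Omega>: "continuous_on U D\<Omega>" using continuous_on_param_constD[OF pdiff_on_continuous] by blast
  have skew: "\<Omega> z a \<bullet> c = - (\<Omega> z c \<bullet> a)" if "z \<in> U" for z a c
    using alt[OF that, of "a + c"] alt[OF that, of a] alt[OF that, of c]
    by (simp add: \<Omega>[OF that] bilinear_ladd[OF bil[OF that]] bilinear_radd[OF bil[OF that]])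
  have d\<eta>: "frechet_derivative (\<lambda>z. \<eta> z a c) (at z) w = D\<Omega> z w a \<bullet> c" if z: "z \<in> U" for z a c w
  proof -
    have "((\<lambda>z. \<Omega> z a \<bullet> c) has_derivative (\<lambda>w. D\<Omega> z w a \<bullet> c)) (at z)"
      by (rule bounded_linear.has_derivative[OF bounded_linear_compose[OF bounded_linear_inner_left blinfun.bounded_linear_left] d\<Omega>[OF z]])
    then have "((\<lambda>z. \<eta> z a c) has_derivative (\<lambda>w. D\<Omega> z w a \<bullet> c)) (at z)"
      by (rule has_derivative_transform_within_open[OF _ U(1) z]) (simp add: \<Omega>)
    from frechet_derivative_at[OF this] show ?thesis by metis
  qed
  have cl: "D\<Omega> z a c \<bullet> e - D\<Omega> z c a \<bullet> e + D\<Omega> z e a \<bullet> c = 0" if "z \<in> U" for z a c e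
    using closed[OF that, of a c e] by (simp add: ext_deriv_def d\<eta>[OF that])
  have nd: "a = 0" if "\<Omega> z0 a = 0" for a
    using nondeg \<Omega>[OF U(2), of a] that by simp
  obtain r where r: "r > 0" "ball z0 r \<subseteq> U" using U by (rule openE)
  let ?S = "ball z0 r"
  have S: "open ?S" "convex ?S" "z0 \<in> ?S" using r by auto
  have inU: "z \<in> U" if "z \<in> ?S" for z using that r(2) by blast
  have p\<Omega>S: "pdiff_on k {0::real} ?S (\<lambda>_. \<Omega>)" for k
    by (rule pdiff_on_reparam[OF p\<Omega>, where h="\<lambda>x. x"]) (use r in auto)
  obtain C where pC: "\<And>k P. pdiff_on k P ?S (\<lambda>_::real. C)" and C0: "C z0 = 0"
    and C: "\<And>z D u v. z \<in> ?S \<Longrightarrow> ((\<lambda>z. blinfun_apply (C z) (z - z0)) has_derivative D) (at z) \<Longrightarrow>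
      D u \<bullet> v - D v \<bullet> u = (\<Omega> z u - \<Omega> z0 u) \<bullet> v"
    by (rule poincare_two_form[OF S p\<Omega>S d\<Omega>[OF inU] continuous_on_subset[OF cD\<Omega> r(2)] skew[OF inU] cl[OF inU]])
      (assumption | rule that)+
  obtain W0 X where W0: "open W0" "z0 \<in> W0" "W0 \<subseteq> ?S" and pX: "\<And>k. pdiff_on k {0..1} W0 X"
    and X: "\<And>t z. t \<in> {0..1} \<Longrightarrow> z \<in> W0 \<Longrightarrow> (\<Omega> z + t *\<^sub>R (\<Omega> z0 - \<Omega> z)) (X t z) = blinfun_apply (C z) (z - z0)"
    and lip: "\<And>t w w'. t \<in> {0..1} \<Longrightarrow> w \<in> W0 \<Longrightarrow> w' \<in> W0 \<Longrightarrow> norm (X t w - X t w') \<le> norm (w - w') / 2"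
    by (rule moser_field[OF S(1,3) p\<Omega>S nd pC C0]) (assumption | rule that)+
  have WU: "z \<in> U" "z \<in> ?S" if "z \<in> W0" for z using that W0(3) r(2) by auto
  have X0: "X t z0 = 0" if "t \<in> {0..1}" for t
    using X[OF that W0(2)] nd by simp
  obtain Z \<phi> where Z: "open Z" "z0 \<in> Z" "Z \<subseteq> W0" and p\<phi>: "\<And>k. pdiff_on k {0::real} Z (\<lambda>_. \<phi>)"
    and pull: "\<And>z D u v. z \<in> Z \<Longrightarrow> (\<phi> has_derivative D) (at z) \<Longrightarrow> \<Omega> z0 (D u) \<bullet> D v = \<Omega> z u \<bullet> v"
    by (rule moser_flow[OF W0(1,2) d\<Omega>[OF WU(1)] skew[OF WU(1)] cl[OF WU(1)] C[OF WU(2)] pX X lip X0])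
      (assumption | rule that)+
  obtain D0 where D0: "(\<phi> has_derivative D0) (at z0)"
    using pdiff_on_SucE[OF p\<phi>] Z(2) by (metis singletonI)
  \<comment> \<open>A vector killed by \<open>D0\<close> pairs to 0 with everything under the
    pulled-back form, which at \<open>z0\<close> is the nondegenerate \<eta> itself.\<close>
  have D0_inj: "a = 0" if "D0 a = 0" for a
    using pull[OF Z(2) D0, of a] that nondeg[of a] by (simp add: \<Omega>[OF U(2)] blinfun.zero_right)
  obtain V V' g where V: "open V" "z0 \<in> V" "V \<subseteq> Z" "open V'" and hom: "homeomorphism V V' \<phi> g"
    and pg: "\<And>k. pdiff_on k {0::real} V' (\<lambda>_. g)"
    by (rule smooth_local_inverse[OF Z(1,2) p\<phi> D0 D0_inj]) (assumption | rule that)+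
  obtain L M :: "'e \<Rightarrow> 'e" where L: "linear L" and M: "linear M" and Linv: "\<And>x. L (M x) = x" and Minv: "\<And>x. M (L x) = x"
    and \<eta>L: "\<And>u v. \<eta> z0 u v = (\<Sum>j=1..n. (L u \<bullet> b (Inl j)) * (L v \<bullet> b (Inr j)) - (L v \<bullet> b (Inl j)) * (L u \<bullet> b (Inr j)))"
    by (rule symplectic_normal_form[OF bil[OF U(2)] alt[OF U(2)] nondeg dim b]) (assumption | rule that)+
  have bl: "bounded_linear L" "bounded_linear M" using L M by (simp_all add: linear_conv_bounded_linear)
  have VU: "V \<subseteq> U" using V Z W0 r by blast
  define W where "W = M -` V'"
  have W: "open W" unfolding W_def
    by (rule open_vimage[OF V(4) linear_continuous_on[OF bl(2)]])
  have h: "\<phi> ` V = V'" "g ` V' = V" "\<And>x. x \<in> V \<Longrightarrow> g (\<phi> x) = x" "\<And>y. y \<in> V' \<Longrightarrow> \<phi> (g y) = y"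
    "continuous_on V \<phi>" "continuous_on V' g"
    using hom by (auto simp: homeomorphism_def)
  show ?thesis
  proof (rule that[of V W "\<lambda>x. L (\<phi> x)" "\<lambda>y. g (M y)"])
    have 1: "(\<lambda>x. L (\<phi> x)) ` V = W"
    proof (intro equalityI subsetI)
      fix y assume "y \<in> W"
      then have "M y \<in> V'" by (simp add: W_def)
      then have "g (M y) \<in> V" "L (\<phi> (g (M y))) = y" using h Linv by auto
      then show "y \<in> (\<lambda>x. L (\<phi> x)) ` V" by force
    qed (use h Minv in \<open>auto simp: W_def\<close>)
    have 2: "(\<lambda>y. g (M y)) ` W = V" unfolding 1[symmetric] image_image using h(3) Minv by force
    show "homeomorphism V W (\<lambda>x. L (\<phi> x)) (\<lambda>y. g (M y))"
      unfolding homeomorphism_def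
    proof (intro conjI ballI)
      show "continuous_on V (\<lambda>x. L (\<phi> x))" by (rule bounded_linear.continuous_on[OF bl(1) h(5)])
      show "continuous_on W (\<lambda>y. g (M y))"
        by (rule continuous_on_compose2[OF h(6) linear_continuous_on[OF bl(2)]]) (auto simp: W_def)
    qed (use 1 2 h Linv Minv in \<open>auto simp: W_def\<close>)
    have "pdiff_on k {0::real} V (\<lambda>_. \<phi>)" for k
      by (rule pdiff_on_reparam[OF p\<phi>, where h="\<lambda>x. x"]) (use V in auto)
    then show "smooth_on V (\<lambda>x. L (\<phi> x))"
      unfolding smooth_on_iff_pdiff_on[OF V(1)] by (intro allI pdiff_on_linear[OF bl(1)])
    show "smooth_on W (\<lambda>y. g (M y))"
      unfolding smooth_on_iff_pdiff_on[OF W]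
      by (intro allI pdiff_on_compose[OF pg pdiff_on_linear[OF bl(2) pdiff_on_id] _ W]) (simp add: W_def)
    fix z D u v assume z: "z \<in> V" and D: "((\<lambda>x. L (\<phi> x)) has_derivative D) (at z)"
    have zZ: "z \<in> Z" using z V(3) by blast
    \<comment> \<open>The given derivative belongs to the composite with \<open>L\<close>; applying
      \<open>M\<close> recovers that of \<open>\<phi>\<close>, to which \<open>pull\<close>
      refers.\<close>
    have "((\<lambda>x. M (L (\<phi> x))) has_derivative (\<lambda>w. M (D w))) (at z)"
      by (rule bounded_linear.has_derivative[OF bl(2) D])
    then have "(\<phi> has_derivative (\<lambda>w. M (D w))) (at z)" by (simp add: Minv)
    from pull[OF zZ this, of u v]
    have "\<eta> z u v = \<eta> z0 (M (D u)) (M (D v))"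
      using \<Omega>[OF U(2)] \<Omega>[of z] z VU by auto
    then show "\<eta> z u v = (\<Sum>j=1..n. (D u \<bullet> b (Inl j)) * (D v \<bullet> b (Inr j)) - (D v \<bullet> b (Inl j)) * (D u \<bullet> b (Inr j)))"
      by (simp add: \<eta>L Linv)
  qed (use V VU W in auto)
qed

section \<open>Charts and tangent vectors\<close>

lemma smooth_on_subset:
  fixes f :: "'a::euclidean_space \<Rightarrow> 'b::real_normed_vector"
  assumes "smooth_on S f" "S' \<subseteq> S" "open S" "open S'"
  shows "smooth_on S' f"
  using assms(1) pdiff_on_reparam[of _ "{0}" S "\<lambda>_. f" "{0}" "\<lambda>x. x" S'] assms(2)
  unfolding smooth_on_iff_pdiff_on[OF assms(3)] smooth_on_iff_pdiff_on[OF assms(4)] by auto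

lemma smooth_on_cong:
  fixes f :: "'a::euclidean_space \<Rightarrow> 'b::real_normed_vector"
  assumes "smooth_on S f" "open S" "\<And>x. x \<in> S \<Longrightarrow> f x = g x"
  shows "smooth_on S g"
  using assms(1) pdiff_on_cong[OF assms(2), of "{0}" "\<lambda>_. f" "\<lambda>_. g"] assms(3)
  unfolding smooth_on_iff_pdiff_on[OF assms(2)] by auto

lemma smooth_on_compose:
  fixes f :: "'a::euclidean_space \<Rightarrow> 'b::euclidean_space"
  assumes "smooth_on T g" "smooth_on S f" "open S" "open T" "f ` S \<subseteq> T"
  shows "smooth_on S (\<lambda>x. g (f x))"
  unfolding smooth_on_iff_pdiff_on[OF assms(3)]
proof
  fix k
  have g: "pdiff_on k {0::real} T (\<lambda>_. g)" and f: "pdiff_on k {0::real} S (\<lambda>_. f)"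
    using assms(1,2) by (simp_all add: smooth_on_iff_pdiff_on[OF assms(3)] smooth_on_iff_pdiff_on[OF assms(4)])
  show "pdiff_on k {0::real} S (\<lambda>_ x. g (f x))"
    by (rule pdiff_on_compose[OF g f _ assms(3)]) (use assms(5) in auto)
qed

lemma smooth_on_linear:
  fixes f :: "'a::euclidean_space \<Rightarrow> 'b::real_normed_vector"
  assumes "bounded_linear L" "smooth_on S f" "open S"
  shows "smooth_on S (\<lambda>x. L (f x))"
  using assms(2) pdiff_on_linear[OF assms(1)] unfolding smooth_on_iff_pdiff_on[OF assms(3)] by blast

lemma smooth_on_differentiable: "smooth_on S f \<Longrightarrow> x \<in> S \<Longrightarrow> f differentiable (at x)"
  unfolding smooth_on_def by (metis C_diff_on.simps(2))

lemma smooth_on_has_derivative: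
  "smooth_on S f \<Longrightarrow> x \<in> S \<Longrightarrow> (f has_derivative frechet_derivative f (at x)) (at x)"
  by (simp add: smooth_on_differentiable frechet_derivative_works[symmetric])

context smooth_manifold
begin

lemma chart_dom_open: "c \<in> A \<Longrightarrow> openin T (chart_dom c)"
  using charts by (simp add: is_chart_def)

lemma chart_img_open: "c \<in> A \<Longrightarrow> open (chart_img c)"
  using charts by (simp add: is_chart_def)

lemma chart_homeomorphic:
  "c \<in> A \<Longrightarrow> homeomorphic_map (subtopology T (chart_dom c)) (top_of_set (chart_img c)) (chart_map c)"
  using charts by (simp add: is_chart_def)

lemma topspace_chart: "c \<in> A \<Longrightarrow> topspace (subtopology T (chart_dom c)) = chart_dom c"
  using openin_subset[OF chart_dom_open, of c] by (simp add: Int_absorb1)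

lemma chart_inj: "c \<in> A \<Longrightarrow> inj_on (chart_map c) (chart_dom c)"
  using homeomorphic_imp_injective_map[OF chart_homeomorphic] topspace_chart by metis

lemma chart_inv_chart_map [simp]: "c \<in> A \<Longrightarrow> p \<in> chart_dom c \<Longrightarrow> chart_inv c (chart_map c p) = p"
  by (simp add: chart_inv_def inv_into_f_f[OF chart_inj])

lemma chart_map_in_img: "p \<in> chart_dom c \<Longrightarrow> chart_map c p \<in> chart_img c"
  by (simp add: chart_img_def)

lemma chart_inv_in_dom: "z \<in> chart_img c \<Longrightarrow> chart_inv c z \<in> chart_dom c"
  by (simp add: chart_inv_def chart_img_def inv_into_into)

lemma chart_map_chart_inv: "z \<in> chart_img c \<Longrightarrow> chart_map c (chart_inv c z) = z"
  by (simp add: chart_inv_def chart_img_def f_inv_into_f)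

lemma open_chart_image:
  assumes "c \<in> A" "openin T U" "U \<subseteq> chart_dom c"
  shows "open (chart_map c ` U)"
proof -
  have "openin (subtopology T (chart_dom c)) U"
    using assms(2,3) by (metis openin_subset_topspace_eq openin_subtopology subset_openin_subtopology)
  then have "openin (top_of_set (chart_img c)) (chart_map c ` U)"
    using homeomorphic_imp_open_map[OF chart_homeomorphic[OF assms(1)]] by (simp add: open_map_def)
  then show ?thesis using chart_img_open[OF assms(1)] openin_open_trans by blast
qed

lemma openin_chart_preimage:
  assumes "c \<in> A" "open V"
  shows "openin T {p \<in> chart_dom c. chart_map c p \<in> V}"
proof -
  have "openin (top_of_set (chart_img c)) (chart_img c \<inter> V)" using assms(2) by (rule openin_open_Int)
  then have "openin (subtopology T (chart_dom c)) {p \<in> chart_dom c. chart_map c p \<in> chart_img c \<inter> V}"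
    using openin_continuous_map_preimage[OF homeomorphic_imp_continuous_map[OF chart_homeomorphic[OF assms(1)]]]
    unfolding topspace_chart[OF assms(1)] by blast
  moreover have "{p \<in> chart_dom c. chart_map c p \<in> chart_img c \<inter> V} = {p \<in> chart_dom c. chart_map c p \<in> V}"
    by (auto simp: chart_img_def)
  ultimately show ?thesis using chart_dom_open[OF assms(1)] by (metis openin_trans_full)
qed

lemma open_chart_overlap: "c \<in> A \<Longrightarrow> d \<in> A \<Longrightarrow> open (chart_map c ` (chart_dom c \<inter> chart_dom d))"
  by (intro open_chart_image openin_Int chart_dom_open) auto

lemma smooth_transition: "c \<in> A \<Longrightarrow> d \<in> A \<Longrightarrow> smooth_on (chart_map c ` (chart_dom c \<inter> chart_dom d)) (transition c d)"
  using compatible by (simp add: compatible_charts_def)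

lemma transition_chart_map [simp]:
  "c \<in> A \<Longrightarrow> p \<in> chart_dom c \<Longrightarrow> transition c d (chart_map c p) = chart_map d p"
  by (simp add: transition_def)

lemma transition_has_derivative:
  assumes "c \<in> A" "d \<in> A" "p \<in> chart_dom c" "p \<in> chart_dom d"
  shows "(transition c d has_derivative frechet_derivative (transition c d) (at (chart_map c p))) (at (chart_map c p))"
  by (rule smooth_on_has_derivative[OF smooth_transition[OF assms(1,2)]]) (use assms in auto)

text \<open>The cocycle rule: the chain rule on the overlap of the three charts. It makes
  \<open>tangent_vector\<close> a compatible family.\<close>

lemma frechet_derivative_transition_compose:
  assumes "c \<in> A" "d \<in> A" "e \<in> A" "p \<in> chart_dom c" "p \<in> chart_dom d" "p \<in> chart_dom e"
  shows "frechet_derivative (transition c e) (at (chart_map c p)) a =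
    frechet_derivative (transition d e) (at (chart_map d p)) (frechet_derivative (transition c d) (at (chart_map c p)) a)"
proof -
  let ?S = "chart_map c ` (chart_dom c \<inter> chart_dom d \<inter> chart_dom e)"
  have S: "open ?S" by (intro open_chart_image openin_Int chart_dom_open assms) auto
  have "(transition d e has_derivative frechet_derivative (transition d e) (at (chart_map d p)))
      (at (transition c d (chart_map c p)))"
    using transition_has_derivative[of d e p] assms by simp
  from has_derivative_compose[OF transition_has_derivative[of c d p] this]
  have "((\<lambda>z. transition d e (transition c d z)) has_derivative
     (\<lambda>a. frechet_derivative (transition d e) (at (chart_map d p)) (frechet_derivative (transition c d) (at (chart_map c p)) a)))
     (at (chart_map c p))" using assms by simp
  then have "(transition c e has_derivative
     (\<lambda>a. frechet_derivative (transition d e) (at (chart_map d p)) (frechet_derivative (transition c d) (at (chart_map c p)) a)))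
     (at (chart_map c p))"
    by (rule has_derivative_transform_within_open[OF _ S]) (use assms in auto)
  from has_derivative_unique[OF transition_has_derivative[of c e p] this] show ?thesis
    using assms by simp
qed

lemma frechet_derivative_transition_self:
  assumes "c \<in> A" "p \<in> chart_dom c"
  shows "frechet_derivative (transition c c) (at (chart_map c p)) a = a"
proof -
  have "(transition c c has_derivative (\<lambda>a. a)) (at (chart_map c p))"
    by (rule has_derivative_transform_within_open[OF has_derivative_ident chart_img_open[OF assms(1)]])
      (use assms in \<open>auto simp: transition_def chart_map_chart_inv chart_map_in_img\<close>)
  from has_derivative_unique[OF transition_has_derivative[of c c p] this] show ?thesis
    using assms by simp
qed

lemma tangent_vector_in_tangent_space:
  assumes "c \<in> charts_at A p" shows "tangent_vector A c p a \<in> tangent_space A p"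
proof -
  have "tangent_vector A c p a e = frechet_derivative (transition d e) (at (chart_map d p)) (tangent_vector A c p a d)"
    if de: "d \<in> charts_at A p" "e \<in> charts_at A p" for d e
  proof -
    have "c \<in> A" "d \<in> A" "e \<in> A" "p \<in> chart_dom c" "p \<in> chart_dom d" "p \<in> chart_dom e"
      using assms de by (auto simp: charts_at_def)
    from frechet_derivative_transition_compose[OF this] show ?thesis
      using de by (simp add: tangent_vector_def)
  qed
  then show ?thesis unfolding tangent_space_def mem_Collect_eq
    by (intro conjI ballI allI impI) (assumption | simp add: tangent_vector_def)+
qed

lemma tangent_vector_same:
  assumes "c \<in> charts_at A p" shows "tangent_vector A c p a c = a"
  using assms frechet_derivative_transition_self by (auto simp: tangent_vector_def charts_at_def)

text \<open>With \<open>tangent_vector_same\<close> this identifies the tangent space with the model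
  space through evaluation at \<open>c\<close>.\<close>

lemma tangent_vector_eq:
  assumes "c \<in> charts_at A p" "u \<in> tangent_space A p" shows "tangent_vector A c p (u c) = u"
proof
  fix d
  have "u d = frechet_derivative (transition c d) (at (chart_map c p)) (u c)" if "d \<in> charts_at A p"
    using assms that unfolding tangent_space_def by blast
  moreover have "u d = 0" if "d \<notin> charts_at A p" using assms(2) that unfolding tangent_space_def by blast
  ultimately show "tangent_vector A c p (u c) d = u d" by (simp add: tangent_vector_def)
qed

lemma tangent_vector_linear:
  assumes "c \<in> charts_at A p"
  shows "tangent_vector A c p (r *\<^sub>R a + s *\<^sub>R b) = (\<lambda>d. r *\<^sub>R tangent_vector A c p a d + s *\<^sub>R tangent_vector A c p b d)"
proof
  fix d
  show "tangent_vector A c p (r *\<^sub>R a + s *\<^sub>R b) d = r *\<^sub>R tangent_vector A c p a d + s *\<^sub>R tangent_vector A c p b d"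
  proof (cases "d \<in> charts_at A p")
    case True
    then have "linear (frechet_derivative (transition c d) (at (chart_map c p)))"
      using assms by (intro has_derivative_linear[OF transition_has_derivative]) (auto simp: charts_at_def)
    then show ?thesis using True by (simp add: tangent_vector_def linear_add linear_cmul)
  qed (simp add: tangent_vector_def)
qed

text \<open>\<open>differential\<close> uses an unspecified chart \<open>e\<close>. The chain rule
  through the transition from \<open>e\<close> to \<open>c\<close>, with the compatibility of the
  components of \<open>v\<close>, allows computing in any chosen chart; a representative
  \<open>h\<close> of \<open>f\<close> near the point is enough.\<close>

lemma differential_chart:
  assumes c: "c \<in> charts_at A p" and S: "open S" "chart_map c p \<in> S" "S \<subseteq> chart_img c"
    and f: "(h has_derivative D) (at (chart_map c p))"
    and fh: "\<And>q. q \<in> chart_dom c \<Longrightarrow> chart_map c q \<in> S \<Longrightarrow> f q = h (chart_map c q)"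
    and v: "v \<in> tangent_space A p"
  shows "differential A f p v = D (v c)"
proof -
  define e where "e = (SOME c. c \<in> charts_at A p)"
  have e: "e \<in> charts_at A p" using c unfolding e_def by (rule someI)
  have m: "c \<in> A" "e \<in> A" "p \<in> chart_dom c" "p \<in> chart_dom e" using c e by (auto simp: charts_at_def)
  let ?U = "chart_dom e \<inter> {q \<in> chart_dom c. chart_map c q \<in> S}"
  have U: "open (chart_map e ` ?U)"
    by (intro open_chart_image openin_Int chart_dom_open openin_chart_preimage m S) auto
  have "(h has_derivative D) (at (transition e c (chart_map e p)))" using f m by simp
  from has_derivative_compose[OF transition_has_derivative[OF m(2,1,4,3)] this]
  have "((\<lambda>z. h (transition e c z)) has_derivative
    (\<lambda>a. D (frechet_derivative (transition e c) (at (chart_map e p)) a))) (at (chart_map e p))" .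
  then have "((f \<circ> chart_inv e) has_derivative
    (\<lambda>a. D (frechet_derivative (transition e c) (at (chart_map e p)) a))) (at (chart_map e p))"
    by (rule has_derivative_transform_within_open[OF _ U]) (use m S fh in auto)
  note fe = frechet_derivative_at[OF this, symmetric]
  have "differential A f p v = D (frechet_derivative (transition e c) (at (chart_map e p)) (v e))"
    unfolding differential_def Let_def e_def[symmetric] fe ..
  also have "frechet_derivative (transition e c) (at (chart_map e p)) (v e) = v c"
    by (rule sym) (use v c e in \<open>unfold tangent_space_def, blast\<close>)
  finally show ?thesis .
qed

text \<open>By maximality it suffices to check compatibility with each chart \<open>e\<close>. The
  transitions are those of \<open>c\<close> composed with \<open>\<Theta>\<close> on one side and
  with \<open>\<Psi>\<close> on the other, which is why both maps must be smooth.\<close>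

lemma chart_compose:
  assumes c: "c \<in> A" and V0: "open V0" "V0 \<subseteq> chart_img c" and W: "open W"
    and hom: "homeomorphism V0 W \<Psi> \<Theta>" and sm: "smooth_on V0 \<Psi>" "smooth_on W \<Theta>"
  shows "({p \<in> chart_dom c. chart_map c p \<in> V0}, \<lambda>p. \<Psi> (chart_map c p)) \<in> A"
proof -
  define V where "V = {p \<in> chart_dom c. chart_map c p \<in> V0}"
  define d where "d = (V, \<lambda>p. \<Psi> (chart_map c p))"
  have V: "openin T V" "V \<subseteq> chart_dom c" unfolding V_def using openin_chart_preimage[OF c V0(1)] by auto
  have cV: "chart_map c ` V = V0" using V0(2) by (auto simp: V_def chart_img_def)
  have h: "\<Psi> ` V0 = W" "\<Theta> ` W = V0" "\<And>x. x \<in> V0 \<Longrightarrow> \<Theta> (\<Psi> x) = x" "\<And>y. y \<in> W \<Longrightarrow> \<Psi> (\<Theta> y) = y"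
    "continuous_on V0 \<Psi>" "continuous_on W \<Theta>"
    using hom by (auto simp: homeomorphism_def)
  have img: "chart_img d = W"
    unfolding chart_img_def d_def using h(1) cV by (metis (no_types, lifting) fst_conv image_cong image_image snd_conv)
  have dom: "chart_dom d = V" and map: "chart_map d = (\<lambda>p. \<Psi> (chart_map c p))" by (simp_all add: d_def)
  have "chart_dom c \<inter> V = V" using V(2) by auto
  then have 1: "homeomorphic_map (subtopology T V) (top_of_set V0) (chart_map c)"
    using homeomorphic_map_subtopologies[OF chart_homeomorphic[OF c], of V V0] cV V(2) V0(2)
      openin_subset[OF V(1)]
    by (simp add: subtopology_subtopology topspace_chart[OF c] chart_img_def image_mono Int_absorb1 Int_absorb2)
  have "homeomorphic_maps (top_of_set V0) (top_of_set W) \<Psi> \<Theta>"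
    using h by (auto simp: homeomorphic_maps_def)
  then have 2: "homeomorphic_map (top_of_set V0) (top_of_set W) \<Psi>" by (rule homeomorphic_maps_imp_map)
  have chart: "is_chart T d"
    using homeomorphic_map_compose[OF 1 2] V(1) W by (simp add: is_chart_def img dom map o_def)
  have inv: "chart_inv d (\<Psi> (chart_map c q)) = q" if "q \<in> V" for q
  proof -
    have "inj_on (chart_map d) V"
      using chart_inj[OF c] V(2) h(3) by (auto simp: map inj_on_def V_def) (metis)
    then show ?thesis using that inv_into_f_f[of "chart_map d" V q] by (simp add: chart_inv_def dom map)
  qed
  have "d \<in> A"
  proof (rule maximal[OF chart])
    fix e assume e: "e \<in> A"
    have oc: "open (chart_map c ` (V \<inter> chart_dom e))" and oe: "open (chart_map e ` (V \<inter> chart_dom e))"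
      by (intro open_chart_image openin_Int chart_dom_open V c e; use V in auto)+
    \<comment> \<open>Membership of the new chart in the atlas is still to be shown, so openness is
      obtained from continuity of \<open>\<Theta>\<close> instead of
      \<open>open_chart_image\<close>.\<close>
    have od: "open (chart_map d ` (V \<inter> chart_dom e))"
    proof -
      have "chart_map d ` (V \<inter> chart_dom e) = {y \<in> W. \<Theta> y \<in> chart_map c ` (V \<inter> chart_dom e)}"
        using h cV by (auto simp: map V_def image_iff)
      also have "\<dots> = W \<inter> \<Theta> -` (chart_map c ` (V \<inter> chart_dom e))" by auto
      finally show ?thesis using continuous_open_preimage[OF h(6) W oc] by simp
    qed
    have "smooth_on (chart_map d ` (V \<inter> chart_dom e)) (transition d e)"
    proof (rule smooth_on_cong[OF _ od])
      show "smooth_on (chart_map d ` (V \<inter> chart_dom e)) (\<lambda>y. transition c e (\<Theta> y))"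
        by (rule smooth_on_compose[OF smooth_transition[OF c e] smooth_on_subset[OF sm(2) _ W od] od open_chart_overlap[OF c e]])
          (use V h cV in \<open>auto simp: map V_def\<close>)
      show "transition c e (\<Theta> y) = transition d e y" if "y \<in> chart_map d ` (V \<inter> chart_dom e)" for y
        using that c V(2) h(3) by (auto simp: map transition_def inv) (simp add: V_def)
    qed
    moreover have "smooth_on (chart_map e ` (V \<inter> chart_dom e)) (transition e d)"
    proof (rule smooth_on_cong[OF _ oe])
      show "smooth_on (chart_map e ` (V \<inter> chart_dom e)) (\<lambda>y. \<Psi> (transition e c y))"
        by (rule smooth_on_compose[OF sm(1) smooth_on_subset[OF smooth_transition[OF e c] _ open_chart_overlap[OF e c] oe] oe V0(1)])
          (use V e in \<open>auto simp: V_def\<close>)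
      show "\<Psi> (transition e c y) = transition e d y" for y
        by (simp add: transition_def map)
    qed
    ultimately show "compatible_charts d e"
      by (simp add: compatible_charts_def dom Int_commute)
  qed
  then show ?thesis by (simp add: d_def V_def)
qed

end

section \<open>The symplectic form in a chart\<close>

context symplectic_manifold
begin

lemma form_rep_bilinear:
  assumes c: "c \<in> A" and z: "z \<in> chart_img c"
  shows "bilinear (form_rep A \<omega> c z)" and "form_rep A \<omega> c z a a = 0"
proof -
  define q where "q = chart_inv c z"
  have q: "q \<in> topspace T" "c \<in> charts_at A q"
    using c chart_inv_in_dom[OF z] cover by (auto simp: q_def charts_at_def)
  have alt: "alternating_bilinear_on (tangent_space A q) (\<omega> q)"
    using smooth_form q(1) by (simp add: smooth_two_form_def)
  note tv = tangent_vector_in_tangent_space[OF q(2)] tangent_vector_linear[OF q(2)]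
  have l: "form_rep A \<omega> c z (r *\<^sub>R a + s *\<^sub>R b) e = r * form_rep A \<omega> c z a e + s * form_rep A \<omega> c z b e"
    and r: "form_rep A \<omega> c z e (r *\<^sub>R a + s *\<^sub>R b) = r * form_rep A \<omega> c z e a + s * form_rep A \<omega> c z e b" for r s a b e
    using alt unfolding form_rep_def q_def[symmetric] alternating_bilinear_on_def tv(2) using tv(1) by blast+
  show "bilinear (form_rep A \<omega> c z)"
    unfolding bilinear_def
  proof (intro conjI allI linearI)
    fix a b e :: 'e and s :: real
    show "form_rep A \<omega> c z (a + b) e = form_rep A \<omega> c z a e + form_rep A \<omega> c z b e" using l[of 1 a 1 b] by simp
    show "form_rep A \<omega> c z e (a + b) = form_rep A \<omega> c z e a + form_rep A \<omega> c z e b" using r[of e 1 a 1 b] by simp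
    show "form_rep A \<omega> c z (s *\<^sub>R a) e = s *\<^sub>R form_rep A \<omega> c z a e" using l[of s a 0 0] by simp
    show "form_rep A \<omega> c z e (s *\<^sub>R a) = s *\<^sub>R form_rep A \<omega> c z e a" using r[of e s a 0 0] by simp
  qed
  show "form_rep A \<omega> c z a a = 0"
    using alt tv(1) unfolding form_rep_def q_def[symmetric] alternating_bilinear_on_def by blast
qed

lemma form_rep_eq:
  assumes "c \<in> charts_at A q" "u \<in> tangent_space A q" "v \<in> tangent_space A q"
  shows "\<omega> q u v = form_rep A \<omega> c (chart_map c q) (u c) (v c)"
  using assms(1) tangent_vector_eq[OF assms(1,2)] tangent_vector_eq[OF assms(1,3)]
  by (simp add: form_rep_def charts_at_def)

text \<open>Every tangent vector at \<open>q\<close> is given by its representative in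
  \<open>c\<close>, so testing against all \<open>b\<close> is testing against the whole tangent
  space.\<close>

lemma form_rep_nondegenerate:
  assumes c: "c \<in> charts_at A q" and a: "\<And>b. form_rep A \<omega> c (chart_map c q) a b = 0"
  shows "a = 0"
proof -
  have q: "q \<in> topspace T" using c cover by (auto simp: charts_at_def)
  note tv = tangent_vector_in_tangent_space[OF c, of a]
  have "\<forall>v\<in>tangent_space A q. \<omega> q (tangent_vector A c q a) v = 0"
    using form_rep_eq[OF c tv] a by (simp add: tangent_vector_same[OF c])
  then have "tangent_vector A c q a = (\<lambda>c. 0)"
    using nondegenerate q tv unfolding nondegenerate_two_form_def by blast
  then show ?thesis using tangent_vector_same[OF c, of a] by simp
qed

end

theorem theorem2p1:
  fixes T :: "'a topology"
    and A :: "('a, 'e::euclidean_space) chart set"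
    and \<omega> :: "('a, 'e) two_form"
    and n :: nat
  assumes "symplectic_manifold T A \<omega>"
    and "DIM('e) = 2 * n"
  shows "\<forall>p\<in>topspace T. \<exists>V (x :: nat \<Rightarrow> 'a \<Rightarrow> real) (y :: nat \<Rightarrow> 'a \<Rightarrow> real).
           openin T V \<and> p \<in> V \<and>
           (\<forall>j\<in>{1..n}. x j \<in> smooth_functions A V \<and> y j \<in> smooth_functions A V) \<and>
           coordinate_functions A V ({1..n} <+> {1..n}) (case_sum x y) \<and>
           (\<forall>q\<in>V. \<forall>u\<in>tangent_space A q. \<forall>v\<in>tangent_space A q.
              \<omega> q u v = (\<Sum>j=1..n. wedge (differential A (x j)) (differential A (y j)) q u v))"
proof
  interpret symplectic_manifold T A \<omega> by (rule assms(1))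
  let ?I = "{1..n} <+> {1..n}"
  \<comment> \<open>Both sets have \<open>2 * n\<close> elements. Left indices will label the
    \<open>x\<close> coordinates and right indices the \<open>y\<close> coordinates.\<close>
  have "\<exists>b :: nat + nat \<Rightarrow> 'e. bij_betw b ?I Basis"
    by (rule finite_same_card_bij) (use assms(2) in \<open>auto simp: card_Plus\<close>)
  then obtain b :: "nat + nat \<Rightarrow> 'e" where b: "bij_betw b ?I Basis" by blast
  fix p assume "p \<in> topspace T"
  then obtain c where c: "c \<in> A" "p \<in> chart_dom c" using cover by blast
  have cp: "c \<in> charts_at A p" using c by (simp add: charts_at_def)
  have coeff_smooth: "smooth_on (chart_img c) (\<lambda>z. form_rep A \<omega> c z u v)" for u v
    using smooth_form c(1) by (simp add: smooth_two_form_def)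
  have coeff_closed: "ext_deriv (form_rep A \<omega> c) z u v w = 0" if "z \<in> chart_img c" for z u v w
    using closed_form c(1) that by (simp add: closed_two_form_def)
  obtain V0 W \<Psi> \<Theta> where V0: "open V0" "chart_map c p \<in> V0" "V0 \<subseteq> chart_img c" and W: "open W"
    and hom: "homeomorphism V0 W \<Psi> \<Theta>" and sm: "smooth_on V0 \<Psi>" "smooth_on W \<Theta>"
    and normal: "\<And>z D u v. z \<in> V0 \<Longrightarrow> (\<Psi> has_derivative D) (at z) \<Longrightarrow> form_rep A \<omega> c z u v =
      (\<Sum>j=1..n. (D u \<bullet> b (Inl j)) * (D v \<bullet> b (Inr j)) - (D v \<bullet> b (Inl j)) * (D u \<bullet> b (Inr j)))"
    by (rule darboux_local[OF chart_img_open[OF c(1)] chart_map_in_img[OF c(2)] form_rep_bilinear[OF c(1)]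
          coeff_smooth coeff_closed form_rep_nondegenerate[OF cp] assms(2) b]) (assumption | rule that)+
  define V where "V = {q \<in> chart_dom c. chart_map c q \<in> V0}"
  define d where "d = (V, \<lambda>q. \<Psi> (chart_map c q))"
  have dA: "d \<in> A" unfolding d_def V_def by (rule chart_compose[OF c(1) V0(1,3) W hom sm])
  define f where "f i q = \<Psi> (chart_map c q) \<bullet> b i" for i q
  have V: "openin T V" "V \<subseteq> chart_dom c" unfolding V_def using openin_chart_preimage[OF c(1) V0(1)] by auto
  have dom: "chart_dom d = V" and map: "chart_map d = (\<lambda>p. \<Psi> (chart_map c p))" by (simp_all add: d_def)
  have smooth: "f i \<in> smooth_functions A V" for i
    unfolding smooth_functions_def mem_Collect_eq
  proof
    fix e assume e: "e \<in> A"
    have "smooth_on (chart_map e ` (chart_dom e \<inter> V)) (\<lambda>z. transition e d z \<bullet> b i)"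
      using smooth_transition[OF e dA] open_chart_overlap[OF e dA] unfolding dom
      by (rule smooth_on_linear[OF bounded_linear_inner_left])
    then show "smooth_on (chart_map e ` (chart_dom e \<inter> V)) (f i \<circ> chart_inv e)"
      by (simp add: f_def transition_def map o_def)
  qed
  have coord: "coordinate_functions A V ?I f"
  proof -
    have "(\<Sum>i\<in>?I. f i q *\<^sub>R b i) = \<Psi> (chart_map c q)" for q
    proof -
      have "(\<Sum>i\<in>?I. f i q *\<^sub>R b i) = (\<Sum>e\<in>Basis. (\<Psi> (chart_map c q) \<bullet> e) *\<^sub>R e)"
        unfolding f_def by (rule sum.reindex_bij_betw[OF b])
      then show ?thesis by (simp add: euclidean_representation)
    qed
    then show ?thesis using b dA unfolding coordinate_functions_def d_def by auto
  qed
  have form: "\<omega> q u v = (\<Sum>j=1..n. wedge (differential A (f (Inl j))) (differential A (f (Inr j))) q u v)"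
    if q: "q \<in> V" and u: "u \<in> tangent_space A q" and v: "v \<in> tangent_space A q" for q u v
  proof -
    have cq: "c \<in> charts_at A q" and q0: "chart_map c q \<in> V0" using q c(1) by (auto simp: V_def charts_at_def)
    let ?D = "frechet_derivative \<Psi> (at (chart_map c q))"
    have D: "(\<Psi> has_derivative ?D) (at (chart_map c q))"
      by (rule smooth_on_has_derivative[OF sm(1) q0])
    \<comment> \<open>Each coordinate differential is a component of the derivative of
      \<open>\<Psi>\<close> in the old chart \<open>c\<close>, so the normal form there becomes the
      sum of wedge products term by term.\<close>
    have df: "differential A (f i) q w = ?D (w c) \<bullet> b i" if "w \<in> tangent_space A q" for i w
      by (rule differential_chart[OF cq V0(1) q0 V0(3) bounded_linear.has_derivative[OF bounded_linear_inner_left D] _ that])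
        (simp add: f_def)
    show ?thesis
      unfolding form_rep_eq[OF cq u v] normal[OF q0 D] wedge_def df[OF u] df[OF v] ..
  qed
  show "\<exists>V (x :: nat \<Rightarrow> 'a \<Rightarrow> real) (y :: nat \<Rightarrow> 'a \<Rightarrow> real).
           openin T V \<and> p \<in> V \<and>
           (\<forall>j\<in>{1..n}. x j \<in> smooth_functions A V \<and> y j \<in> smooth_functions A V) \<and>
           coordinate_functions A V ?I (case_sum x y) \<and>
           (\<forall>q\<in>V. \<forall>u\<in>tangent_space A q. \<forall>v\<in>tangent_space A q.
              \<omega> q u v = (\<Sum>j=1..n. wedge (differential A (x j)) (differential A (y j)) q u v))"
  proof (rule exI[of _ V], rule exI[of _ "\<lambda>j. f (Inl j)"], rule exI[of _ "\<lambda>j. f (Inr j)"], intro conjI)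
    have "case_sum (\<lambda>j. f (Inl j)) (\<lambda>j. f (Inr j)) = f" by (auto split: sum.split)
    then show "coordinate_functions A V ?I (case_sum (\<lambda>j. f (Inl j)) (\<lambda>j. f (Inr j)))"
      using coord by simp
    show "p \<in> V" using c(2) V0(2) by (simp add: V_def)
  qed (use V(1) smooth form in blast)+
qed

end
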